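(* Let $E$ be a faithful $W^*$-correspondence over a $W^*$-algebra $\mathcal{B}$, and let $(\sigma_0,\sigma)$ be a normal faithful representation of $E$ on a Hilbert space $G$. Then $(\sigma_0,\sigma)$ admits a nondegenerate extension; that is, there exist a Hilbert space $H\supset G$ and a normal nondegenerate (faithful) representation $(\tau_0,\tau)$ of $E$ on $H$ such that $\tau(x)g=\sigma(x)g$ and $\tau_0(b)g=\sigma_0(b)g$ for all $x\in E$, $b\in\mathcal{B}$ and $g\in G\subset H$.
   Context: A $W^*$-module over a $W^*$-algebra $\mathcal{B}$ is a self-dual Hilbert $\mathcal{B}$-module. A $W^*$-correspondence $E$ over $\mathcal{B}$ is a $W^*$-module over $\mathcal{B}$ with a nondegenerate left action of $\mathcal{B}$ by adjointable operators such that all maps $b\mapsto\langle x,bx\rangle$, $x\in E$, are normal. It is faithful if the left action $\mathcal{B}\to B^a(E)$ is injective. A representation of $E$ on a Hilbert space $G$ is a pair $(\pi,\eta)$, where $\pi:\mathcal{B}\to B(G)$ is a nondegenerate representation of $\mathcal{B}$ and $\eta:E\to B(G)$ is a linear map with $\eta(bxb')=\pi(b)\eta(x)\pi(b')$ and $\eta(x)^*\eta(y)=\pi(\langle x,y\rangle)$. It is nondegenerate if $\overline{\mathrm{span}}\,\eta(E)G=G$, faithful if $\pi$ is injective (then $\eta$ is injective, too), and normal if $\pi$ is normal (then $\eta$ is normal, too). *)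

theory Defs
  imports "HOL-Analysis.Analysis"
begin

section \<open>Complex Banach spaces, Hilbert spaces and C*-algebras\<close>

class complex_vector = real_vector +
  fixes scaleC :: "complex \<Rightarrow> 'a \<Rightarrow> 'a"  (infixr "*\<^sub>C" 75)
  assumes scaleC_add_right: "c *\<^sub>C (x + y) = c *\<^sub>C x + c *\<^sub>C y"
    and scaleC_add_left: "(c + d) *\<^sub>C x = c *\<^sub>C x + d *\<^sub>C x"
    and scaleC_scaleC: "c *\<^sub>C (d *\<^sub>C x) = (c * d) *\<^sub>C x"
    and scaleC_of_real: "complex_of_real r *\<^sub>C x = r *\<^sub>R x"

class complex_normed_vector = complex_vector + real_normed_vector +
  assumes norm_scaleC: "norm (c *\<^sub>C x) = cmod c * norm x"

class complex_banach = complex_normed_vector + banach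

text \<open>Inner products are conjugate linear in the first and linear in the second argument.\<close>

class complex_hilbert = complex_banach +
  fixes cinner :: "'a \<Rightarrow> 'a \<Rightarrow> complex"
  assumes cinner_commute: "cinner x y = cnj (cinner y x)"
    and cinner_add_right: "cinner x (y + z) = cinner x y + cinner x z"
    and cinner_scaleC_right: "cinner x (c *\<^sub>C y) = c * cinner x y"
    and cinner_self: "cinner x x = complex_of_real ((norm x)\<^sup>2)"

text \<open>No unit is required here: W*-algebras have one automatically, and the zero algebra is
  not excluded.\<close>

class cstar_algebra = complex_banach + real_normed_algebra +
  fixes star :: "'a \<Rightarrow> 'a"
  assumes mult_scaleC_left: "(c *\<^sub>C a) * b = c *\<^sub>C (a * b)"
    and mult_scaleC_right: "a * (c *\<^sub>C b) = c *\<^sub>C (a * b)"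
    and star_star: "star (star a) = a"
    and star_add: "star (a + b) = star a + star b"
    and star_scaleC: "star (c *\<^sub>C a) = cnj c *\<^sub>C star a"
    and star_mult: "star (a * b) = star b * star a"
    and norm_star_mult: "norm (star a * a) = (norm a)\<^sup>2"

instantiation complex :: complex_banach
begin
definition scaleC_complex_def: "c *\<^sub>C (x::complex) = c * x"
instance
  by standard (simp_all add: scaleC_complex_def algebra_simps norm_mult scaleR_conv_of_real)
end

instantiation blinfun :: (real_normed_vector, complex_normed_vector) complex_normed_vector
begin

definition scaleC_blinfun_def: "c *\<^sub>C f = Blinfun (\<lambda>x. c *\<^sub>C blinfun_apply f x)"

lemma bounded_linear_scaleC_right: "bounded_linear ((*\<^sub>C) c :: 'b \<Rightarrow> 'b)"
proof (rule bounded_linear_intro[where K = "cmod c"])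
  show "c *\<^sub>C (r *\<^sub>R x) = r *\<^sub>R (c *\<^sub>C x)" for r and x :: 'b
    by (metis scaleC_of_real scaleC_scaleC mult.commute)
qed (simp_all add: scaleC_add_right norm_scaleC mult.commute)

lemma scaleC_blinfun_apply: "blinfun_apply (c *\<^sub>C f) x = c *\<^sub>C blinfun_apply f x"
  for f :: "'a \<Rightarrow>\<^sub>L 'b"
  unfolding scaleC_blinfun_def
  by (subst bounded_linear_Blinfun_apply)
    (auto intro: bounded_linear_compose[OF bounded_linear_scaleC_right] blinfun.bounded_linear_right)

lemma norm_scaleC_blinfun_le: "norm (c *\<^sub>C f) \<le> cmod c * norm f" for f :: "'a \<Rightarrow>\<^sub>L 'b"
proof (rule norm_blinfun_bound)
  show "norm (blinfun_apply (c *\<^sub>C f) x) \<le> cmod c * norm f * norm x" for x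
    using mult_left_mono[OF norm_blinfun[of f x], of "cmod c"]
    by (simp add: scaleC_blinfun_apply norm_scaleC mult.assoc)
qed simp

instance
proof
  fix c d :: complex and f g :: "'a \<Rightarrow>\<^sub>L 'b" and r :: real
  show "c *\<^sub>C (f + g) = c *\<^sub>C f + c *\<^sub>C g"
    by (rule blinfun_eqI) (simp add: scaleC_blinfun_apply plus_blinfun.rep_eq scaleC_add_right)
  show "(c + d) *\<^sub>C f = c *\<^sub>C f + d *\<^sub>C f"
    by (rule blinfun_eqI) (simp add: scaleC_blinfun_apply plus_blinfun.rep_eq scaleC_add_left)
  show *: "c *\<^sub>C d *\<^sub>C f = (c * d) *\<^sub>C f" for c d :: complex
    by (rule blinfun_eqI) (simp add: scaleC_blinfun_apply scaleC_scaleC)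
  show **: "complex_of_real r *\<^sub>C f = r *\<^sub>R f" for r
    by (rule blinfun_eqI) (simp add: scaleC_blinfun_apply scaleR_blinfun.rep_eq scaleC_of_real)
  show "norm (c *\<^sub>C f) = cmod c * norm f"
  proof (cases "c = 0")
    case True
    then show ?thesis using norm_scaleC_blinfun_le[of 0 f] by simp
  next
    case False
    have "f = inverse c *\<^sub>C c *\<^sub>C f"
      using False **[of 1] by (simp add: *)
    then have "norm f \<le> cmod (inverse c) * norm (c *\<^sub>C f)"
      using norm_scaleC_blinfun_le[of "inverse c" "c *\<^sub>C f"] by simp
    then have "cmod c * norm f \<le> norm (c *\<^sub>C f)"
      using False by (simp add: norm_inverse norm_divide field_simps)
    then show ?thesis using norm_scaleC_blinfun_le[of c f] by simp
  qed
qed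

end

section \<open>Square summable families\<close>

definition square_summable :: "('i \<Rightarrow> 'a::real_normed_vector) \<Rightarrow> bool" where
  "square_summable f \<longleftrightarrow> (\<lambda>i. (norm (f i))\<^sup>2) summable_on UNIV"

lemma square_summableI:
  assumes "\<And>F. finite F \<Longrightarrow> L2_set (\<lambda>i. norm (f i)) F \<le> B"
  shows "square_summable f"
  unfolding square_summable_def
proof (rule nonneg_bdd_above_summable_on)
  have "(\<Sum>i\<in>F. (norm (f i))\<^sup>2) \<le> B\<^sup>2" if "finite F" for F
    using assms[OF that] unfolding L2_set_def by (meson real_sqrt_le_iff' sqrt_le_D)
  then show "bdd_above (sum (\<lambda>i. (norm (f i))\<^sup>2) ` {F. F \<subseteq> UNIV \<and> finite F})"
    by (auto intro!: bdd_aboveI2)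
qed simp

lemma L2_set_le_infsum:
  assumes "square_summable f"
  shows "L2_set (\<lambda>i. norm (f i)) F \<le> sqrt (\<Sum>\<^sub>\<infinity>i. (norm (f i))\<^sup>2)"
proof (cases "finite F")
  case True
  then show ?thesis
    using finite_sum_le_infsum[OF assms[unfolded square_summable_def] True]
    unfolding L2_set_def by simp
qed (simp add: infsum_nonneg)

lemma infsum_le_L2_bound:
  assumes "\<And>F. finite F \<Longrightarrow> L2_set (\<lambda>i. norm (f i)) F \<le> B"
  shows "sqrt (\<Sum>\<^sub>\<infinity>i. (norm (f i))\<^sup>2) \<le> B"
proof -
  have "0 \<le> B" using assms[of "{}"] by simp
  have "(\<Sum>i\<in>F. (norm (f i))\<^sup>2) \<le> B\<^sup>2" if "finite F" for F
    using assms[OF that] unfolding L2_set_def by (meson real_sqrt_le_iff' sqrt_le_D)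
  then have "(\<Sum>\<^sub>\<infinity>i. (norm (f i))\<^sup>2) \<le> B\<^sup>2"
    using square_summableI[OF assms] infsum_le_finite_sums unfolding square_summable_def by blast
  then show ?thesis using \<open>0 \<le> B\<close> by (simp add: real_le_lsqrt)
qed

lemma L2_set_norm_add_le:
  "L2_set (\<lambda>i. norm (f i + g i)) F \<le> L2_set (\<lambda>i. norm (f i)) F + L2_set (\<lambda>i. norm (g i)) F"
  by (rule order_trans[OF L2_set_mono L2_set_triangle_ineq]) (auto intro: norm_triangle_ineq)

lemma square_summable_add:
  assumes "square_summable f" "square_summable g"
  shows "square_summable (\<lambda>i. f i + g i)"
  by (rule square_summableI, rule order_trans[OF L2_set_norm_add_le])
    (rule add_mono[OF assms[THEN L2_set_le_infsum]])

lemma square_summable_mult: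
  assumes "square_summable f" "\<And>i. norm (g i) = c * norm (f i)"
  shows "square_summable g"
  using assms(1) summable_on_cmult_right[of "\<lambda>i. (norm (f i))\<^sup>2" UNIV "c\<^sup>2"]
  unfolding square_summable_def assms(2) power_mult_distrib by blast

lemma cinner_add_left: "cinner (x + y) z = cinner x z + cinner y z"
  by (metis cinner_commute cinner_add_right complex_cnj_add)

lemma cinner_scaleC_left: "cinner (c *\<^sub>C x) y = cnj c * cinner x y"
  by (metis cinner_commute cinner_scaleC_right complex_cnj_mult)

lemma cinner_cauchy_schwarz: "cmod (cinner x y) \<le> norm x * norm y"
proof (cases "y = 0")
  case True
  have "cinner x 0 = 0" using cinner_add_right[of x 0 0] by simp
  then show ?thesis using True by simp
next
  case False
  define n where "n = complex_of_real ((norm y)\<^sup>2)"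
  define c where "c = - (cinner y x / n)"
  have n: "n \<noteq> 0" "cnj n = n" using False by (simp_all add: n_def)
  have "complex_of_real ((norm (x + c *\<^sub>C y))\<^sup>2) = cinner (x + c *\<^sub>C y) (x + c *\<^sub>C y)"
    by (rule cinner_self[symmetric])
  also have "\<dots> = cinner x x + c * cinner x y + cnj c * cinner y x + cnj c * c * n"
    by (simp add: cinner_add_left cinner_add_right cinner_scaleC_left cinner_scaleC_right
        cinner_self[of y] n_def algebra_simps)
  also have "\<dots> = cinner x x - cinner x y * cinner y x / n"
    using n cinner_commute[of x y] by (simp add: c_def field_simps)
  also have "cinner x y * cinner y x = complex_of_real ((cmod (cinner x y))\<^sup>2)"
    by (metis cinner_commute complex_norm_square of_real_power)
  also have "cinner x x - complex_of_real ((cmod (cinner x y))\<^sup>2) / n =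
      complex_of_real ((norm x)\<^sup>2 - (cmod (cinner x y))\<^sup>2 / (norm y)\<^sup>2)"
    by (simp add: cinner_self n_def)
  finally have "(norm (x + c *\<^sub>C y))\<^sup>2 = (norm x)\<^sup>2 - (cmod (cinner x y))\<^sup>2 / (norm y)\<^sup>2"
    using of_real_eq_iff by blast
  then have "(cmod (cinner x y))\<^sup>2 / (norm y)\<^sup>2 \<le> (norm x)\<^sup>2"
    by (metis diff_ge_0_iff_ge zero_le_power2)
  then have "(cmod (cinner x y))\<^sup>2 \<le> (norm x * norm y)\<^sup>2"
    using False by (simp add: divide_le_eq power_mult_distrib)
  then show ?thesis by (rule power2_le_imp_le) simp
qed

lemma summable_cinner:
  assumes "square_summable f" "square_summable g"
  shows "(\<lambda>i. cinner (f i) (g i)) summable_on UNIV"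
proof -
  have "(\<lambda>i. (norm (f i))\<^sup>2 + (norm (g i))\<^sup>2) summable_on UNIV"
    using assms unfolding square_summable_def by (rule summable_on_add)
  moreover have "norm (cinner (f i) (g i)) \<le> (norm (f i))\<^sup>2 + (norm (g i))\<^sup>2" for i
  proof -
    have "2 * (norm (f i) * norm (g i)) \<le> (norm (f i))\<^sup>2 + (norm (g i))\<^sup>2"
      using sum_squares_bound[of "norm (f i)" "norm (g i)"] by simp
    moreover have "0 \<le> norm (f i) * norm (g i)" by simp
    ultimately show ?thesis using cinner_cauchy_schwarz[of "f i" "g i"] by linarith
  qed
  ultimately have "(\<lambda>i. norm (cinner (f i) (g i))) summable_on UNIV"
    by (rule Infinite_Sum.abs_summable_on_comparison_test')
  then show ?thesis by (rule abs_summable_summable)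
qed

text \<open>The Hilbert space of square summable families \<open>'i \<Rightarrow> 'a\<close>, that is, the Hilbert space
  tensor product of \<open>'a\<close> and \<open>\<ell>\<^sup>2('i)\<close>.\<close>

typedef (overloaded) ('i, 'a) ell2 = "{f :: 'i \<Rightarrow> 'a::complex_hilbert. square_summable f}"
  morphisms ell2_apply Ell2
  by (rule exI[of _ "\<lambda>_. 0"]) (simp add: square_summable_def)

setup_lifting type_definition_ell2

lemma square_summable_ell2_apply: "square_summable (ell2_apply f)"
  using ell2_apply by blast

instantiation ell2 :: (type, complex_hilbert) complex_vector
begin

lift_definition zero_ell2 :: "('a, 'b) ell2" is "\<lambda>_. 0"
  by (simp add: square_summable_def)

lift_definition plus_ell2 :: "('a, 'b) ell2 \<Rightarrow> ('a, 'b) ell2 \<Rightarrow> ('a, 'b) ell2"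
  is "\<lambda>f g i. f i + g i"
  by (rule square_summable_add)

lift_definition uminus_ell2 :: "('a, 'b) ell2 \<Rightarrow> ('a, 'b) ell2" is "\<lambda>f i. - f i"
  by (erule square_summable_mult[where c = 1]) simp

lift_definition minus_ell2 :: "('a, 'b) ell2 \<Rightarrow> ('a, 'b) ell2 \<Rightarrow> ('a, 'b) ell2"
  is "\<lambda>f g i. f i - g i"
  unfolding diff_conv_add_uminus
  by (rule square_summable_add, assumption, erule square_summable_mult[where c = 1]) simp

lift_definition scaleR_ell2 :: "real \<Rightarrow> ('a, 'b) ell2 \<Rightarrow> ('a, 'b) ell2"
  is "\<lambda>r f i. r *\<^sub>R f i"
  subgoal for r f by (erule square_summable_mult[where c = "\<bar>r\<bar>"]) simp
  done

lift_definition scaleC_ell2 :: "complex \<Rightarrow> ('a, 'b) ell2 \<Rightarrow> ('a, 'b) ell2"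
  is "\<lambda>c f i. c *\<^sub>C f i"
  subgoal for c f by (erule square_summable_mult[where c = "cmod c"]) (simp add: norm_scaleC)
  done

instance
proof
  fix f g h :: "('a, 'b) ell2" and r s :: real and c d :: complex
  show "f + g + h = f + (g + h)" by transfer (simp add: add.assoc)
  show "f + g = g + f" by transfer (simp add: add.commute)
  show "0 + f = f" by transfer simp
  show "- f + f = 0" by transfer simp
  show "f - g = f + - g" by transfer simp
  show "r *\<^sub>R (f + g) = r *\<^sub>R f + r *\<^sub>R g" by transfer (simp add: scaleR_add_right)
  show "(r + s) *\<^sub>R f = r *\<^sub>R f + s *\<^sub>R f" by transfer (simp add: scaleR_add_left)
  show "r *\<^sub>R s *\<^sub>R f = (r * s) *\<^sub>R f" by transfer simp
  show "1 *\<^sub>R f = f" by transfer simp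
  show "c *\<^sub>C (f + g) = c *\<^sub>C f + c *\<^sub>C g" by transfer (simp add: scaleC_add_right)
  show "(c + d) *\<^sub>C f = c *\<^sub>C f + d *\<^sub>C f" by transfer (simp add: scaleC_add_left)
  show "c *\<^sub>C d *\<^sub>C f = (c * d) *\<^sub>C f" by transfer (simp add: scaleC_scaleC)
  show "complex_of_real r *\<^sub>C f = r *\<^sub>R f" by transfer (simp add: scaleC_of_real)
qed

end

instantiation ell2 :: (type, complex_hilbert) complex_normed_vector
begin

lift_definition norm_ell2 :: "('a, 'b) ell2 \<Rightarrow> real"
  is "\<lambda>f. sqrt (\<Sum>\<^sub>\<infinity>i. (norm (f i))\<^sup>2)" .

definition sgn_ell2 :: "('a, 'b) ell2 \<Rightarrow> ('a, 'b) ell2" where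
  "sgn_ell2 f = f /\<^sub>R norm f"

definition dist_ell2 :: "('a, 'b) ell2 \<Rightarrow> ('a, 'b) ell2 \<Rightarrow> real" where
  "dist_ell2 f g = norm (f - g)"

definition uniformity_ell2 :: "(('a, 'b) ell2 \<times> ('a, 'b) ell2) filter" where
  "uniformity_ell2 = (INF e\<in>{0<..}. principal {(f, g). dist f g < e})"

definition open_ell2 :: "('a, 'b) ell2 set \<Rightarrow> bool" where
  "open_ell2 U \<longleftrightarrow> (\<forall>x\<in>U. eventually (\<lambda>(x', y). x' = x \<longrightarrow> y \<in> U) uniformity)"

instance
proof
  fix f g :: "('a, 'b) ell2" and r :: real and c :: complex
  show "(norm f = 0) = (f = 0)"
  proof (transfer, rule iffI)
    fix f :: "'a \<Rightarrow> 'b"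
    assume f: "square_summable f" and "sqrt (\<Sum>\<^sub>\<infinity>i. (norm (f i))\<^sup>2) = 0"
    then have "(\<Sum>\<^sub>\<infinity>i. (norm (f i))\<^sup>2) \<le> 0" by simp
    then have "(norm (f i))\<^sup>2 = 0" for i
      by (rule nonneg_infsum_le_0D[OF _ f[unfolded square_summable_def]]) simp_all
    then show "f = (\<lambda>_. 0)" by auto
  qed simp
  show "norm (f + g) \<le> norm f + norm g"
    by transfer (rule infsum_le_L2_bound, rule order_trans[OF L2_set_norm_add_le],
        rule add_mono; rule L2_set_le_infsum)
  have scale: "sqrt (\<Sum>\<^sub>\<infinity>i. (\<bar>r\<bar> * norm (f i))\<^sup>2) = \<bar>r\<bar> * sqrt (\<Sum>\<^sub>\<infinity>i. (norm (f i))\<^sup>2)"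
    for r and f :: "'a \<Rightarrow> 'b"
    by (simp add: power_mult_distrib infsum_cmult_right' real_sqrt_mult)
  show "norm (r *\<^sub>R f) = \<bar>r\<bar> * norm f"
    by transfer (simp only: norm_scaleR scale)
  show "norm (c *\<^sub>C f) = cmod c * norm f"
    using scale[of "cmod c"] by transfer (simp add: norm_scaleC)
qed (rule sgn_ell2_def dist_ell2_def uniformity_ell2_def open_ell2_def)+

end

lemma L2_set_le_norm_ell2: "L2_set (\<lambda>i. norm (ell2_apply f i)) F \<le> norm f"
  unfolding norm_ell2.rep_eq by (rule L2_set_le_infsum[OF square_summable_ell2_apply])

lemma norm_ell2_leI:
  assumes "\<And>F. finite F \<Longrightarrow> L2_set (\<lambda>i. norm (ell2_apply f i)) F \<le> B"
  shows "norm f \<le> B"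
  unfolding norm_ell2.rep_eq using assms by (rule infsum_le_L2_bound)

lemma norm_ell2_apply_le: "norm (ell2_apply f i) \<le> norm f"
  using L2_set_le_norm_ell2[of f "{i}"] by simp

instance ell2 :: (type, complex_hilbert) complex_banach
proof
  fix X :: "nat \<Rightarrow> ('a, 'b) ell2"
  assume X: "Cauchy X"
  have "Cauchy (\<lambda>n. ell2_apply (X n) i)" for i
  proof (rule CauchyI)
    fix e :: real assume "e > 0"
    then obtain M where "\<forall>m\<ge>M. \<forall>n\<ge>M. norm (X m - X n) < e"
      using CauchyD[OF X] by blast
    moreover have "norm (ell2_apply (X m) i - ell2_apply (X n) i) \<le> norm (X m - X n)" for m n
      using norm_ell2_apply_le[of "X m - X n" i] by (simp add: minus_ell2.rep_eq)
    ultimately show "\<exists>M. \<forall>m\<ge>M. \<forall>n\<ge>M. norm (ell2_apply (X m) i - ell2_apply (X n) i) < e"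
      by (meson le_less_trans)
  qed
  then have "convergent (\<lambda>n. ell2_apply (X n) i)" for i
    by (rule Cauchy_convergent)
  moreover define l where "l i = lim (\<lambda>n. ell2_apply (X n) i)" for i
  ultimately have l: "(\<lambda>n. ell2_apply (X n) i) \<longlonglongrightarrow> l i" for i
    by (simp only: convergent_LIMSEQ_iff)
  have close: "L2_set (\<lambda>i. norm (ell2_apply (X m) i - l i)) F \<le> e"
    if "\<forall>m\<ge>M. \<forall>n\<ge>M. norm (X m - X n) < e" "m \<ge> M" for m M e F
  proof (rule LIMSEQ_le_const2)
    show "(\<lambda>n. L2_set (\<lambda>i. norm (ell2_apply (X m) i - ell2_apply (X n) i)) F)
        \<longlonglongrightarrow> L2_set (\<lambda>i. norm (ell2_apply (X m) i - l i)) F"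
      unfolding L2_set_def by (intro tendsto_intros l)
    show "\<exists>N. \<forall>n\<ge>N. L2_set (\<lambda>i. norm (ell2_apply (X m) i - ell2_apply (X n) i)) F \<le> e"
    proof (intro exI allI impI)
      fix n assume "n \<ge> M"
      then have "norm (X m - X n) \<le> e" using that by (simp add: less_imp_le)
      then show "L2_set (\<lambda>i. norm (ell2_apply (X m) i - ell2_apply (X n) i)) F \<le> e"
        using L2_set_le_norm_ell2[of "X m - X n" F] by (simp add: minus_ell2.rep_eq)
    qed
  qed
  obtain M where M: "\<forall>m\<ge>M. \<forall>n\<ge>M. norm (X m - X n) < 1"
    using CauchyD[OF X, of 1] by auto
  have "square_summable (\<lambda>i. ell2_apply (X M) i - l i)"
    by (rule square_summableI, rule close[OF M]) simp
  then have "square_summable (\<lambda>i. - (ell2_apply (X M) i - l i))"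
    by (rule square_summable_mult[where c = 1]) (simp only: norm_minus_cancel mult_1)
  from square_summable_add[OF square_summable_ell2_apply[of "X M"] this]
  have "square_summable l" by simp
  then have L: "ell2_apply (Ell2 l) = l" by (simp add: Ell2_inverse)
  have "X \<longlonglongrightarrow> Ell2 l"
  proof (rule LIMSEQ_I)
    fix e :: real assume "e > 0"
    then obtain M where M: "\<forall>m\<ge>M. \<forall>n\<ge>M. norm (X m - X n) < e / 2"
      using CauchyD[OF X, of "e / 2"] by auto
    have "norm (X m - Ell2 l) < e" if "m \<ge> M" for m
    proof -
      have "norm (X m - Ell2 l) \<le> e / 2"
        by (rule norm_ell2_leI) (simp only: minus_ell2.rep_eq L close[OF M that])
      then show ?thesis using \<open>e > 0\<close> by simp
    qed
    then show "\<exists>M. \<forall>m\<ge>M. norm (X m - Ell2 l) < e" by blast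
  qed
  then show "convergent X" by (rule convergentI)
qed

instantiation ell2 :: (type, complex_hilbert) complex_hilbert
begin

lift_definition cinner_ell2 :: "('a, 'b) ell2 \<Rightarrow> ('a, 'b) ell2 \<Rightarrow> complex"
  is "\<lambda>f g. \<Sum>\<^sub>\<infinity>i. cinner (f i) (g i)" .

instance
proof
  fix f g h :: "('a, 'b) ell2" and c :: complex
  show "cinner f g = cnj (cinner g f)"
    by transfer (subst infsum_cnj[symmetric], rule infsum_cong, rule cinner_commute)
  show "cinner f (g + h) = cinner f g + cinner f h"
    by transfer (simp add: cinner_add_right infsum_add summable_cinner)
  show "cinner f (c *\<^sub>C g) = c * cinner f g"
    by transfer (simp add: cinner_scaleC_right infsum_cmult_right')
  show "cinner f f = complex_of_real ((norm f)\<^sup>2)"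
  proof transfer
    fix f :: "'a \<Rightarrow> 'b"
    assume "square_summable f"
    then have "((\<lambda>i. (norm (f i))\<^sup>2) has_sum (\<Sum>\<^sub>\<infinity>i. (norm (f i))\<^sup>2)) UNIV"
      unfolding square_summable_def by (rule has_sum_infsum)
    then have "((\<lambda>i. complex_of_real ((norm (f i))\<^sup>2)) has_sum
        complex_of_real (\<Sum>\<^sub>\<infinity>i. (norm (f i))\<^sup>2)) UNIV"
      by (rule has_sum_of_real)
    then show "(\<Sum>\<^sub>\<infinity>i. cinner (f i) (f i)) =
        complex_of_real ((sqrt (\<Sum>\<^sub>\<infinity>i. (norm (f i))\<^sup>2))\<^sup>2)"
      by (simp only: cinner_self infsumI real_sqrt_pow2 infsum_nonneg zero_le_power2)
  qed
qed

end


section \<open>Subspaces and linear maps\<close>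

definition csubspace :: "'a::complex_vector set \<Rightarrow> bool" where
  "csubspace S \<longleftrightarrow> 0 \<in> S \<and> (\<forall>x\<in>S. \<forall>y\<in>S. x + y \<in> S) \<and> (\<forall>c. \<forall>x\<in>S. c *\<^sub>C x \<in> S)"

definition cspan :: "'a::complex_vector set \<Rightarrow> 'a set" where
  "cspan S = csubspace hull S"

definition clinear_on :: "'a::complex_vector set \<Rightarrow> ('a \<Rightarrow> 'b::complex_vector) \<Rightarrow> bool" where
  "clinear_on S f \<longleftrightarrow>
     (\<forall>x\<in>S. \<forall>y\<in>S. f (x + y) = f x + f y) \<and> (\<forall>c. \<forall>x\<in>S. f (c *\<^sub>C x) = c *\<^sub>C f x)"

definition bounded_clinear_on ::
    "'a::complex_normed_vector set \<Rightarrow> ('a \<Rightarrow> 'b::complex_normed_vector) \<Rightarrow> bool" where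
  "bounded_clinear_on S f \<longleftrightarrow>
     clinear_on S f \<and> (\<exists>M. \<forall>x\<in>S. norm (f x) \<le> M * norm x)"


section \<open>W*-algebras and normal maps\<close>

text \<open>A W*-algebra is a C*-algebra which, as a Banach space, is isometrically isomorphic to the
  dual of a Banach space. Such a predual embeds canonically into the dual of the algebra, hence
  can be taken to be a closed space \<open>P\<close> of bounded complex linear functionals, the isomorphism
  from the algebra to the dual of \<open>P\<close> being evaluation. (By Sakai's theorem \<open>P\<close> is unique.)
  The type \<open>'b \<Rightarrow>\<^sub>L complex\<close> consists of the bounded real linear maps; complex linearity is
  imposed separately.\<close>

definition predual :: "('b::cstar_algebra \<Rightarrow>\<^sub>L complex) set \<Rightarrow> bool" where
  "predual P \<longleftrightarrow>
     (\<forall>\<phi>\<in>P. clinear_on UNIV (blinfun_apply \<phi>)) \<and> csubspace P \<and> closed P \<and>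
     (\<forall>b. norm b = (SUP \<phi>\<in>{\<phi>\<in>P. norm \<phi> \<le> 1}. cmod (blinfun_apply \<phi> b))) \<and>
     (\<forall>F::('b \<Rightarrow>\<^sub>L complex) \<Rightarrow> complex.
        bounded_clinear_on P F \<longrightarrow> (\<exists>b. \<forall>\<phi>\<in>P. F \<phi> = blinfun_apply \<phi> b))"

text \<open>The coarsest topology making all functions in \<open>F\<close> continuous.\<close>

definition weak_topology :: "('a \<Rightarrow> complex) set \<Rightarrow> 'a topology" where
  "weak_topology F = topology_generated_by {\<phi> -` U | \<phi> U. \<phi> \<in> F \<and> open U}"

text \<open>The \<open>\<sigma>\<close>-weak topology (weak* topology) of a W*-algebra with predual \<open>P\<close>.
  Normal maps are the \<open>\<sigma>\<close>-weakly continuous ones.\<close>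

abbreviation sigma_weak :: "('b::cstar_algebra \<Rightarrow>\<^sub>L complex) set \<Rightarrow> 'b topology" where
  "sigma_weak P \<equiv> weak_topology (blinfun_apply ` P)"

text \<open>Hilbert spaces occur as closed subspaces of types of class \<open>complex_hilbert\<close>, so that
  they can be quantified over. Operators on such a subspace \<open>H\<close> are functions on the whole type
  of which only the restriction to \<open>H\<close> matters.\<close>

definition hilbert_space :: "'h::complex_hilbert set \<Rightarrow> bool" where
  "hilbert_space H \<longleftrightarrow> csubspace H \<and> closed H"

definition bounded_operators :: "'h::complex_hilbert set \<Rightarrow> ('h \<Rightarrow> 'h) set" where
  "bounded_operators H = {T. T ` H \<subseteq> H \<and> bounded_clinear_on H T}"

definition operator_sigma_weak :: "'h::complex_hilbert set \<Rightarrow> ('h \<Rightarrow> 'h) topology" where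
  "operator_sigma_weak H =
     subtopology
       (weak_topology {\<lambda>T. \<Sum>n. cinner (g n) (T (h n)) | g h :: nat \<Rightarrow> 'h.
          range g \<subseteq> H \<and> range h \<subseteq> H \<and>
          summable (\<lambda>n. (norm (g n))\<^sup>2) \<and> summable (\<lambda>n. (norm (h n))\<^sup>2)})
       (bounded_operators H)"


section \<open>W*-correspondences\<close>

text \<open>Completeness of \<open>E\<close> is part of the class \<open>complex_banach\<close>. An element of a C*-algebra is
  positive if it is of the form \<open>c\<^sup>*c\<close>.\<close>

locale hilbert_module =
  fixes rmult :: "'e::complex_banach \<Rightarrow> 'b::cstar_algebra \<Rightarrow> 'e"
    and ip :: "'e \<Rightarrow> 'e \<Rightarrow> 'b"
  assumes rmult_add_left: "rmult (x + y) b = rmult x b + rmult y b"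
    and rmult_add_right: "rmult x (b + b') = rmult x b + rmult x b'"
    and rmult_scaleC_left: "rmult (c *\<^sub>C x) b = c *\<^sub>C rmult x b"
    and rmult_scaleC_right: "rmult x (c *\<^sub>C b) = c *\<^sub>C rmult x b"
    and rmult_rmult: "rmult (rmult x b) b' = rmult x (b * b')"
    and ip_add_right: "ip x (y + z) = ip x y + ip x z"
    and ip_scaleC_right: "ip x (c *\<^sub>C y) = c *\<^sub>C ip x y"
    and ip_rmult_right: "ip x (rmult y b) = ip x y * b"
    and star_ip: "star (ip x y) = ip y x"
    and ip_positive: "\<exists>c. ip x x = star c * c"
    and ip_definite: "ip x x = 0 \<Longrightarrow> x = 0"
    and norm_eq_ip: "norm x = sqrt (norm (ip x x))"

locale wstar_module = hilbert_module rmult ip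
  for P :: "('b::cstar_algebra \<Rightarrow>\<^sub>L complex) set"
    and rmult :: "'e::complex_banach \<Rightarrow> 'b \<Rightarrow> 'e"
    and ip :: "'e \<Rightarrow> 'e \<Rightarrow> 'b" +
  assumes predual: "predual P"
    and self_dual: "\<And>\<Phi> :: 'e \<Rightarrow> 'b. bounded_clinear_on UNIV \<Phi> \<Longrightarrow>
      (\<And>x b. \<Phi> (rmult x b) = \<Phi> x * b) \<Longrightarrow> \<exists>y. \<forall>x. \<Phi> x = ip y x"

text \<open>The left action is a *-homomorphism from the algebra into the adjointable operators. By
  \<open>ip_lmult\<close> the operator \<open>lmult b\<close> has the adjoint \<open>lmult (star b)\<close>; in particular
  it is linear, commutes with the right action, and is bounded.\<close>

locale wstar_correspondence = wstar_module P rmult ip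
  for P :: "('b::cstar_algebra \<Rightarrow>\<^sub>L complex) set"
    and lmult :: "'b \<Rightarrow> 'e::complex_banach \<Rightarrow> 'e"
    and rmult :: "'e \<Rightarrow> 'b \<Rightarrow> 'e"
    and ip :: "'e \<Rightarrow> 'e \<Rightarrow> 'b" +
  assumes lmult_add_left: "lmult (b + b') x = lmult b x + lmult b' x"
    and lmult_scaleC_left: "lmult (c *\<^sub>C b) x = c *\<^sub>C lmult b x"
    and lmult_lmult: "lmult b (lmult b' x) = lmult (b * b') x"
    and ip_lmult: "ip (lmult b x) y = ip x (lmult (star b) y)"
    and lmult_nondegenerate: "closure (cspan {lmult b x | b x. True}) = UNIV"
    and lmult_normal: "continuous_map (sigma_weak P) (sigma_weak P) (\<lambda>b. ip x (lmult b x))"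

locale faithful_wstar_correspondence = wstar_correspondence P lmult rmult ip
  for P :: "('b::cstar_algebra \<Rightarrow>\<^sub>L complex) set"
    and lmult :: "'b \<Rightarrow> 'e::complex_banach \<Rightarrow> 'e"
    and rmult :: "'e \<Rightarrow> 'b \<Rightarrow> 'e"
    and ip :: "'e \<Rightarrow> 'e \<Rightarrow> 'b" +
  assumes lmult_faithful: "inj lmult"


section \<open>Representations\<close>

locale algebra_representation =
  fixes H :: "'h::complex_hilbert set"
    and \<pi> :: "'b::cstar_algebra \<Rightarrow> 'h \<Rightarrow> 'h"
  assumes hilbert_space: "hilbert_space H"
    and pi_bounded: "\<pi> b \<in> bounded_operators H"
    and pi_add: "h \<in> H \<Longrightarrow> \<pi> (b + b') h = \<pi> b h + \<pi> b' h"
    and pi_scaleC: "h \<in> H \<Longrightarrow> \<pi> (c *\<^sub>C b) h = c *\<^sub>C \<pi> b h"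
    and pi_mult: "h \<in> H \<Longrightarrow> \<pi> (b * b') h = \<pi> b (\<pi> b' h)"
    and pi_star: "h \<in> H \<Longrightarrow> k \<in> H \<Longrightarrow> cinner (\<pi> (star b) h) k = cinner h (\<pi> b k)"
    and pi_nondegenerate: "closure (cspan {\<pi> b h | b h. h \<in> H}) = H"

text \<open>Assumption \<open>eta_ip\<close> is the equation \<open>\<eta>(x)\<^sup>*\<eta>(y) = \<pi>(\<langle>x,y\<rangle>)\<close>.\<close>

locale correspondence_representation = algebra_representation H \<pi>
  for lmult :: "'b::cstar_algebra \<Rightarrow> 'e::complex_banach \<Rightarrow> 'e"
    and rmult :: "'e \<Rightarrow> 'b \<Rightarrow> 'e"
    and ip :: "'e \<Rightarrow> 'e \<Rightarrow> 'b"
    and H :: "'h::complex_hilbert set"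
    and \<pi> :: "'b \<Rightarrow> 'h \<Rightarrow> 'h"
    and \<eta> :: "'e \<Rightarrow> 'h \<Rightarrow> 'h" +
  assumes eta_bounded: "\<eta> x \<in> bounded_operators H"
    and eta_add: "h \<in> H \<Longrightarrow> \<eta> (x + y) h = \<eta> x h + \<eta> y h"
    and eta_scaleC: "h \<in> H \<Longrightarrow> \<eta> (c *\<^sub>C x) h = c *\<^sub>C \<eta> x h"
    and eta_bimodule: "h \<in> H \<Longrightarrow> \<eta> (lmult b (rmult x b')) h = \<pi> b (\<eta> x (\<pi> b' h))"
    and eta_ip: "h \<in> H \<Longrightarrow> k \<in> H \<Longrightarrow> cinner (\<eta> x h) (\<eta> y k) = cinner h (\<pi> (ip x y) k)"

definition nondegenerate_rep :: "'h::complex_hilbert set \<Rightarrow> ('e \<Rightarrow> 'h \<Rightarrow> 'h) \<Rightarrow> bool" where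
  "nondegenerate_rep H \<eta> \<longleftrightarrow> closure (cspan {\<eta> x h | x h. h \<in> H}) = H"

definition faithful_rep :: "'h::complex_hilbert set \<Rightarrow> ('b \<Rightarrow> 'h \<Rightarrow> 'h) \<Rightarrow> bool" where
  "faithful_rep H \<pi> \<longleftrightarrow> inj (\<lambda>b. restrict (\<pi> b) H)"

definition normal_rep ::
    "('b::cstar_algebra \<Rightarrow>\<^sub>L complex) set \<Rightarrow> 'h::complex_hilbert set \<Rightarrow> ('b \<Rightarrow> 'h \<Rightarrow> 'h) \<Rightarrow> bool" where
  "normal_rep P H \<pi> \<longleftrightarrow> continuous_map (sigma_weak P) (operator_sigma_weak H) \<pi>"

text \<open>The identification of a Hilbert space \<open>G\<close> with a subspace of a Hilbert space \<open>H\<close> that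
  may live in a different type. Types cannot be quantified in HOL, so an extension space of \<open>G\<close>
  inside a type \<open>'g\<close> is to be found among the closed subspaces of \<open>(nat \<times> 'g, 'g) ell2\<close>, which
  contains \<open>G\<close> and all multiples of \<open>G\<close> of multiplicity up to the cardinality of \<open>nat \<times> 'g\<close>.\<close>

definition isometric_embedding ::
    "'g::complex_hilbert set \<Rightarrow> 'h::complex_hilbert set \<Rightarrow> ('g \<Rightarrow> 'h) \<Rightarrow> bool" where
  "isometric_embedding G H V \<longleftrightarrow> V ` G \<subseteq> H \<and> clinear_on G V \<and> (\<forall>g\<in>G. norm (V g) = norm g)"

end

theory Submission
  imports Defs
begin

text \<open>
  Let \<open>A\<close> be the closed span of \<open>\<sigma>(E)G\<close>. Since \<open>E\<close> is faithful, the algebra acts faithfully on \<open>A\<close>, and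
  then every nonzero submodule of \<open>G\<close> receives a nonzero intertwiner from \<open>A\<close>: otherwise a double
  commutant argument and the weak* compactness of the unit ball would produce an element of the
  algebra that vanishes on \<open>A\<close> but not on the submodule. By polar decomposition and Zorn's lemma, \<open>G\<close>
  embeds into a multiple of \<open>A\<close>. Hence, for the infinite amplifications \<open>G\<^sub>\<infinity>\<close> and
  \<open>A\<^sub>\<infinity> \<subseteq> G\<^sub>\<infinity>\<close>, there is an isometric intertwiner of \<open>G\<^sub>\<infinity>\<close> into \<open>A\<^sub>\<infinity>\<close> that fixes the
  zeroth copy of \<open>A\<close>, and a Schroeder--Bernstein argument yields a unitary intertwiner
  \<open>W : A\<^sub>\<infinity> \<rightarrow> G\<^sub>\<infinity>\<close> that fixes it as well. The extension is \<open>\<tau>(x) = W \<sigma>\<^sub>\<infinity>(x)\<close> on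
  \<open>H = G\<^sub>\<infinity>\<close>: it is nondegenerate because \<open>W\<close> is onto.
\<close>

section \<open>Projections in Hilbert spaces\<close>

text \<open>An isometry that commutes with the algebra can be put in front of
  \<open>\<sigma>\<close> without disturbing inner products or the bimodule relation, so only its
  range matters. Since \<open>\<sigma>\<close> takes its values in A, fixing one copy of A is
  exactly what makes the new representation an extension. G embeds only into a multiple of A;
  infinitely many copies absorb that multiple and still leave room for the fixed one. The main
  obstacle is norm control. The double commutant argument yields elements that nearly vanish on
  given vectors of A and nearly fix a given vector elsewhere, but their norms are uncontrolled,
  while weak* compactness needs a bound. Kaplansky's theorem is replaced by explicit bounded
  elements close to exp(ib/8) - 1, which require b to be self-adjoint. This is why real subspaces
  occur next to complex ones. On the fixed vector such an element acts like i/8, and this imaginary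
  part survives the weak* limit.\<close>

lemma scaleC_zero_left [simp]: "0 *\<^sub>C x = 0"
  using scaleC_of_real[of 0 x] by simp

lemma scaleC_zero_right [simp]: "c *\<^sub>C 0 = 0"
  using scaleC_add_right[of c 0 0] by simp

lemma scaleC_one [simp]: "1 *\<^sub>C x = x"
  using scaleC_of_real[of 1 x] by simp

lemma scaleC_minus_one [simp]: "(-1) *\<^sub>C x = - x"
  using scaleC_of_real[of "-1" x] by simp

lemma scaleC_minus_right [simp]: "c *\<^sub>C (- x) = - (c *\<^sub>C x)"
  using scaleC_add_right[of c x "- x"] by (simp add: eq_neg_iff_add_eq_0 add.commute)

lemma scaleC_diff_right: "c *\<^sub>C (x - y) = c *\<^sub>C x - c *\<^sub>C y"
  using scaleC_add_right[of c x "- y"] by simp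

lemma cinner_scaleR_right: "cinner x (r *\<^sub>R y) = r *\<^sub>R cinner x y"
  by (metis cinner_scaleC_right scaleC_of_real scaleR_conv_of_real)

lemma cinner_scaleR_left: "cinner (r *\<^sub>R x) y = r *\<^sub>R cinner x y"
  by (metis cinner_commute cinner_scaleR_right complex_cnj_scaleR)

text \<open>Conjugate linearity in the first argument is still real linearity, so the rules for
  limits, sums and differences of real bilinear maps apply.\<close>

interpretation cinner: bounded_bilinear "cinner :: 'a::complex_hilbert \<Rightarrow> 'a \<Rightarrow> complex"
  by unfold_locales (auto simp: cinner_add_left cinner_add_right cinner_scaleR_left
      cinner_scaleR_right intro!: exI[of _ 1] cinner_cauchy_schwarz)

declare cinner.zero_left [simp] cinner.zero_right [simp]

lemmas tendsto_scaleC_right = bounded_linear.tendsto[OF bounded_linear_scaleC_right]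

lemma Re_cinner_self: "Re (cinner x x) = (norm x)\<^sup>2"
  by (simp add: cinner_self)

lemma Re_cinner_commute: "Re (cinner x y) = Re (cinner y x)"
  by (subst cinner_commute) simp

lemma norm_add_sqr: "(norm (x + y))\<^sup>2 = (norm x)\<^sup>2 + (norm y)\<^sup>2 + 2 * Re (cinner x y)"
  for x y :: "'a::complex_hilbert"
  using Re_cinner_commute[of x y]
  by (simp add: Re_cinner_self[symmetric] cinner_add_left cinner_add_right)

lemma norm_diff_sqr: "(norm (x - y))\<^sup>2 = (norm x)\<^sup>2 + (norm y)\<^sup>2 - 2 * Re (cinner x y)"
  for x y :: "'a::complex_hilbert"
  using norm_add_sqr[of x "- y"] by (simp add: cinner.minus_right)

lemma cinner_eq_zero_comm: "cinner x y = 0 \<longleftrightarrow> cinner y x = 0"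
  by (metis cinner_commute complex_cnj_zero_iff)

lemma cinner_self_eq_zero [simp]: "cinner x x = 0 \<longleftrightarrow> x = 0"
  by (simp add: cinner_self)

text \<open>The choices c = 1 and c = \<i> recover the real and the imaginary part. Facts about real
  projections and polarised norms become complex in this way.\<close>

lemma cinner_eqI_Re:
  assumes "\<And>c. Re (cinner (c *\<^sub>C x) y) = Re (cinner (c *\<^sub>C x') y')"
  shows "cinner x y = cinner x' y'"
  using assms[of 1] assms[of \<i>] by (simp add: cinner_scaleC_left complex_eq_iff)

lemma norm_sum_orthogonal:
  fixes u :: "'i \<Rightarrow> 'a::complex_hilbert"
  assumes "finite F" "\<And>i j. i \<in> F \<Longrightarrow> j \<in> F \<Longrightarrow> i \<noteq> j \<Longrightarrow> cinner (u i) (u j) = 0"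
  shows "(norm (sum u F))\<^sup>2 = (\<Sum>i\<in>F. (norm (u i))\<^sup>2)"
  using assms
proof (induction F rule: finite_induct)
  case (insert i F)
  have "cinner (u i) (sum u F) = 0"
    using insert by (auto simp: cinner.sum_right intro!: sum.neutral)
  then show ?case using insert by (simp add: norm_add_sqr)
qed simp

section \<open>Subspaces, spans and closures\<close>

lemma csubspaceD:
  assumes "csubspace S"
  shows "0 \<in> S" "x \<in> S \<Longrightarrow> y \<in> S \<Longrightarrow> x + y \<in> S" "x \<in> S \<Longrightarrow> c *\<^sub>C x \<in> S"
    "x \<in> S \<Longrightarrow> - x \<in> S" "x \<in> S \<Longrightarrow> y \<in> S \<Longrightarrow> x - y \<in> S" "x \<in> S \<Longrightarrow> r *\<^sub>R x \<in> S"
proof -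
  show 1: "0 \<in> S" "\<And>x y. x \<in> S \<Longrightarrow> y \<in> S \<Longrightarrow> x + y \<in> S" "\<And>c x. x \<in> S \<Longrightarrow> c *\<^sub>C x \<in> S"
    using assms by (auto simp: csubspace_def)
  show 2: "- x \<in> S" if "x \<in> S" for x using 1(3)[OF that, of "-1"] by simp
  show "x \<in> S \<Longrightarrow> y \<in> S \<Longrightarrow> x - y \<in> S" using 1(2)[of x "- y"] 2[of y] by simp
  show "x \<in> S \<Longrightarrow> r *\<^sub>R x \<in> S" using 1(3)[of x "of_real r"] by (simp add: scaleC_of_real)
qed

lemma csubspace_sum: "csubspace S \<Longrightarrow> (\<And>i. i \<in> F \<Longrightarrow> u i \<in> S) \<Longrightarrow> sum u F \<in> S"
  by (induction F rule: infinite_finite_induct) (auto dest: csubspaceD)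

lemma csubspace_Inter: "(\<And>S. S \<in> \<S> \<Longrightarrow> csubspace S) \<Longrightarrow> csubspace (\<Inter>\<S>)"
  unfolding csubspace_def by blast

lemma csubspace_cspan: "csubspace (cspan S)"
  unfolding cspan_def by (rule hull_in) (auto intro: csubspace_Inter)

lemma cspan_superset: "S \<subseteq> cspan S"
  unfolding cspan_def by (rule hull_subset)

lemma cspan_minimal: "S \<subseteq> T \<Longrightarrow> csubspace T \<Longrightarrow> cspan S \<subseteq> T"
  unfolding cspan_def by (rule hull_minimal)

lemma csubspace_closure:
  fixes S :: "'a::complex_normed_vector set"
  assumes "csubspace S"
  shows "csubspace (closure S)"
  unfolding csubspace_def
proof (intro conjI ballI allI)
  show "0 \<in> closure S" using csubspaceD(1)[OF assms] closure_subset by blast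
next
  fix x y assume "x \<in> closure S" "y \<in> closure S"
  then obtain u v where "\<forall>n. u n \<in> S" "u \<longlonglongrightarrow> x" "\<forall>n. v n \<in> S" "v \<longlonglongrightarrow> y"
    unfolding closure_sequential by blast
  then show "x + y \<in> closure S"
    unfolding closure_sequential using csubspaceD[OF assms]
    by (intro exI[of _ "\<lambda>n. u n + v n"]) (auto intro: tendsto_add)
next
  fix c and x assume "x \<in> closure S"
  then obtain u where "\<forall>n. u n \<in> S" "u \<longlonglongrightarrow> x" unfolding closure_sequential by blast
  then show "c *\<^sub>C x \<in> closure S"
    unfolding closure_sequential using csubspaceD[OF assms]
    by (intro exI[of _ "\<lambda>n. c *\<^sub>C u n"]) (auto intro: tendsto_scaleC_right)
qed

lemma subspace_closure:
  fixes S :: "'a::real_normed_vector set"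
  assumes "subspace S"
  shows "subspace (closure S)"
  unfolding subspace_def
proof (intro conjI ballI allI)
  show "0 \<in> closure S" using subspace_0[OF assms] closure_subset by blast
next
  fix x y assume "x \<in> closure S" "y \<in> closure S"
  then obtain u v where "\<forall>n. u n \<in> S" "u \<longlonglongrightarrow> x" "\<forall>n. v n \<in> S" "v \<longlonglongrightarrow> y"
    unfolding closure_sequential by blast
  then show "x + y \<in> closure S"
    unfolding closure_sequential using subspace_add[OF assms]
    by (intro exI[of _ "\<lambda>n. u n + v n"]) (auto intro: tendsto_add)
next
  fix r and x assume "x \<in> closure S"
  then obtain u where "\<forall>n. u n \<in> S" "u \<longlonglongrightarrow> x" unfolding closure_sequential by blast
  then show "r *\<^sub>R x \<in> closure S"
    unfolding closure_sequential using subspace_scale[OF assms]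
    by (intro exI[of _ "\<lambda>n. r *\<^sub>R u n"]) (auto intro: tendsto_intros)
qed

lemma hilbert_spaceD:
  assumes "hilbert_space H"
  shows "csubspace H" "closed H"
  using assms by (auto simp: hilbert_space_def)

lemmas hilbert_space_mem = csubspaceD[OF hilbert_spaceD(1)]

lemma hilbert_space_closure:
  fixes S :: "'a::complex_hilbert set"
  shows "csubspace S \<Longrightarrow> hilbert_space (closure S)"
  by (simp add: hilbert_space_def csubspace_closure)

text \<open>Only real scalars are asked of S, because the self-adjoint elements of the algebra form
  just a real subspace; orthogonality is then a statement about real parts. By the parallelogram law
  a sequence minimising the distance is Cauchy.\<close>

lemma real_projection_exists:
  fixes S :: "'a::complex_hilbert set"
  assumes S: "closed S" "0 \<in> S" "\<And>x y. x \<in> S \<Longrightarrow> y \<in> S \<Longrightarrow> x + y \<in> S"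
    "\<And>r x. x \<in> S \<Longrightarrow> r *\<^sub>R x \<in> S"
  obtains p where "p \<in> S" "\<And>s. s \<in> S \<Longrightarrow> Re (cinner s (x - p)) = 0"
proof -
  define D where "D = (\<lambda>s. (norm (x - s))\<^sup>2) ` S"
  define d where "d = Inf D"
  have D: "D \<noteq> {}" "bdd_below D"
    using S(2) by (auto simp: D_def intro!: bdd_belowI2[of _ 0])
  have d_le: "d \<le> (norm (x - s))\<^sup>2" if "s \<in> S" for s
    unfolding d_def using D that by (intro cInf_lower) (auto simp: D_def)
  have "\<exists>s\<in>S. (norm (x - s))\<^sup>2 < d + inverse (real (Suc n))" for n
    using cInf_lessD[OF D(1), of "d + inverse (real (Suc n))"] unfolding d_def D_def by auto
  then obtain s where s: "\<And>n. s n \<in> S"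
    "\<And>n. (norm (x - s n))\<^sup>2 < d + inverse (real (Suc n))" by metis
  have close: "(norm (s m - s n))\<^sup>2 \<le> 2 * inverse (real (Suc m)) + 2 * inverse (real (Suc n))" for m n
  proof -
    have "(1/2) *\<^sub>R (s m + s n) \<in> S" using S s by blast
    from d_le[OF this] have "4 * d \<le> 4 * (norm (x - (1/2) *\<^sub>R (s m + s n)))\<^sup>2" by simp
    also have "\<dots> = (norm (2 *\<^sub>R (x - (1/2) *\<^sub>R (s m + s n))))\<^sup>2" by (simp add: power_mult_distrib)
    also have "2 *\<^sub>R (x - (1/2) *\<^sub>R (s m + s n)) = (x - s m) + (x - s n)"
      by (simp add: scaleR_diff_right scaleR_2 algebra_simps)
    also have "(norm \<dots>)\<^sup>2 = 2 * (norm (x - s m))\<^sup>2 + 2 * (norm (x - s n))\<^sup>2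
        - (norm ((x - s n) - (x - s m)))\<^sup>2"
      unfolding norm_add_sqr norm_diff_sqr[of "x - s n" "x - s m"]
      using Re_cinner_commute[of "x - s m" "x - s n"] by simp
    finally show ?thesis using s(2)[of m] s(2)[of n] by simp
  qed
  have "Cauchy s"
  proof (rule CauchyI)
    fix e :: real assume "e > 0"
    then obtain N where N: "inverse (real (Suc N)) < e\<^sup>2 / 4"
      using reals_Archimedean[of "e\<^sup>2 / 4"] by auto
    have "norm (s m - s n) < e" if "m \<ge> N" "n \<ge> N" for m n
    proof -
      have "inverse (real (Suc m)) \<le> inverse (real (Suc N))"
        "inverse (real (Suc n)) \<le> inverse (real (Suc N))" using that by auto
      then have "(norm (s m - s n))\<^sup>2 < e\<^sup>2" using close[of m n] N by linarith
      then show ?thesis using \<open>e > 0\<close> by (meson less_eq_real_def power2_less_imp_less)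
    qed
    then show "\<exists>M. \<forall>m\<ge>M. \<forall>n\<ge>M. norm (s m - s n) < e" by blast
  qed
  then obtain p where p: "s \<longlonglongrightarrow> p" using Cauchy_convergent convergent_def by blast
  have pS: "p \<in> S" using closed_sequentially[OF S(1)] s(1) p by blast
  have "(norm (x - p))\<^sup>2 \<le> d + 0"
  proof (rule LIMSEQ_le)
    show "(\<lambda>n. (norm (x - s n))\<^sup>2) \<longlonglongrightarrow> (norm (x - p))\<^sup>2" by (intro tendsto_intros p)
    show "(\<lambda>n. d + inverse (real (Suc n))) \<longlonglongrightarrow> d + 0"
      by (intro tendsto_intros LIMSEQ_inverse_real_of_nat)
    show "\<exists>N. \<forall>n\<ge>N. (norm (x - s n))\<^sup>2 \<le> d + inverse (real (Suc n))"
      using s(2) less_imp_le by blast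
  qed
  then have min: "(norm (x - p))\<^sup>2 \<le> (norm (x - q))\<^sup>2" if "q \<in> S" for q
    using d_le[OF that] by (simp only: add_0_right)
  have "Re (cinner t (x - p)) = 0" if t: "t \<in> S" for t
  proof (cases "t = 0")
    case False
    \<comment> \<open>The real number that minimises the norm of
      \<open>(x - p) - r *\<^sub>R t\<close>.\<close>
    define r where "r = Re (cinner t (x - p)) / (norm t)\<^sup>2"
    have "p + r *\<^sub>R t \<in> S" using S pS t by blast
    from min[OF this] have "(norm (x - p))\<^sup>2 \<le> (norm ((x - p) - r *\<^sub>R t))\<^sup>2"
      by (simp add: algebra_simps)
    also have "\<dots> = (norm (x - p))\<^sup>2 + r\<^sup>2 * (norm t)\<^sup>2 - 2 * r * Re (cinner t (x - p))"
      unfolding norm_diff_sqr by (simp add: cinner_scaleR_right Re_cinner_commute power_mult_distrib)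
    also have "\<dots> = (norm (x - p))\<^sup>2 - (Re (cinner t (x - p)))\<^sup>2 / (norm t)\<^sup>2"
      using False by (simp add: r_def field_simps power2_eq_square)
    finally have "(Re (cinner t (x - p)))\<^sup>2 / (norm t)\<^sup>2 \<le> 0" by simp
    then show ?thesis using False by (simp add: divide_le_0_iff)
  qed simp
  then show thesis using that pS by blast
qed

definition proj :: "'a::complex_hilbert set \<Rightarrow> 'a \<Rightarrow> 'a" where
  "proj S x = (SOME p. p \<in> S \<and> (\<forall>s\<in>S. cinner s (x - p) = 0))"

context
  fixes S :: "'a::complex_hilbert set"
  assumes S: "hilbert_space S"
begin

lemma proj_exists: "\<exists>p. p \<in> S \<and> (\<forall>s\<in>S. cinner s (x - p) = 0)"
proof -
  obtain p where p: "p \<in> S" "\<And>s. s \<in> S \<Longrightarrow> Re (cinner s (x - p)) = 0"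
    using real_projection_exists[OF hilbert_spaceD(2)[OF S] hilbert_space_mem(1,2,6)[OF S]]
    by metis
  have "cinner s (x - p) = cinner (0::'a) 0" if "s \<in> S" for s
    by (rule cinner_eqI_Re) (use p(2) hilbert_space_mem(3)[OF S that] in simp)
  then show ?thesis using p(1) by auto
qed

lemma proj_in: "proj S x \<in> S"
  and proj_orth: "s \<in> S \<Longrightarrow> cinner s (x - proj S x) = 0"
  using someI_ex[OF proj_exists[of x]] unfolding proj_def by blast+

lemma proj_unique:
  assumes "p \<in> S" "\<And>s. s \<in> S \<Longrightarrow> cinner s (x - p) = 0"
  shows "proj S x = p"
proof -
  have d: "proj S x - p \<in> S" using hilbert_space_mem(5)[OF S proj_in assms(1)] .
  have "cinner (proj S x - p) (x - p) - cinner (proj S x - p) (x - proj S x) = 0"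
    using assms(2)[OF d] proj_orth[OF d] by simp
  then have "cinner (proj S x - p) ((x - p) - (x - proj S x)) = 0"
    by (simp only: cinner.diff_right)
  then show ?thesis by simp
qed

lemma proj_id: "x \<in> S \<Longrightarrow> proj S x = x"
  by (rule proj_unique) simp_all

lemma proj_eq_zeroI: "(\<And>s. s \<in> S \<Longrightarrow> cinner s x = 0) \<Longrightarrow> proj S x = 0"
  by (rule proj_unique) (simp_all add: hilbert_space_mem[OF S])

lemma proj_add: "proj S (x + y) = proj S x + proj S y"
proof (rule proj_unique)
  show "proj S x + proj S y \<in> S" using hilbert_space_mem(2)[OF S proj_in proj_in] .
  show "cinner s (x + y - (proj S x + proj S y)) = 0" if "s \<in> S" for s
    using proj_orth[OF that, of x] proj_orth[OF that, of y]
    by (simp add: cinner.diff_right cinner.add_right)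
qed

lemma proj_scaleC: "proj S (c *\<^sub>C x) = c *\<^sub>C proj S x"
proof (rule proj_unique)
  show "c *\<^sub>C proj S x \<in> S" using hilbert_space_mem(3)[OF S proj_in] .
  show "cinner s (c *\<^sub>C x - c *\<^sub>C proj S x) = 0" if "s \<in> S" for s
    using proj_orth[OF that, of x] by (simp add: scaleC_diff_right[symmetric] cinner_scaleC_right)
qed

lemma norm_proj_pythagoras: "(norm x)\<^sup>2 = (norm (proj S x))\<^sup>2 + (norm (x - proj S x))\<^sup>2"
  using norm_add_sqr[of "proj S x" "x - proj S x"] proj_orth[OF proj_in] by simp

lemma norm_proj_le: "norm (proj S x) \<le> norm x"
  by (rule power2_le_imp_le) (simp_all add: norm_proj_pythagoras[of x])

lemma bounded_linear_proj: "bounded_linear (proj S)"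
proof (rule bounded_linear_intro[where K = 1])
  show "proj S (r *\<^sub>R x) = r *\<^sub>R proj S x" for r x
    using proj_scaleC[of "of_real r" x] by (simp add: scaleC_of_real)
qed (simp_all add: proj_add norm_proj_le)

lemma cinner_proj_left: "cinner (proj S x) y = cinner (proj S x) (proj S y)"
  using proj_orth[OF proj_in, of x y] cinner.diff_right[of "proj S x" y "proj S y"] by simp

lemma cinner_proj: "cinner (proj S x) y = cinner x (proj S y)"
  by (metis cinner_proj_left cinner_commute)

text \<open>The error of projecting a vector of S onto the closure of N is itself in S and
  orthogonal to N. The real projection suffices, since orthogonality to all multiples of n is
  complex orthogonality.\<close>

lemma closure_eqI_orthogonal:
  assumes N: "csubspace N" "N \<subseteq> S"
    and "\<And>k. k \<in> S \<Longrightarrow> (\<And>n. n \<in> N \<Longrightarrow> cinner n k = 0) \<Longrightarrow> k = 0"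
  shows "closure N = S"
proof
  show sub: "closure N \<subseteq> S" using N(2) hilbert_spaceD(2)[OF S] by (simp add: closure_minimal)
  show "S \<subseteq> closure N"
  proof
    fix x assume x: "x \<in> S"
    obtain p where p: "p \<in> closure N" "\<And>s. s \<in> closure N \<Longrightarrow> Re (cinner s (x - p)) = 0"
      using real_projection_exists[of "closure N" x] csubspace_closure[OF N(1)]
      by (auto dest: csubspaceD)
    have "cinner n (x - p) = cinner (0::'a) 0" if "n \<in> N" for n
    proof (rule cinner_eqI_Re)
      fix c
      have "c *\<^sub>C n \<in> closure N" using csubspaceD(3)[OF N(1) that] closure_subset by blast
      then show "Re (cinner (c *\<^sub>C n) (x - p)) = Re (cinner (c *\<^sub>C (0::'a)) 0)" using p(2) by simp
    qed
    then have "x - p = 0"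
      using assms(3)[of "x - p"] x p(1) sub hilbert_space_mem(5)[OF S] by auto
    then show "x \<in> closure N" using p(1) by simp
  qed
qed

end

section \<open>Linear maps and isometries on subspaces\<close>

lemma clinear_onD:
  assumes "clinear_on S f"
  shows "x \<in> S \<Longrightarrow> y \<in> S \<Longrightarrow> f (x + y) = f x + f y" "x \<in> S \<Longrightarrow> f (c *\<^sub>C x) = c *\<^sub>C f x"
  using assms by (auto simp: clinear_on_def)

lemma clinear_on_diff:
  assumes "clinear_on S f" "csubspace S" "x \<in> S" "y \<in> S"
  shows "f (x - y) = f x - f y"
  using clinear_onD(1)[OF assms(1,3), of "- y"] clinear_onD(2)[OF assms(1,4), of "-1"]
    csubspaceD(4)[OF assms(2,4)] by simp

lemma clinear_on_zero:
  assumes "clinear_on S f" "csubspace S"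
  shows "f 0 = 0"
  using clinear_on_diff[OF assms, of 0 0] csubspaceD(1)[OF assms(2)] by simp

lemma clinear_on_sum:
  assumes f: "clinear_on S f" and S: "csubspace S" and "\<And>i. i \<in> F \<Longrightarrow> u i \<in> S"
  shows "f (sum u F) = (\<Sum>i\<in>F. f (u i))"
  using assms(3)
  by (induction F rule: infinite_finite_induct)
    (simp_all add: clinear_on_zero[OF f S] clinear_onD(1)[OF f] csubspace_sum[OF S])

lemma bounded_clinear_on_bound:
  assumes "bounded_clinear_on S f"
  obtains M where "M > 0" "\<And>x. x \<in> S \<Longrightarrow> norm (f x) \<le> M * norm x"
proof -
  obtain M where M: "\<forall>x\<in>S. norm (f x) \<le> M * norm x"
    using assms by (auto simp: bounded_clinear_on_def)
  show thesis
  proof (rule that[of "max M 1"])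
    show "norm (f x) \<le> max M 1 * norm x" if "x \<in> S" for x
      using M that by (meson max.cobounded1 mult_right_mono norm_ge_zero order_trans)
  qed simp
qed

lemma bounded_clinear_on_tendsto:
  assumes f: "bounded_clinear_on S f" and S: "csubspace S"
    and u: "\<And>n. u n \<in> S" "x \<in> S" "(u \<longlongrightarrow> x) \<F>"
  shows "((\<lambda>n. f (u n)) \<longlongrightarrow> f x) \<F>"
proof -
  have lin: "clinear_on S f" using f by (simp add: bounded_clinear_on_def)
  obtain M where M: "M > 0" "\<And>x. x \<in> S \<Longrightarrow> norm (f x) \<le> M * norm x"
    using bounded_clinear_on_bound[OF f] by blast
  have "((\<lambda>n. f (u n) - f x) \<longlongrightarrow> 0) \<F>"
  proof (rule Lim_null_comparison)
    show "\<forall>\<^sub>F n in \<F>. norm (f (u n) - f x) \<le> M * norm (u n - x)"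
      using M(2)[of "u _ - x"] u csubspaceD(5)[OF S]
      by (auto simp: clinear_on_diff[OF lin S, symmetric])
    have "((\<lambda>n. M * norm (u n - x)) \<longlongrightarrow> M * norm (x - x)) \<F>"
      by (intro tendsto_intros u)
    then show "((\<lambda>n. M * norm (u n - x)) \<longlongrightarrow> 0) \<F>" by simp
  qed
  then show ?thesis using LIM_zero_iff by blast
qed

lemma bounded_clinear_on_closure:
  assumes f: "bounded_clinear_on S f" and S: "csubspace S"
    and N: "closure N \<subseteq> S" "\<And>x. x \<in> N \<Longrightarrow> f x \<in> M" and x: "x \<in> closure N"
  shows "f x \<in> closure M"
proof -
  obtain u where u: "\<forall>n. u n \<in> N" "u \<longlonglongrightarrow> x" using x unfolding closure_sequential by blast
  have uS: "u n \<in> S" for n using u(1) N(1) closure_subset by blast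
  have xS: "x \<in> S" using N(1) x by blast
  have "(\<lambda>n. f (u n)) \<longlonglongrightarrow> f x"
    by (rule bounded_clinear_on_tendsto[OF f S uS xS u(2)])
  moreover have "\<forall>n. f (u n) \<in> M" using u(1) N(2) by simp
  ultimately show ?thesis unfolding closure_sequential by (intro exI conjI)
qed

text \<open>Polarisation: the norm of \<open>c *\<^sub>C x + y\<close> determines the real part of
  the inner product for every c.\<close>

lemma isometry_cinner:
  assumes T: "clinear_on S T" and S: "csubspace S" and "\<And>x. x \<in> S \<Longrightarrow> norm (T x) = norm x"
    and x: "x \<in> S" and y: "y \<in> S"
  shows "cinner (T x) (T y) = cinner x y"
proof (rule cinner_eqI_Re)
  fix c
  have cx: "c *\<^sub>C x \<in> S" using csubspaceD(3)[OF S x] .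
  have "(norm (T (c *\<^sub>C x) + T y))\<^sup>2 = (norm (c *\<^sub>C x + y))\<^sup>2"
    using clinear_onD(1)[OF T cx y] assms(3) csubspaceD(2)[OF S cx y] by metis
  then show "Re (cinner (c *\<^sub>C T x) (T y)) = Re (cinner (c *\<^sub>C x) y)"
    unfolding norm_add_sqr using assms(3)[OF cx] assms(3)[OF y] clinear_onD(2)[OF T x] by simp
qed

text \<open>If the images converge, their preimages form a Cauchy sequence, because distances are
  preserved, and the limit stays in S.\<close>

lemma isometry_image_closed:
  fixes T :: "'a::complex_hilbert \<Rightarrow> 'b::complex_hilbert"
  assumes T: "clinear_on S T" and S: "hilbert_space S" and iso: "\<And>x. x \<in> S \<Longrightarrow> norm (T x) = norm x"
  shows "hilbert_space (T ` S)"
proof -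
  note cS = hilbert_spaceD(1)[OF S]
  have sub: "csubspace (T ` S)"
    unfolding csubspace_def
  proof (intro conjI ballI allI)
    show "0 \<in> T ` S" using clinear_on_zero[OF T cS] csubspaceD(1)[OF cS] by force
    show "x + y \<in> T ` S" if "x \<in> T ` S" "y \<in> T ` S" for x y
      using that clinear_onD(1)[OF T] csubspaceD(2)[OF cS] by (auto simp: image_iff) metis
    show "c *\<^sub>C x \<in> T ` S" if "x \<in> T ` S" for c x
      using that clinear_onD(2)[OF T] csubspaceD(3)[OF cS] by (auto simp: image_iff) metis
  qed
  have bT: "bounded_clinear_on S T"
    using T iso by (auto simp: bounded_clinear_on_def intro!: exI[of _ 1])
  have "closed (T ` S)"
    unfolding closed_sequential_limits
  proof (intro allI impI, elim conjE)
    fix v l assume v: "\<forall>n. v n \<in> T ` S" "v \<longlonglongrightarrow> l"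
    then have "\<forall>n. \<exists>x. x \<in> S \<and> v n = T x" by blast
    then obtain u where u: "\<And>n. u n \<in> S" "\<And>n. v n = T (u n)" by metis
    have "norm (u m - u n) = norm (v m - v n)" for m n
      using iso[of "u m - u n"] u csubspaceD(5)[OF cS] clinear_on_diff[OF T cS] by metis
    then have "Cauchy u"
      using v(2)[THEN LIMSEQ_imp_Cauchy] by (simp add: Cauchy_def dist_norm)
    then obtain x where x: "u \<longlonglongrightarrow> x" using Cauchy_convergent convergent_def by blast
    then have "x \<in> S" using closed_sequentially[OF hilbert_spaceD(2)[OF S]] u(1) by blast
    then have "v \<longlonglongrightarrow> T x"
      using bounded_clinear_on_tendsto[OF bT cS u(1) _ x] u(2) by presburger
    then show "l \<in> T ` S" using v(2) \<open>x \<in> S\<close> LIMSEQ_unique by blast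
  qed
  then show ?thesis using sub by (simp add: hilbert_space_def)
qed

section \<open>Submodules and isometric linear relations\<close>

definition submodule :: "'h::complex_hilbert set \<Rightarrow> ('b \<Rightarrow> 'h \<Rightarrow> 'h) \<Rightarrow> 'h set \<Rightarrow> bool" where
  "submodule H \<pi> N \<longleftrightarrow> hilbert_space N \<and> N \<subseteq> H \<and> (\<forall>b. \<forall>h\<in>N. \<pi> b h \<in> N)"

lemma submoduleD:
  assumes "submodule H \<pi> N"
  shows "hilbert_space N" "N \<subseteq> H" "h \<in> N \<Longrightarrow> h \<in> H" "h \<in> N \<Longrightarrow> \<pi> b h \<in> N"
  using assms by (auto simp: submodule_def)

lemma closed_orthogonal: "closed {h::'a::complex_hilbert. \<forall>n\<in>N. cinner n h = 0}"
proof -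
  have "{h. \<forall>n\<in>N. cinner n h = 0} = (\<Inter>n\<in>N. {h. cinner n h = 0})" by auto
  moreover have "closed {h. cinner n h = 0}" for n :: 'a
    by (intro closed_Collect_eq continuous_intros bounded_linear.continuous_on[OF cinner.bounded_linear_right])
  ultimately show ?thesis by auto
qed

lemma hilbert_space_orthogonal: "hilbert_space {h::'a::complex_hilbert. \<forall>n\<in>N. cinner n h = 0}"
  unfolding hilbert_space_def csubspace_def
  using closed_orthogonal by (auto simp: cinner_add_right cinner_scaleC_right)

lemma hilbert_space_Int: "hilbert_space S \<Longrightarrow> hilbert_space T \<Longrightarrow> hilbert_space (S \<inter> T)"
  unfolding hilbert_space_def csubspace_def by auto

context algebra_representation
begin

lemma csubspace_H: "csubspace H"
  using hilbert_spaceD(1)[OF hilbert_space] .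

lemma pi_in: "h \<in> H \<Longrightarrow> \<pi> b h \<in> H"
  using pi_bounded by (force simp: bounded_operators_def)

lemma pi_bounded_clinear: "bounded_clinear_on H (\<pi> b)"
  using pi_bounded by (simp add: bounded_operators_def)

lemma pi_clinear: "clinear_on H (\<pi> b)"
  using pi_bounded_clinear by (simp add: bounded_clinear_on_def)

lemma pi_adjoint: "h \<in> H \<Longrightarrow> k \<in> H \<Longrightarrow> cinner (\<pi> b h) k = cinner h (\<pi> (star b) k)"
  using pi_star[of h k "star b"] by (simp add: star_star)

lemma pi_zero: "h \<in> H \<Longrightarrow> \<pi> 0 h = 0"
  using pi_add[of h 0 0] by simp

lemma pi_scaleR: "h \<in> H \<Longrightarrow> \<pi> (r *\<^sub>R b) h = r *\<^sub>R \<pi> b h"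
  using pi_scaleC[of h "of_real r" b] by (simp add: scaleC_of_real)

lemma pi_minus: "h \<in> H \<Longrightarrow> \<pi> (- b) h = - \<pi> b h"
  using pi_scaleR[of h "-1" b] by simp

lemma pi_diff: "h \<in> H \<Longrightarrow> \<pi> (b - c) h = \<pi> b h - \<pi> c h"
  using pi_add[of h b "- c"] pi_minus[of h c] by simp

text \<open>The form in which nondegeneracy is used throughout: such a k is orthogonal to every
  \<open>\<pi> b h\<close>, hence to all of H. It takes over the work of a unit.\<close>

lemma eq_zeroI:
  assumes k: "k \<in> H" and 0: "\<And>b. \<pi> b k = 0"
  shows "k = 0"
proof -
  have "{\<pi> b h |b h. h \<in> H} \<subseteq> {h. \<forall>n\<in>{k}. cinner n h = 0}"
    using pi_star[of _ k] k 0 by (auto simp: cinner_eq_zero_comm[of k]) (metis pi_adjoint cinner.zero_right)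
  then have "closure (cspan {\<pi> b h |b h. h \<in> H}) \<subseteq> {h. \<forall>n\<in>{k}. cinner n h = 0}"
    by (intro closure_minimal cspan_minimal hilbert_spaceD hilbert_space_orthogonal)
  then have "cinner k k = 0" using pi_nondegenerate k by auto
  then show ?thesis by simp
qed

text \<open>The orthogonal complement of N is invariant too, because the algebra is closed under
  \<open>star\<close>; so the action respects the decomposition of h.\<close>

lemma submodule_proj:
  assumes N: "submodule H \<pi> N" and h: "h \<in> H"
  shows "proj N (\<pi> b h) = \<pi> b (proj N h)"
proof (rule proj_unique[OF submoduleD(1)[OF N]])
  have p: "proj N h \<in> N" by (rule proj_in[OF submoduleD(1)[OF N]])
  then show "\<pi> b (proj N h) \<in> N" using submoduleD(4)[OF N] by blast
  fix s assume s: "s \<in> N"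
  have d: "h - proj N h \<in> H"
    using h p submoduleD(2)[OF N] csubspaceD(5)[OF csubspace_H] by blast
  have "\<pi> b h - \<pi> b (proj N h) = \<pi> b (h - proj N h)"
    using clinear_on_diff[OF pi_clinear csubspace_H h] p submoduleD(2)[OF N] by auto
  moreover have "cinner s \<dots> = cinner (\<pi> (star b) s) (h - proj N h)"
    using pi_star[of s "h - proj N h" b] d s submoduleD(2)[OF N] by auto
  ultimately show "cinner s (\<pi> b h - \<pi> b (proj N h)) = 0"
    using proj_orth[OF submoduleD(1)[OF N] submoduleD(4)[OF N s]] by simp
qed

lemma submodule_orthogonal:
  assumes "N \<subseteq> H" "\<And>b n. n \<in> N \<Longrightarrow> \<pi> b n \<in> N"
  shows "submodule H \<pi> (H \<inter> {h. \<forall>n\<in>N. cinner n h = 0})"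
  unfolding submodule_def
  using assms pi_star by (auto intro!: hilbert_space_Int hilbert_space hilbert_space_orthogonal pi_in)
    (metis subsetD)

lemma submodule_closure:
  assumes N: "csubspace N" "N \<subseteq> H" "\<And>b n. n \<in> N \<Longrightarrow> \<pi> b n \<in> N"
  shows "submodule H \<pi> (closure N)"
proof -
  have cl: "closure N \<subseteq> H" using N(2) hilbert_spaceD(2)[OF hilbert_space] by (simp add: closure_minimal)
  have "\<pi> b h \<in> closure N" if "h \<in> closure N" for b h
    by (rule bounded_clinear_on_closure[OF pi_bounded_clinear csubspace_H cl N(3) that])
  then show ?thesis using N(1) cl by (simp add: submodule_def hilbert_space_closure)
qed

lemma csubspace_orbit:
  assumes h: "h \<in> H"
  shows "csubspace (range (\<lambda>b. \<pi> b h))"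
  unfolding csubspace_def
proof (intro conjI ballI allI)
  show "0 \<in> range (\<lambda>b. \<pi> b h)" using rangeI[of "\<lambda>b. \<pi> b h" 0] by (simp add: pi_zero[OF h])
  show "x + y \<in> range (\<lambda>b. \<pi> b h)" if "x \<in> range (\<lambda>b. \<pi> b h)" "y \<in> range (\<lambda>b. \<pi> b h)" for x y
    using that by (auto simp: pi_add[OF h, symmetric])
  show "c *\<^sub>C x \<in> range (\<lambda>b. \<pi> b h)" if "x \<in> range (\<lambda>b. \<pi> b h)" for c x
    using that by (auto simp: pi_scaleC[OF h, symmetric])
qed

lemma submodule_orbit:
  assumes h: "h \<in> H"
  shows "submodule H \<pi> (closure (range (\<lambda>b. \<pi> b h)))"
  by (rule submodule_closure) (use h csubspace_orbit[OF h] in \<open>auto simp: pi_in pi_mult[OF h, symmetric]\<close>)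

text \<open>A unit would make this immediate. Without one, let k be the error of projecting h onto
  the orbit closure: every \<open>\<pi> b h\<close> already lies there, so every
  \<open>\<pi> b\<close> kills k, and \<open>eq_zeroI\<close> gives k = 0.\<close>

lemma mem_closure_orbit:
  assumes h: "h \<in> H"
  shows "h \<in> closure (range (\<lambda>b. \<pi> b h))"
proof -
  let ?N = "closure (range (\<lambda>b. \<pi> b h))"
  note N = submodule_orbit[OF h]
  have p: "proj ?N h \<in> ?N" by (rule proj_in[OF submoduleD(1)[OF N]])
  have pH: "proj ?N h \<in> H" using p submoduleD(2)[OF N] by blast
  have "h - proj ?N h = 0"
  proof (rule eq_zeroI)
    show "h - proj ?N h \<in> H" using csubspaceD(5)[OF csubspace_H h pH] .
    have "\<pi> b h \<in> ?N" for b by (rule subsetD[OF closure_subset rangeI])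
    then show "\<pi> b (h - proj ?N h) = 0" for b
      using submodule_proj[OF N h, of b] proj_id[OF submoduleD(1)[OF N]]
        clinear_on_diff[OF pi_clinear csubspace_H h pH] by simp
  qed
  then show ?thesis using p by simp
qed

end

text \<open>A linear relation spares the check that a map given on sums is well defined: a pair
  \<open>(0, y)\<close> has y = 0 by isometry, so the relation and its closure are single-valued.
  Convergence of first components makes the second ones Cauchy, which gives the domain.\<close>

lemma isometric_relation_extension:
  fixes R :: "('a::complex_hilbert \<times> 'b::complex_hilbert) set"
  assumes add: "\<And>x y x' y'. (x, y) \<in> R \<Longrightarrow> (x', y') \<in> R \<Longrightarrow> (x + x', y + y') \<in> R"
    and scale: "\<And>c x y. (x, y) \<in> R \<Longrightarrow> (c *\<^sub>C x, c *\<^sub>C y) \<in> R"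
    and iso: "\<And>x y. (x, y) \<in> R \<Longrightarrow> norm y = norm x"
  obtains T where "clinear_on (closure (fst ` R)) T"
    "\<And>x. x \<in> closure (fst ` R) \<Longrightarrow> norm (T x) = norm x"
    "\<And>x. x \<in> closure (fst ` R) \<Longrightarrow> (x, T x) \<in> closure R"
    "\<And>x y. (x, y) \<in> closure R \<Longrightarrow> y = T x"
proof -
  have add': "(x + x', y + y') \<in> closure R" if 1: "(x, y) \<in> closure R" and 2: "(x', y') \<in> closure R" for x x' y y'
  proof -
    obtain u where "\<forall>n. u n \<in> R" "u \<longlonglongrightarrow> (x, y)"
      using 1 unfolding closure_sequential by blast
    moreover obtain v where "\<forall>n. v n \<in> R" "v \<longlonglongrightarrow> (x', y')"
      using 2 unfolding closure_sequential by blast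
    ultimately have "\<forall>n. u n + v n \<in> R" "(\<lambda>n. u n + v n) \<longlonglongrightarrow> (x + x', y + y')"
      using tendsto_add[of u "(x, y)" _ v "(x', y')"]
      by (auto simp: plus_prod_def intro!: add)
    then show ?thesis unfolding closure_sequential by (intro exI conjI)
  qed
  have scale': "(c *\<^sub>C x, c *\<^sub>C y) \<in> closure R" if 1: "(x, y) \<in> closure R" for c x y
  proof -
    obtain u where u: "\<forall>n. u n \<in> R" "u \<longlonglongrightarrow> (x, y)" using 1 unfolding closure_sequential by blast
    have "\<forall>n. (c *\<^sub>C fst (u n), c *\<^sub>C snd (u n)) \<in> R" using u(1) scale by simp
    moreover have "(\<lambda>n. (c *\<^sub>C fst (u n), c *\<^sub>C snd (u n))) \<longlonglongrightarrow> (c *\<^sub>C x, c *\<^sub>C y)"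
      using tendsto_fst[OF u(2)] tendsto_snd[OF u(2)] by (auto intro!: tendsto_Pair tendsto_scaleC_right)
    ultimately show ?thesis unfolding closure_sequential by (intro exI conjI)
  qed
  have iso': "norm y = norm x" if 1: "(x, y) \<in> closure R" for x y
  proof -
    obtain u where u: "\<forall>n. u n \<in> R" "u \<longlonglongrightarrow> (x, y)" using 1 unfolding closure_sequential by blast
    have "(\<lambda>n. norm (fst (u n))) \<longlonglongrightarrow> norm x" "(\<lambda>n. norm (snd (u n))) \<longlonglongrightarrow> norm y"
      using tendsto_norm[OF tendsto_fst[OF u(2)]] tendsto_norm[OF tendsto_snd[OF u(2)]] by simp_all
    moreover have "norm (snd (u n)) = norm (fst (u n))" for n using u(1) iso by simp
    ultimately show ?thesis using LIMSEQ_unique by fastforce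
  qed
  have unique: "y = y'" if "(x, y) \<in> closure R" "(x, y') \<in> closure R" for x y y'
    using add'[OF that(1) scale'[OF that(2), of "-1"]] iso' by force
  have ex: "\<exists>y. (x, y) \<in> closure R" if x: "x \<in> closure (fst ` R)" for x
  proof -
    obtain u where u: "\<forall>n. u n \<in> fst ` R" "u \<longlonglongrightarrow> x" using x unfolding closure_sequential by blast
    then have "\<forall>n. \<exists>y. (u n, y) \<in> R" by force
    then obtain v where v: "\<And>n. (u n, v n) \<in> R" by metis
    have "norm (v m - v n) = norm (u m - u n)" for m n
      using iso[OF add[OF v[of m] scale[OF v[of n], of "-1"]]] by simp
    then have "Cauchy v"
      using u(2)[THEN LIMSEQ_imp_Cauchy] by (simp add: Cauchy_def dist_norm)
    then obtain y where "v \<longlonglongrightarrow> y" using Cauchy_convergent convergent_def by blast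
    then have "(\<lambda>n. (u n, v n)) \<longlonglongrightarrow> (x, y)" using u(2) by (intro tendsto_Pair)
    then show ?thesis using v unfolding closure_sequential by (intro exI[of _ y] exI conjI) auto
  qed
  define T where "T x = (SOME y. (x, y) \<in> closure R)" for x
  have T: "(x, T x) \<in> closure R" if "x \<in> closure (fst ` R)" for x
    unfolding T_def using someI_ex[OF ex[OF that]] .
  have T_eq: "y = T x" if "(x, y) \<in> closure R" for x y
    unfolding T_def using someI[of "\<lambda>y. (x, y) \<in> closure R", OF that] unique that by blast
  show thesis
  proof (rule that[of T])
    show "clinear_on (closure (fst ` R)) T"
      unfolding clinear_on_def
    proof (intro conjI ballI allI)
      show "T (x + y) = T x + T y" if "x \<in> closure (fst ` R)" "y \<in> closure (fst ` R)" for x y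
        using T_eq[OF add'[OF T T, OF that]] by simp
      show "T (c *\<^sub>C x) = c *\<^sub>C T x" if "x \<in> closure (fst ` R)" for c x
        using T_eq[OF scale'[OF T[OF that]]] by simp
    qed
  qed (use T T_eq iso' in blast)+
qed

section \<open>Amplifications\<close>

lemma square_summable_le:
  assumes f: "square_summable f" and le: "\<And>i. norm (g i) \<le> M * norm (f i)"
  shows "square_summable g"
  unfolding square_summable_def
proof (rule summable_on_comparison_test)
  show "(\<lambda>i. M\<^sup>2 * (norm (f i))\<^sup>2) summable_on UNIV"
    using f unfolding square_summable_def by (rule summable_on_cmult_right)
  show "(norm (g i))\<^sup>2 \<le> M\<^sup>2 * (norm (f i))\<^sup>2" for i
    using power_mono[OF le[of i], of 2] by (simp add: power_mult_distrib)
qed simp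

lemma ell2_eqI: "(\<And>i. ell2_apply f i = ell2_apply g i) \<Longrightarrow> f = g"
  by (metis ell2_apply_inject ext)

lemma ell2_apply_Ell2: "square_summable f \<Longrightarrow> ell2_apply (Ell2 f) = f"
  by (simp add: Ell2_inverse)

lemma norm_ell2_sqr: "(norm f)\<^sup>2 = (\<Sum>\<^sub>\<infinity>i. (norm (ell2_apply f i))\<^sup>2)"
  by (simp add: norm_ell2.rep_eq infsum_nonneg)

lemma norm_ell2_le:
  assumes "\<And>i. norm (ell2_apply g i) \<le> M * norm (ell2_apply f i)" "M \<ge> 0"
  shows "norm g \<le> M * norm f"
proof (rule norm_ell2_leI)
  fix F :: "'a set"
  have "L2_set (\<lambda>i. norm (ell2_apply g i)) F \<le> L2_set (\<lambda>i. M * norm (ell2_apply f i)) F"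
    by (rule L2_set_mono) (use assms in auto)
  also have "\<dots> = M * L2_set (\<lambda>i. norm (ell2_apply f i)) F"
    by (simp add: L2_set_right_distrib assms(2))
  also have "\<dots> \<le> M * norm f" by (intro mult_left_mono L2_set_le_norm_ell2 assms)
  finally show "L2_set (\<lambda>i. norm (ell2_apply g i)) F \<le> M * norm f" .
qed

lemma bounded_linear_ell2_apply: "bounded_linear (\<lambda>f. ell2_apply f i)"
  by (rule bounded_linear_intro[where K = 1])
    (simp_all add: plus_ell2.rep_eq scaleR_ell2.rep_eq norm_ell2_apply_le)

lemma ell2_apply_diff: "ell2_apply (f - g) i = ell2_apply f i - ell2_apply g i"
  by (simp add: minus_ell2.rep_eq)

text \<open>The subspace may vary with the index, since the density argument needs D on one part of
  the index set and A on the rest.\<close>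

definition fibre :: "('i \<Rightarrow> 'h::complex_hilbert set) \<Rightarrow> ('i, 'h) ell2 set" where
  "fibre S = {f. \<forall>i. ell2_apply f i \<in> S i}"

lemma hilbert_space_fibre:
  assumes "\<And>i. hilbert_space (S i)"
  shows "hilbert_space (fibre S)"
  unfolding hilbert_space_def
proof
  note S = hilbert_space_mem[OF assms]
  show "csubspace (fibre S)"
    unfolding csubspace_def fibre_def
    by (auto simp: zero_ell2.rep_eq plus_ell2.rep_eq scaleC_ell2.rep_eq intro: S)
  show "closed (fibre S)"
    unfolding closed_sequential_limits
  proof (intro allI impI, elim conjE)
    fix u l assume u: "\<forall>n. u n \<in> fibre S" "u \<longlonglongrightarrow> l"
    have "ell2_apply l i \<in> S i" for i
    proof (rule closed_sequentially[OF hilbert_spaceD(2)[OF assms]])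
      show "ell2_apply (u n) i \<in> S i" for n using u(1) by (simp add: fibre_def)
      show "(\<lambda>n. ell2_apply (u n) i) \<longlonglongrightarrow> ell2_apply l i"
        by (rule bounded_linear.tendsto[OF bounded_linear_ell2_apply u(2)])
    qed
    then show "l \<in> fibre S" by (simp add: fibre_def)
  qed
qed

definition delta :: "'i \<Rightarrow> 'h::complex_hilbert \<Rightarrow> ('i, 'h) ell2" where
  "delta i h = Ell2 (\<lambda>j. if j = i then h else 0)"

definition restr :: "'i set \<Rightarrow> ('i, 'h::complex_hilbert) ell2 \<Rightarrow> ('i, 'h) ell2" where
  "restr J f = Ell2 (\<lambda>i. if i \<in> J then ell2_apply f i else 0)"

text \<open>The operator T tensored with the identity. T is controlled only on H, so the family is
  known to be square summable only for f in the fibre space over H, to which all facts below are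
  restricted.\<close>

definition amp :: "('h::complex_hilbert \<Rightarrow> 'k::complex_hilbert) \<Rightarrow> ('i, 'h) ell2 \<Rightarrow> ('i, 'k) ell2" where
  "amp T f = Ell2 (\<lambda>i. T (ell2_apply f i))"

lemma square_summable_finite_support:
  assumes "finite F" "\<And>i. i \<notin> F \<Longrightarrow> f i = 0"
  shows "square_summable f"
proof -
  have "(\<lambda>i. (norm (f i))\<^sup>2) summable_on F" using assms(1) by simp
  moreover have "(\<lambda>i. (norm (f i))\<^sup>2) summable_on F \<longleftrightarrow> (\<lambda>i. (norm (f i))\<^sup>2) summable_on UNIV"
    by (rule summable_on_cong_neutral) (use assms(2) in auto)
  ultimately show ?thesis by (simp add: square_summable_def)
qed

lemma ell2_apply_delta: "ell2_apply (delta i h) j = (if j = i then h else 0)"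
  unfolding delta_def
  by (subst ell2_apply_Ell2) (rule square_summable_finite_support[of "{i}"], auto)

lemma ell2_apply_restr: "ell2_apply (restr J f) i = (if i \<in> J then ell2_apply f i else 0)"
  unfolding restr_def
  by (subst ell2_apply_Ell2) (auto intro: square_summable_le[OF square_summable_ell2_apply, of _ 1])

lemma infsum_single:
  assumes "\<And>j. j \<noteq> i \<Longrightarrow> f j = 0"
  shows "(\<Sum>\<^sub>\<infinity>j. f j) = f i"
proof -
  have "infsum f UNIV = infsum f {i}" by (rule infsum_cong_neutral) (use assms in auto)
  then show ?thesis by simp
qed

lemma cinner_delta: "cinner (delta i h) f = cinner h (ell2_apply f i)"
  unfolding cinner_ell2.rep_eq by (subst infsum_single[of i]) (simp_all add: ell2_apply_delta)

lemma norm_delta: "norm (delta i h) = norm h"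
proof -
  have "(norm (delta i h))\<^sup>2 = (norm h)\<^sup>2"
    by (subst norm_ell2_sqr, subst infsum_single[of i]) (simp_all add: ell2_apply_delta)
  then show ?thesis by simp
qed

lemma delta_add: "delta i (h + k) = delta i h + delta i k"
  and delta_scaleC: "delta i (c *\<^sub>C h) = c *\<^sub>C delta i h"
  by (auto intro!: ell2_eqI simp: ell2_apply_delta plus_ell2.rep_eq scaleC_ell2.rep_eq)

context
  fixes H :: "'h::complex_hilbert set" and T :: "'h \<Rightarrow> 'k::complex_hilbert"
  assumes T: "bounded_clinear_on H T" and H: "csubspace H"
begin

lemma ell2_apply_amp:
  assumes f: "f \<in> fibre (\<lambda>_. H)"
  shows "ell2_apply (amp T f) i = T (ell2_apply f i)"
proof -
  obtain M where "\<And>x. x \<in> H \<Longrightarrow> norm (T x) \<le> M * norm x"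
    using bounded_clinear_on_bound[OF T] by blast
  then have "square_summable (\<lambda>i. T (ell2_apply f i))"
    using f by (intro square_summable_le[OF square_summable_ell2_apply[of f]]) (auto simp: fibre_def)
  then show ?thesis unfolding amp_def by (simp add: ell2_apply_Ell2)
qed

lemma amp_clinear: "clinear_on (fibre (\<lambda>_. H)) (amp T)"
  unfolding clinear_on_def
proof (intro conjI ballI allI)
  have lin: "clinear_on H T" using T by (simp add: bounded_clinear_on_def)
  fix f g :: "('i, 'h) ell2" and c assume f: "f \<in> fibre (\<lambda>_. H)"
  have "c *\<^sub>C f \<in> fibre (\<lambda>_. H)"
    using f csubspaceD(3)[OF H] by (simp add: fibre_def scaleC_ell2.rep_eq)
  then show "amp T (c *\<^sub>C f) = c *\<^sub>C amp T f"
    using f clinear_onD(2)[OF lin]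
    by (auto intro!: ell2_eqI simp: ell2_apply_amp scaleC_ell2.rep_eq fibre_def)
  assume g: "g \<in> fibre (\<lambda>_. H)"
  have "f + g \<in> fibre (\<lambda>_. H)"
    using f g csubspaceD(2)[OF H] by (simp add: fibre_def plus_ell2.rep_eq)
  then show "amp T (f + g) = amp T f + amp T g"
    using f g clinear_onD(1)[OF lin]
    by (auto intro!: ell2_eqI simp: ell2_apply_amp plus_ell2.rep_eq fibre_def)
qed

lemma amp_bounded_clinear: "bounded_clinear_on (fibre (\<lambda>_. H)) (amp T)"
proof -
  obtain M where M: "M > 0" "\<And>x. x \<in> H \<Longrightarrow> norm (T x) \<le> M * norm x"
    using bounded_clinear_on_bound[OF T] by blast
  have "norm (amp T f) \<le> M * norm f" if "f \<in> fibre (\<lambda>_. H)" for f :: "('i, 'h) ell2"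
    using M that by (intro norm_ell2_le) (auto simp: ell2_apply_amp fibre_def)
  then show ?thesis using amp_clinear by (auto simp: bounded_clinear_on_def)
qed

lemma amp_delta: "h \<in> H \<Longrightarrow> amp T (delta i h) = delta i (T h)"
proof (rule ell2_eqI)
  fix j assume h: "h \<in> H"
  have "delta i h \<in> fibre (\<lambda>_. H)" using h csubspaceD(1)[OF H] by (simp add: fibre_def ell2_apply_delta)
  moreover have "T 0 = 0" using clinear_on_zero[OF _ H] T by (auto simp: bounded_clinear_on_def)
  ultimately show "ell2_apply (amp T (delta i h)) j = ell2_apply (delta i (T h)) j"
    by (simp add: ell2_apply_amp ell2_apply_delta)
qed

end

lemma amp_bounded_operators:
  assumes "T \<in> bounded_operators H" "csubspace H"
  shows "amp T \<in> bounded_operators (fibre (\<lambda>_. H) :: ('i, 'h::complex_hilbert) ell2 set)"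
proof -
  have T: "bounded_clinear_on H T" "\<And>h. h \<in> H \<Longrightarrow> T h \<in> H"
    using assms(1) by (auto simp: bounded_operators_def)
  have "amp T f \<in> fibre (\<lambda>_. H)" if f: "f \<in> fibre (\<lambda>_. H)" for f :: "('i, 'h) ell2"
    using f T(2) by (simp add: fibre_def ell2_apply_amp[OF T(1) assms(2) f])
  then show ?thesis using amp_bounded_clinear[OF T(1) assms(2)] by (auto simp: bounded_operators_def)
qed

context algebra_representation
begin

lemmas amp_apply = ell2_apply_amp[OF pi_bounded_clinear csubspace_H]

lemma fibre_mem: "f \<in> fibre (\<lambda>_. H) \<Longrightarrow> ell2_apply f i \<in> H"
  by (simp add: fibre_def)

lemma delta_in_fibre: "h \<in> H \<Longrightarrow> delta i h \<in> fibre (\<lambda>_. H)"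
  using csubspaceD(1)[OF csubspace_H] by (simp add: fibre_def ell2_apply_delta)

lemma algebra_representation_amp:
  "algebra_representation (fibre (\<lambda>_. H) :: ('i, 'h) ell2 set) (\<lambda>b. amp (\<pi> b))"
proof
  let ?L = "fibre (\<lambda>_. H) :: ('i, 'h) ell2 set"
  show L: "hilbert_space ?L" by (rule hilbert_space_fibre[OF hilbert_space])
  show bounded: "amp (\<pi> b) \<in> bounded_operators ?L" for b
    by (rule amp_bounded_operators[OF pi_bounded csubspace_H])
  then have in_L: "f \<in> ?L \<Longrightarrow> amp (\<pi> b) f \<in> ?L" for b f by (force simp: bounded_operators_def)
  show "amp (\<pi> (b + b')) f = amp (\<pi> b) f + amp (\<pi> b') f" if "f \<in> ?L" for f b b'
    using that by (auto intro!: ell2_eqI simp: amp_apply plus_ell2.rep_eq pi_add fibre_mem)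
  show "amp (\<pi> (c *\<^sub>C b)) f = c *\<^sub>C amp (\<pi> b) f" if "f \<in> ?L" for f c b
    using that by (auto intro!: ell2_eqI simp: amp_apply scaleC_ell2.rep_eq pi_scaleC fibre_mem)
  show "amp (\<pi> (b * b')) f = amp (\<pi> b) (amp (\<pi> b') f)" if "f \<in> ?L" for f b b'
    using that in_L by (auto intro!: ell2_eqI simp: amp_apply pi_mult fibre_mem)
  show star: "cinner (amp (\<pi> (star b)) f) g = cinner f (amp (\<pi> b) g)" if "f \<in> ?L" "g \<in> ?L" for f g b
    using that unfolding cinner_ell2.rep_eq by (intro infsum_cong) (simp add: amp_apply pi_star fibre_mem)
  show "closure (cspan {amp (\<pi> b) f |b f. f \<in> ?L}) = ?L"
  proof (rule closure_eqI_orthogonal[OF L csubspace_cspan])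
    show "cspan {amp (\<pi> b) f |b f. f \<in> ?L} \<subseteq> ?L"
      by (rule cspan_minimal[OF _ hilbert_spaceD(1)[OF L]]) (auto intro: in_L)
    fix k assume k: "k \<in> ?L" "\<And>n. n \<in> cspan {amp (\<pi> b) f |b f. f \<in> ?L} \<Longrightarrow> cinner n k = 0"
    have "ell2_apply k i = 0" for i
    proof (rule eq_zeroI)
      show ki: "ell2_apply k i \<in> H" using k(1) by (rule fibre_mem)
      fix b
      \<comment> \<open>Paired with k, this vector gives the squared norm of \<open>\<pi> b\<close>
        applied to the i-th coordinate of k.\<close>
      have "amp (\<pi> (star b)) (amp (\<pi> b) (delta i (ell2_apply k i))) \<in> cspan {amp (\<pi> b) f |b f. f \<in> ?L}"
        using in_L[OF delta_in_fibre[OF ki]] cspan_superset[of "{amp (\<pi> b) f |b f. f \<in> ?L}"] by blast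
      then have "cinner (delta i (\<pi> (star b) (\<pi> b (ell2_apply k i)))) k = 0"
        using k(2) ki by (simp add: amp_delta[OF pi_bounded_clinear csubspace_H] pi_in)
      then show "\<pi> b (ell2_apply k i) = 0"
        using ki pi_star[OF pi_in[OF ki] ki, of b b] by (simp add: cinner_delta)
    qed
    then show "k = 0" by (auto intro!: ell2_eqI simp: zero_ell2.rep_eq)
  qed
qed

end

section \<open>Intertwiners\<close>

text \<open>The adjoint is carried along as data: both maps arise as opposite blocks of one
  projection, so no Riesz argument is required to produce it.\<close>

definition intertwining_adjoints ::
    "('b \<Rightarrow> 'h \<Rightarrow> 'h) \<Rightarrow> 'h::complex_hilbert set \<Rightarrow> 'h set \<Rightarrow> ('h \<Rightarrow> 'h) \<Rightarrow> ('h \<Rightarrow> 'h) \<Rightarrow> bool" where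
  "intertwining_adjoints \<pi> A D T T' \<longleftrightarrow>
     bounded_clinear_on A T \<and> T ` A \<subseteq> D \<and> bounded_clinear_on D T' \<and> T' ` D \<subseteq> A \<and>
     (\<forall>a\<in>A. \<forall>d\<in>D. cinner (T a) d = cinner a (T' d)) \<and>
     (\<forall>b. \<forall>a\<in>A. T (\<pi> b a) = \<pi> b (T a)) \<and> (\<forall>b. \<forall>d\<in>D. T' (\<pi> b d) = \<pi> b (T' d))"

context algebra_representation
begin

text \<open>These are the blocks of the projection onto N between the copies i and j. They
  intertwine because the projection commutes with the action, and they are adjoint to each other
  because it is self-adjoint.\<close>

lemma intertwining_adjoints_compression:
  fixes N :: "('i, 'h) ell2 set"
  assumes A: "submodule H \<pi> A" and D: "submodule H \<pi> D"
    and N: "submodule (fibre (\<lambda>_. H)) (\<lambda>b. amp (\<pi> b)) N"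
    and Ni: "\<And>f. f \<in> N \<Longrightarrow> ell2_apply f i \<in> A" and Nj: "\<And>f. f \<in> N \<Longrightarrow> ell2_apply f j \<in> D"
  shows "intertwining_adjoints \<pi> A D
    (\<lambda>a. ell2_apply (proj N (delta i a)) j) (\<lambda>d. ell2_apply (proj N (delta j d)) i)"
proof -
  interpret L: algebra_representation "fibre (\<lambda>_. H) :: ('i, 'h) ell2 set" "\<lambda>b. amp (\<pi> b)"
    by (rule algebra_representation_amp)
  note hN = submoduleD(1)[OF N]
  have bcl: "bounded_clinear_on S (\<lambda>a. ell2_apply (proj N (delta i a)) j)" for i j S
    unfolding bounded_clinear_on_def clinear_on_def
  proof (intro conjI ballI allI exI)
    show "norm (ell2_apply (proj N (delta i a)) j) \<le> 1 * norm a" for a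
      using norm_ell2_apply_le[of "proj N (delta i a)" j] norm_proj_le[OF hN, of "delta i a"]
      by (simp add: norm_delta)
  qed (simp_all add: delta_add delta_scaleC proj_add[OF hN] proj_scaleC[OF hN]
      plus_ell2.rep_eq scaleC_ell2.rep_eq)
  have commute: "ell2_apply (proj N (delta i (\<pi> b a))) j = \<pi> b (ell2_apply (proj N (delta i a)) j)"
    if "a \<in> H" for a b i j
  proof -
    have "delta i (\<pi> b a) = amp (\<pi> b) (delta i a)"
      using that by (simp add: amp_delta[OF pi_bounded_clinear csubspace_H])
    then have "proj N (delta i (\<pi> b a)) = amp (\<pi> b) (proj N (delta i a))"
      using L.submodule_proj[OF N delta_in_fibre[OF that]] by simp
    then show ?thesis
      using amp_apply[of "proj N (delta i a)"] proj_in[OF hN] submoduleD(3)[OF N] by simp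
  qed
  have "cinner (ell2_apply (proj N (delta i a)) j) d = cinner a (ell2_apply (proj N (delta j d)) i)" for a d
    using cinner_proj[OF hN, of "delta i a" "delta j d"]
    by (metis cinner_commute cinner_delta)
  then show ?thesis
    unfolding intertwining_adjoints_def
    using bcl commute proj_in[OF hN] Ni Nj submoduleD(3)[OF A] submoduleD(3)[OF D] by auto
qed

text \<open>A weak double commutant argument: the projection onto the orbit closure of \<open>f\<close>
  is block diagonal, since its off-diagonal blocks are intertwiners.\<close>

lemma disjoint_density:
  fixes f :: "('i, 'h) ell2"
  assumes A: "submodule H \<pi> A" and D: "submodule H \<pi> D"
    and disjoint: "\<And>T T' a. intertwining_adjoints \<pi> A D T T' \<Longrightarrow> a \<in> A \<Longrightarrow> T a = 0"
    and fA: "\<And>i. i \<notin> J \<Longrightarrow> ell2_apply f i \<in> A" and fD: "\<And>i. i \<in> J \<Longrightarrow> ell2_apply f i \<in> D"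
  shows "restr J f \<in> closure (range (\<lambda>b. amp (\<pi> b) f))"
proof -
  interpret L: algebra_representation "fibre (\<lambda>_. H) :: ('i, 'h) ell2 set" "\<lambda>b. amp (\<pi> b)"
    by (rule algebra_representation_amp)
  define S where "S i = (if i \<in> J then D else A)" for i
  let ?N = "closure (range (\<lambda>b. amp (\<pi> b) f))"
  have S: "submodule H \<pi> (S i)" for i using A D by (simp add: S_def)
  have fS: "f \<in> fibre S" using fA fD by (simp add: fibre_def S_def)
  have f: "f \<in> fibre (\<lambda>_. H)" using fS submoduleD(3)[OF S] by (auto simp: fibre_def)
  note N = L.submodule_orbit[OF f]
  note hN = submoduleD(1)[OF N]
  have "amp (\<pi> b) f \<in> fibre S" for b
    using f fS submoduleD(4)[OF S] by (auto simp: fibre_def amp_apply)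
  then have NS: "?N \<subseteq> fibre S"
    using hilbert_spaceD(2)[OF hilbert_space_fibre[of S]] submoduleD(1)[OF S]
    by (intro closure_minimal) auto
  have inS: "ell2_apply (proj ?N x) i \<in> S i" for x i
    using proj_in[OF hN, of x] NS by (auto simp: fibre_def)
  \<comment> \<open>Disjointness speaks of maps from A to D only; the reverse block is the adjoint
    of such a map and vanishes by pairing it with itself.\<close>
  have T0: "ell2_apply (proj ?N (delta i a)) j = 0"
    and T0': "ell2_apply (proj ?N (delta j d)) i = 0"
    if ij: "i \<notin> J" "j \<in> J" and a: "a \<in> A" and d: "d \<in> D" for i j a d
  proof -
    have "ell2_apply x i \<in> A" "ell2_apply x j \<in> D" if "x \<in> ?N" for x
      using NS that ij by (auto simp: fibre_def S_def split: if_splits)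
    note T = intertwining_adjoints_compression[OF A D N this]
    show "ell2_apply (proj ?N (delta i a)) j = 0" using disjoint[OF T a] by simp
    have "cinner a' (ell2_apply (proj ?N (delta j d)) i) = 0" if "a' \<in> A" for a'
      using T disjoint[OF T that] that d by (auto simp: intertwining_adjoints_def)
    moreover have "ell2_apply (proj ?N (delta j d)) i \<in> A" using inS[of _ i] ij by (simp add: S_def)
    ultimately show "ell2_apply (proj ?N (delta j d)) i = 0" by (metis cinner_self_eq_zero)
  qed
  \<comment> \<open>This coordinate lies in \<open>S j\<close>, and its inner product with h in
    \<open>S j\<close> is that of the projection of \<open>delta j h\<close> with x, where by
    assumption the projection vanishes on the support of x.\<close>
  have *: "ell2_apply (proj ?N x) j = 0"
    if supp: "\<And>i. ell2_apply x i \<noteq> 0 \<Longrightarrow> \<forall>h\<in>S j. ell2_apply (proj ?N (delta j h)) i = 0" for x j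
  proof -
    have "cinner h (ell2_apply (proj ?N x) j) = 0" if h: "h \<in> S j" for h
    proof -
      have "cinner h (ell2_apply (proj ?N x) j) = cinner (proj ?N (delta j h)) x"
        by (simp add: cinner_proj[OF hN] cinner_delta)
      also have "\<dots> = (\<Sum>\<^sub>\<infinity>i::'i. 0)"
        unfolding cinner_ell2.rep_eq
      proof (rule infsum_cong)
        show "cinner (ell2_apply (proj ?N (delta j h)) i) (ell2_apply x i) = 0" for i
          using supp[of i] h by (cases "ell2_apply x i = 0") auto
      qed
      finally show ?thesis by simp
    qed
    then show ?thesis using inS[of x j] cinner_self_eq_zero by blast
  qed
  let ?f0 = "restr (- J) f" and ?f1 = "restr J f"
  have "proj ?N ?f1 = ?f1"
  proof (rule ell2_eqI)
    fix i
    \<comment> \<open>f lies in its own orbit closure, so it is fixed by the projection. With zero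
      off-diagonal blocks, ?f0 contributes nothing on J and ?f1 nothing off J.\<close>
    have split: "f = ?f0 + ?f1" by (rule ell2_eqI) (simp add: ell2_apply_restr plus_ell2.rep_eq)
    have "f = proj ?N f" using proj_id[OF hN L.mem_closure_orbit[OF f]] by simp
    also have "\<dots> = proj ?N ?f0 + proj ?N ?f1" using proj_add[OF hN, of ?f0 ?f1] split by simp
    finally have sum: "ell2_apply f i = ell2_apply (proj ?N ?f0) i + ell2_apply (proj ?N ?f1) i"
      using plus_ell2.rep_eq by metis
    show "ell2_apply (proj ?N ?f1) i = ell2_apply ?f1 i"
    proof (cases "i \<in> J")
      case True
      have "ell2_apply (proj ?N ?f0) i = 0"
        by (rule *) (use T0'[OF _ _ hilbert_space_mem(1)[OF submoduleD(1)[OF A]]] True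
            in \<open>auto simp: ell2_apply_restr S_def split: if_splits\<close>)
      then show ?thesis using sum True by (simp add: ell2_apply_restr)
    next
      case False
      have "ell2_apply (proj ?N ?f1) i = 0"
        by (rule *) (use T0[OF _ _ _ hilbert_space_mem(1)[OF submoduleD(1)[OF D]]] False
            in \<open>auto simp: ell2_apply_restr S_def split: if_splits\<close>)
      then show ?thesis using False by (simp add: ell2_apply_restr)
    qed
  qed
  then show ?thesis using proj_in[OF hN, of ?f1] by simp
qed

text \<open>Bounded approximants are available only for self-adjoint elements. Let
  \<open>\<eta>\<close> be the error of projecting \<open>restr J f\<close> onto the closed real
  subspace given by the self-adjoint part of the orbit. Symmetrising elements that approximate
  \<open>restr J\<close> on f and on \<open>\<eta>\<close> at once shows that \<open>\<eta>\<close>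
  is real-orthogonal to \<open>restr J f\<close>, hence to itself.\<close>

lemma disjoint_density_selfadjoint:
  fixes f :: "('i, 'h) ell2"
  assumes A: "submodule H \<pi> A" and D: "submodule H \<pi> D"
    and disjoint: "\<And>T T' a. intertwining_adjoints \<pi> A D T T' \<Longrightarrow> a \<in> A \<Longrightarrow> T a = 0"
    and fA: "\<And>i. i \<notin> J \<Longrightarrow> ell2_apply f i \<in> A" and fD: "\<And>i. i \<in> J \<Longrightarrow> ell2_apply f i \<in> D"
  shows "restr J f \<in> closure ((\<lambda>b. amp (\<pi> b) f) ` {b. star b = b})"
proof -
  interpret L: algebra_representation "fibre (\<lambda>_. H) :: ('i, 'h) ell2 set" "\<lambda>b. amp (\<pi> b)"
    by (rule algebra_representation_amp)
  define S where "S i = (if i \<in> J then D else A)" for i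
  have S: "submodule H \<pi> (S i)" for i using A D by (simp add: S_def)
  have hS: "hilbert_space (fibre S)" by (rule hilbert_space_fibre[OF submoduleD(1)[OF S]])
  have fS: "f \<in> fibre S" using fA fD by (simp add: fibre_def S_def)
  have SL: "g \<in> fibre (\<lambda>_. H)" if "g \<in> fibre S" for g
    using that submoduleD(3)[OF S] by (auto simp: fibre_def)
  note f = SL[OF fS]
  let ?R = "(\<lambda>b. amp (\<pi> b) f) ` {b. star b = b}"
  have star0: "star (0::'b) = 0" using star_add[of "0::'b" 0] by simp
  have R0: "0 \<in> ?R" using L.pi_zero[OF f] star0 by (auto intro!: image_eqI[of _ _ 0])
  have Radd: "x + y \<in> ?R" if "x \<in> ?R" "y \<in> ?R" for x y
    using that by (auto simp: L.pi_add[OF f, symmetric] star_add)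
  have star_scaleR: "star (r *\<^sub>R b) = r *\<^sub>R star b" for r and b :: 'b
    using star_scaleC[of "of_real r" b] by (simp add: scaleC_of_real)
  have Rscale: "r *\<^sub>R x \<in> ?R" if "x \<in> ?R" for r x
    using that by (auto simp: L.pi_scaleR[OF f, symmetric] star_scaleR)
  have "subspace ?R" unfolding subspace_def using R0 Radd Rscale by simp
  then have cR: "subspace (closure ?R)" by (rule subspace_closure)
  obtain p where p: "p \<in> closure ?R" "\<And>s. s \<in> closure ?R \<Longrightarrow> Re (cinner s (restr J f - p)) = 0"
    by (rule real_projection_exists[of "closure ?R" "restr J f"])
      (auto intro: subspace_0[OF cR] subspace_add[OF cR] subspace_scale[OF cR])
  define \<eta> where "\<eta> = restr J f - p"
  have "amp (\<pi> b) f \<in> fibre S" for b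
    using f fS submoduleD(4)[OF S] by (auto simp: fibre_def amp_apply)
  then have "closure ?R \<subseteq> fibre S" by (intro closure_minimal hilbert_spaceD(2)[OF hS]) auto
  moreover have rS: "restr J f \<in> fibre S"
    using fS hilbert_space_mem(1)[OF submoduleD(1)[OF S]] by (simp add: fibre_def ell2_apply_restr)
  ultimately have \<eta>S: "\<eta> \<in> fibre S"
    unfolding \<eta>_def using p(1) by (intro hilbert_space_mem(5)[OF hS]) auto
  note \<eta> = SL[OF \<eta>S]
  have \<eta>i: "ell2_apply \<eta> i \<in> S i" for i using \<eta>S by (simp add: fibre_def)
  have \<eta>A: "ell2_apply \<eta> i \<in> A" if "i \<notin> J" for i using \<eta>i[of i] that by (simp add: S_def)
  have \<eta>D: "ell2_apply \<eta> i \<in> D" if "i \<in> J" for i using \<eta>i[of i] that by (simp add: S_def)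
  \<comment> \<open>Packing f and \<open>\<eta>\<close> into one family indexed by a further
    \<open>bool\<close> makes a single sequence of elements work for both.\<close>
  define g where "g = (\<lambda>(c, i). if c then ell2_apply f i else ell2_apply \<eta> i)"
  have "square_summable g"
  proof -
    have 1: "(\<lambda>p. (norm (g p))\<^sup>2) summable_on range (Pair c)" for c
      using square_summable_ell2_apply[of "if c then f else \<eta>"]
      by (subst summable_on_reindex) (auto simp: g_def o_def inj_on_def square_summable_def split: if_splits)
    have "(\<lambda>p. (norm (g p))\<^sup>2) summable_on (range (Pair True) \<union> range (Pair False))"
      by (rule summable_on_Un_disjoint[OF 1 1]) auto
    moreover have "range (Pair True) \<union> range (Pair False) = (UNIV :: (bool \<times> 'i) set)"
    proof -
      have "x \<in> range (Pair True) \<union> range (Pair False)" for x :: "bool \<times> 'i"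
        by (cases x, cases "fst x") auto
      then show ?thesis by blast
    qed
    ultimately show ?thesis by (simp add: square_summable_def)
  qed
  then have g: "ell2_apply (Ell2 g) (c, i) = (if c then ell2_apply f i else ell2_apply \<eta> i)" for c i
    by (simp add: ell2_apply_Ell2 g_def)
  have gL: "Ell2 g \<in> fibre (\<lambda>_. H)"
    using f \<eta> by (auto simp: fibre_def g)
  have "restr (UNIV \<times> J) (Ell2 g) \<in> closure (range (\<lambda>b. amp (\<pi> b) (Ell2 g)))"
  proof (rule disjoint_density[OF A D])
    show "T a = 0" if "intertwining_adjoints \<pi> A D T T'" "a \<in> A" for T T' a
      using disjoint that .
    show "ell2_apply (Ell2 g) p \<in> A" if "p \<notin> UNIV \<times> J" for p
      using that fA fD \<eta>A \<eta>D by (cases p) (auto simp: g)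
    show "ell2_apply (Ell2 g) p \<in> D" if "p \<in> UNIV \<times> J" for p
      using that fA fD \<eta>A \<eta>D by (cases p) (auto simp: g)
  qed
  then obtain u where u: "\<forall>n. u n \<in> range (\<lambda>b. amp (\<pi> b) (Ell2 g))"
    "u \<longlonglongrightarrow> restr (UNIV \<times> J) (Ell2 g)" unfolding closure_sequential by blast
  then have "\<forall>n. \<exists>c. u n = amp (\<pi> c) (Ell2 g)" by blast
  then obtain b where b: "\<And>n. u n = amp (\<pi> (b n)) (Ell2 g)" by metis
  \<comment> \<open>h is one of the two halves of the packed family, so its error is part of the
    error there.\<close>
  have lim: "(\<lambda>n. amp (\<pi> (b n)) h) \<longlonglongrightarrow> restr J h"
    if h: "h \<in> fibre (\<lambda>_. H)" "\<And>i. ell2_apply h i = ell2_apply (Ell2 g) (c, i)" for h c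
  proof -
    have "norm (amp (\<pi> (b n)) h - restr J h) \<le> norm (u n - restr (UNIV \<times> J) (Ell2 g))" for n
    proof (rule norm_ell2_leI)
      fix F :: "'i set" assume F: "finite F"
      have "L2_set (\<lambda>i. norm (ell2_apply (amp (\<pi> (b n)) h - restr J h) i)) F =
        L2_set (\<lambda>p. norm (ell2_apply (u n - restr (UNIV \<times> J) (Ell2 g)) p)) (Pair c ` F)"
        unfolding L2_set_def
        by (subst sum.reindex)
          (auto simp: inj_on_def b ell2_apply_diff ell2_apply_restr amp_apply[OF h(1)] amp_apply[OF gL]
            h(2) intro!: arg_cong[where f = sqrt] sum.cong)
      also have "\<dots> \<le> norm (u n - restr (UNIV \<times> J) (Ell2 g))" by (rule L2_set_le_norm_ell2)
      finally show "L2_set (\<lambda>i. norm (ell2_apply (amp (\<pi> (b n)) h - restr J h) i)) F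
        \<le> norm (u n - restr (UNIV \<times> J) (Ell2 g))" .
    qed
    moreover have "(\<lambda>n. norm (u n - restr (UNIV \<times> J) (Ell2 g))) \<longlonglongrightarrow> 0"
      using u(2) by (simp add: LIM_zero tendsto_norm_zero)
    ultimately have "(\<lambda>n. amp (\<pi> (b n)) h - restr J h) \<longlonglongrightarrow> 0"
      by (rule Lim_null_comparison[OF eventuallyI])
    then show ?thesis by (rule LIM_zero_cancel)
  qed
  \<comment> \<open>\<open>b + star b\<close> is self-adjoint for every b; moving the star across
    leaves the same b acting once on f and once on \<open>\<eta>\<close>, so the limit can be
    taken.\<close>
  have "Re (cinner (amp (\<pi> b) f) \<eta>) + Re (cinner f (amp (\<pi> b) \<eta>)) = 0" for b
  proof -
    have "star (b + star b) = b + star b" by (simp add: star_add star_star add.commute)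
    then have "amp (\<pi> (b + star b)) f \<in> closure ?R" by (intro subsetD[OF closure_subset] imageI) simp
    then have "Re (cinner (amp (\<pi> (b + star b)) f) \<eta>) = 0" using p(2) by (simp add: \<eta>_def)
    then show ?thesis by (simp add: L.pi_add[OF f] cinner_add_left L.pi_star[OF f \<eta>])
  qed
  moreover have "(\<lambda>n. Re (cinner (amp (\<pi> (b n)) f) \<eta>) + Re (cinner f (amp (\<pi> (b n)) \<eta>)))
      \<longlonglongrightarrow> Re (cinner (restr J f) \<eta>) + Re (cinner f (restr J \<eta>))"
    using lim[OF f, of True] lim[OF \<eta>, of False]
    by (intro tendsto_intros cinner.tendsto) (auto simp: g)
  ultimately have "Re (cinner (restr J f) \<eta>) + Re (cinner f (restr J \<eta>)) = 0"
    by (simp add: LIMSEQ_const_iff)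
  moreover have "cinner f (restr J \<eta>) = cinner (restr J f) \<eta>"
    unfolding cinner_ell2.rep_eq by (rule infsum_cong) (simp add: ell2_apply_restr)
  ultimately have "Re (cinner (restr J f) \<eta>) = 0" by simp
  then have "Re (cinner \<eta> \<eta>) = 0"
    using p unfolding \<eta>_def by (simp add: cinner.diff_left)
  then have "\<eta> = 0" by (simp add: Re_cinner_self)
  then show ?thesis using p(1) by (simp add: \<eta>_def)
qed

end

section \<open>Bounded approximants\<close>

lemma norm_star: "norm (star a) = norm a" for a :: "'b::cstar_algebra"
proof -
  have le: "norm a \<le> norm (star a)" for a :: 'b
  proof (cases "a = 0")
    case False
    have "norm a * norm a \<le> norm (star a) * norm a"
      using norm_mult_ineq[of "star a" a] by (simp add: norm_star_mult power2_eq_square)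
    then show ?thesis using False by simp
  qed simp
  show ?thesis using le[of a] le[of "star a"] by (simp add: star_star)
qed

text \<open>The C*-identity for (1 + w)x, written without a unit. The cross terms cancel as w is
  skew, so the norm grows only to second order in w; this keeps long products of such factors
  bounded.\<close>

lemma norm_add_skew_mult:
  fixes w :: "'b::cstar_algebra"
  assumes "star w = - w"
  shows "(norm (x + w * x))\<^sup>2 \<le> (1 + (norm w)\<^sup>2) * (norm x)\<^sup>2"
proof -
  have "star (x + w * x) * (x + w * x) = star x * x - star x * (w * (w * x))"
    by (simp add: star_add star_mult assms algebra_simps)
  then have "(norm (x + w * x))\<^sup>2 \<le> norm (star x * x) + norm (star x * (w * (w * x)))"
    using norm_triangle_ineq4[of "star x * x" "star x * (w * (w * x))"]
    by (simp add: norm_star_mult[symmetric])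
  also have "norm (star x * (w * (w * x))) \<le> norm (star x) * (norm w * (norm w * norm x))"
    by (meson mult_left_mono norm_ge_zero norm_mult_ineq order_trans)
  finally show ?thesis by (simp add: norm_star_mult norm_star algebra_simps power2_eq_square)
qed

text \<open>This replaces the functional calculus in Kaplansky's density theorem:
  \<open>1 + y = (1 + \<i>b/(8k))\<^sup>k\<close> for large \<open>k\<close> is close to the unitary \<open>exp(\<i>b/8)\<close>, hence bounded
  independently of \<open>b\<close>.\<close>

lemma (in algebra_representation) exists_bounded_approximant:
  assumes b: "star b = b"
  obtains y where "norm y \<le> 3" "\<And>h. h \<in> H \<Longrightarrow> norm (\<pi> y h) \<le> norm (\<pi> b h)"
    "\<And>h. h \<in> H \<Longrightarrow> norm (\<pi> y h - (\<i>/8) *\<^sub>C h) \<le> norm (\<pi> b h) / 32 + norm (\<pi> b h - h) / 4"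
proof -
  obtain M0 where M0: "M0 > 0" "\<And>h. h \<in> H \<Longrightarrow> norm (\<pi> b h) \<le> M0 * norm h"
    using bounded_clinear_on_bound[OF pi_bounded_clinear] by blast
  \<comment> \<open>The same estimate is run in the algebra and on H, and M has to serve as a bound
    in both.\<close>
  define M where "M = max M0 (norm b)"
  have M: "M > 0" "norm b \<le> M" using M0(1) by (auto simp: M_def)
  have M': "norm (\<pi> b h) \<le> M * norm h" if "h \<in> H" for h
    using M0(2)[OF that] mult_right_mono[of M0 M "norm h"] by (auto simp: M_def)
  \<comment> \<open>With k \<ge> M^2 the k-fold growth factor q^k is at most exp(M^2/(64k)) \<le> e
    \<le> 4, and 4 = 2^2 yields the factors 2 below.\<close>
  define k where "k = nat \<lceil>M\<^sup>2\<rceil> + 1"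
  have k: "real k \<ge> M\<^sup>2" "k \<ge> 1" by (auto simp: k_def) linarith
  define q where "q = 1 + (M / (8 * real k))\<^sup>2"
  have q1: "q \<ge> 1" by (simp add: q_def)
  have qj: "q ^ j \<le> 4" if "j \<le> k" for j
  proof -
    have "q ^ j \<le> q ^ k" using q1 that by (rule power_increasing[rotated])
    also have "\<dots> \<le> exp ((M / (8 * real k))\<^sup>2) ^ k"
      by (intro power_mono) (auto simp: q_def exp_ge_add_one_self)
    also have "\<dots> = exp (real k * (M / (8 * real k))\<^sup>2)" by (simp add: exp_of_nat_mult)
    also have "real k * (M / (8 * real k))\<^sup>2 = (M\<^sup>2 / real k) / 64"
      using k(2) by (simp add: power2_eq_square)
    also have "exp \<dots> \<le> exp 1"
    proof -
      have "M\<^sup>2 / real k \<le> 1" using k by (simp add: divide_le_eq)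
      then show ?thesis by simp
    qed
    also have "\<dots> \<le> 4" using exp_le by simp
    finally show ?thesis .
  qed
  define t where "t = \<i> / of_nat (8 * k)"
  have norm_t: "cmod t = 1 / (8 * real k)" by (simp add: t_def norm_divide norm_mult)
  define w where "w = t *\<^sub>C b"
  have "cnj t = - t" by (simp add: t_def)
  then have w: "star w = - w"
    using scaleC_scaleC[of "-1" t b] by (simp add: w_def star_scaleC b)
  have norm_w: "norm w \<le> M / (8 * real k)"
    using M(2) by (simp add: w_def norm_scaleC norm_t divide_right_mono)
  have piw: "\<pi> w h = t *\<^sub>C \<pi> b h" if "h \<in> H" for h using pi_scaleC[OF that] by (simp add: w_def)
  have norm_piw: "norm (\<pi> w h) = norm (\<pi> b h) / (8 * real k)" if "h \<in> H" for h
    by (simp add: piw[OF that] norm_scaleC norm_t)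
  \<comment> \<open>\<open>z j\<close> stands for (1 + w)^j - 1, so that no unit has to be
    mentioned.\<close>
  define z where "z = rec_nat 0 (\<lambda>_ z. w + z + w * z)"
  have z: "z 0 = 0" "z (Suc j) = w + z j + w * z j" for j by (simp_all add: z_def)
  have comm: "w * z j = z j * w" for j
  proof (induction j)
    case (Suc j)
    then show ?case by (simp add: z distrib_left distrib_right mult.assoc flip: Suc)
  qed (simp add: z)
  have step: "(norm (x + w * x))\<^sup>2 \<le> q * (norm x)\<^sup>2" for x
  proof -
    have "(norm w)\<^sup>2 \<le> (M / (8 * real k))\<^sup>2" by (rule power_mono[OF norm_w]) simp
    then have "(1 + (norm w)\<^sup>2) * (norm x)\<^sup>2 \<le> q * (norm x)\<^sup>2"
      by (intro mult_right_mono) (simp_all add: q_def)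
    then show ?thesis using norm_add_skew_mult[OF w, of x] by linarith
  qed
  have zx: "(norm (x + z j * x))\<^sup>2 \<le> q ^ j * (norm x)\<^sup>2" for x j
  proof (induction j)
    case (Suc j)
    have "x + z (Suc j) * x = (x + z j * x) + w * (x + z j * x)"
      by (simp add: z algebra_simps)
    then have "(norm (x + z (Suc j) * x))\<^sup>2 \<le> q * (norm (x + z j * x))\<^sup>2" using step by presburger
    also have "\<dots> \<le> q * (q ^ j * (norm x)\<^sup>2)" using Suc q1 by (intro mult_left_mono) auto
    finally show ?case by (simp add: mult.assoc)
  qed (simp add: z)
  \<comment> \<open>Applied to x = \<open>star (z k)\<close>, the bound 2 for multiplication by 1 +
    \<open>z k\<close> gives 3 for \<open>z k\<close>, and the C*-identity turns the norm of
    \<open>z k * x\<close> into a square.\<close>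
  have norm_zk: "norm (z k) \<le> 3"
  proof (cases "z k = 0")
    case False
    let ?x = "star (z k)"
    have "(norm (?x + z k * ?x))\<^sup>2 \<le> 4 * (norm ?x)\<^sup>2"
      using zx[of ?x k] qj[of k] mult_right_mono[of "q ^ k" 4 "(norm ?x)\<^sup>2"] by simp
    then have "(norm (?x + z k * ?x))\<^sup>2 \<le> (2 * norm ?x)\<^sup>2" by (simp add: power_mult_distrib)
    then have "norm (?x + z k * ?x) \<le> 2 * norm ?x" by (rule power2_le_imp_le) simp
    then have "norm (z k * ?x) \<le> 3 * norm ?x"
      using norm_triangle_ineq4[of "?x + z k * ?x" ?x] by simp
    moreover have "norm (z k * ?x) = norm (z k) * norm (z k)"
      using norm_star_mult[of ?x] by (simp add: star_star norm_star power2_eq_square)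
    ultimately show ?thesis using False by (simp add: norm_star)
  qed simp
  have piw_step: "(norm (h + \<pi> w h))\<^sup>2 \<le> q * (norm h)\<^sup>2" if h: "h \<in> H" for h
  proof -
    have "cinner h (\<pi> w h) = - cinner (\<pi> w h) h"
      using pi_adjoint[OF h h, of w] w pi_minus[OF h, of w] by (simp add: cinner.minus_right)
    then have "Re (cinner h (\<pi> w h)) = 0" using Re_cinner_commute[of h "\<pi> w h"] by simp
    then have "(norm (h + \<pi> w h))\<^sup>2 = (norm h)\<^sup>2 + (norm (\<pi> w h))\<^sup>2" by (simp add: norm_add_sqr)
    also have "norm (\<pi> w h) \<le> M / (8 * real k) * norm h"
      using M'[OF h] k by (simp add: norm_piw[OF h] divide_right_mono)
    then have "(norm (\<pi> w h))\<^sup>2 \<le> (M / (8 * real k) * norm h)\<^sup>2" by (intro power_mono) auto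
    finally show ?thesis by (simp add: q_def power_mult_distrib power_divide algebra_simps)
  qed
  \<comment> \<open>The two recursions peel off the factor 1 + w on opposite sides: this one
    displays the increment of z, the next one the growth of 1 + z.\<close>
  have piz_Suc: "\<pi> (z (Suc j)) h = \<pi> (z j) h + (\<pi> w h + \<pi> (z j) (\<pi> w h))" if h: "h \<in> H" for j h
    by (simp add: z comm pi_add[OF h] pi_mult[OF h])
  have piz_Suc': "h + \<pi> (z (Suc j)) h = (h + \<pi> (z j) h) + \<pi> w (h + \<pi> (z j) h)" if h: "h \<in> H" for j h
    using clinear_onD(1)[OF pi_clinear h pi_in[OF h, of "z j"], of w]
    by (simp add: z pi_add[OF h] pi_mult[OF h])
  have zh_sqr: "(norm (h + \<pi> (z j) h))\<^sup>2 \<le> q ^ j * (norm h)\<^sup>2" if h: "h \<in> H" for h j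
  proof (induction j)
    case (Suc j)
    have "(norm (h + \<pi> (z (Suc j)) h))\<^sup>2 \<le> q * (norm (h + \<pi> (z j) h))\<^sup>2"
      unfolding piz_Suc'[OF h]
      by (rule piw_step) (use h pi_in csubspaceD(2)[OF csubspace_H] in blast)
    also have "\<dots> \<le> q * (q ^ j * (norm h)\<^sup>2)" using Suc q1 by (intro mult_left_mono) auto
    finally show ?case by (simp add: mult.assoc)
  qed (simp add: z pi_zero[OF h])
  have zh: "norm (h + \<pi> (z j) h) \<le> 2 * norm h" if "h \<in> H" "j \<le> k" for h j
  proof (rule power2_le_imp_le)
    show "(norm (h + \<pi> (z j) h))\<^sup>2 \<le> (2 * norm h)\<^sup>2"
      using zh_sqr[OF that(1), of j] qj[OF that(2)] mult_right_mono[of "q ^ j" 4 "(norm h)\<^sup>2"]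
      by (simp add: power_mult_distrib)
  qed simp
  \<comment> \<open>Each of the k steps adds at most twice the norm of \<open>\<pi> w h\<close>,
    which is the share 1/k of \<open>norm (\<pi> b h) / 4\<close>.\<close>
  have small: "norm (\<pi> (z j) h) \<le> real j / real k * (norm (\<pi> b h) / 4)" if h: "h \<in> H" and "j \<le> k" for h j
    using that(2)
  proof (induction j)
    case (Suc j)
    have "norm (\<pi> (z (Suc j)) h) \<le> norm (\<pi> (z j) h) + norm (\<pi> w h + \<pi> (z j) (\<pi> w h))"
      unfolding piz_Suc[OF h] by (rule norm_triangle_ineq)
    also have "\<dots> \<le> real j / real k * (norm (\<pi> b h) / 4) + 2 * norm (\<pi> w h)"
      using Suc zh[OF pi_in[OF h], of j w] by simp
    finally show ?case using k(2) by (simp add: norm_piw[OF h] field_simps)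
  qed (simp add: z pi_zero[OF h])
  have close: "norm (\<pi> (z j) h - (of_nat j * t) *\<^sub>C h)
      \<le> real j / real k * (norm (\<pi> b h) / 32 + norm (\<pi> b h - h) / 4)"
    if h: "h \<in> H" and "j \<le> k" for h j
    using that(2)
  proof (induction j)
    case (Suc j)
    define u where "u = \<pi> b h - h"
    have u: "u \<in> H" "\<pi> b h = h + u"
      using csubspaceD(5)[OF csubspace_H pi_in[OF h] h] by (auto simp: u_def)
    have th: "t *\<^sub>C h \<in> H" "t *\<^sub>C u \<in> H" using csubspaceD(3)[OF csubspace_H] h u(1) by auto
    \<comment> \<open>The increment is t h up to t times a vector of norm at most
      \<open>norm (\<pi> b h) / 4 + 2 * norm u\<close>. As |t| = 1/(8k), k such errors add up to the
      two terms of the bound.\<close>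
    have "\<pi> w h + \<pi> (z j) (\<pi> w h) = t *\<^sub>C h + t *\<^sub>C (\<pi> (z j) h + (u + \<pi> (z j) u))"
      using clinear_onD(1)[OF pi_clinear th, of "z j"] clinear_onD(2)[OF pi_clinear h, of "z j"]
        clinear_onD(2)[OF pi_clinear u(1), of "z j"]
      by (simp add: piw[OF h] u(2) scaleC_add_right)
    then have "\<pi> (z (Suc j)) h - (of_nat (Suc j) * t) *\<^sub>C h =
        (\<pi> (z j) h - (of_nat j * t) *\<^sub>C h) + t *\<^sub>C (\<pi> (z j) h + (u + \<pi> (z j) u))"
      unfolding piz_Suc[OF h] by (simp add: scaleC_add_left algebra_simps)
    then have "norm (\<pi> (z (Suc j)) h - (of_nat (Suc j) * t) *\<^sub>C h)
        \<le> norm (\<pi> (z j) h - (of_nat j * t) *\<^sub>C h) + cmod t * norm (\<pi> (z j) h + (u + \<pi> (z j) u))"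
      by (metis norm_triangle_ineq norm_scaleC)
    also have "norm (\<pi> (z j) h + (u + \<pi> (z j) u)) \<le> norm (\<pi> b h) / 4 + 2 * norm u"
    proof -
      have "real j / real k \<le> 1" using Suc.prems by simp
      then have "real j / real k * (norm (\<pi> b h) / 4) \<le> norm (\<pi> b h) / 4"
        using mult_right_mono[of "real j / real k" 1 "norm (\<pi> b h) / 4"] by simp
      then show ?thesis
        using norm_triangle_ineq[of "\<pi> (z j) h" "u + \<pi> (z j) u"] small[OF h, of j] zh[OF u(1), of j]
          Suc.prems by linarith
    qed
    then have "cmod t * norm (\<pi> (z j) h + (u + \<pi> (z j) u)) \<le> cmod t * (norm (\<pi> b h) / 4 + 2 * norm u)"
      by (intro mult_left_mono) auto
    also note Suc.IH[OF Suc_leD[OF Suc.prems]]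
    finally have "norm (\<pi> (z (Suc j)) h - (of_nat (Suc j) * t) *\<^sub>C h)
      \<le> real j / real k * (norm (\<pi> b h) / 32 + norm u / 4) + 1 / (8 * real k) * (norm (\<pi> b h) / 4 + 2 * norm u)"
      unfolding norm_t u_def[symmetric] by simp
    also have "\<dots> = real (Suc j) / real k * (norm (\<pi> b h) / 32 + norm u / 4)"
      using k(2) by (simp add: field_simps)
    finally show ?case unfolding u_def .
  qed (simp add: z pi_zero[OF h])
  show thesis
  proof (rule that[of "z k"])
    show "norm (\<pi> (z k) h) \<le> norm (\<pi> b h)" if "h \<in> H" for h
    proof -
      have "norm (\<pi> (z k) h) \<le> norm (\<pi> b h) / 4" using small[OF that, of k] k(2) by simp
      then show ?thesis using norm_ge_zero[of "\<pi> b h"] by linarith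
    qed
    have kt: "of_nat k * t = \<i> / 8" using k(2) by (simp add: t_def)
    show "norm (\<pi> (z k) h - (\<i>/8) *\<^sub>C h) \<le> norm (\<pi> b h) / 32 + norm (\<pi> b h - h) / 4" if "h \<in> H" for h
      using close[OF that, of k, unfolded kt] k(2) by simp
  qed (rule norm_zk)
qed

section \<open>Weak topologies\<close>

lemma continuous_map_weak_topology:
  assumes "\<phi> \<in> F"
  shows "continuous_map (weak_topology F) euclidean \<phi>"
proof -
  have top: "topspace (weak_topology F) = UNIV"
    unfolding weak_topology_def topology_generated_by_topspace using assms open_UNIV by auto
  have "openin (weak_topology F) {x. \<phi> x \<in> U}" if "open U" for U
    unfolding weak_topology_def
    by (rule topology_generated_by_Basis) (use assms that in \<open>auto simp: vimage_def\<close>)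
  then show ?thesis by (simp add: continuous_map_def top)
qed

text \<open>F must be nonempty because the topology generated by no sets has an empty
  carrier.\<close>

lemma continuous_map_into_weak_topology:
  assumes "F \<noteq> {}" "\<And>\<phi>. \<phi> \<in> F \<Longrightarrow> continuous_map X euclidean (\<lambda>x. \<phi> (f x))"
  shows "continuous_map X (weak_topology F) f"
  unfolding weak_topology_def
proof (rule continuous_on_generated_topo)
  fix V assume "V \<in> {\<phi> -` U |\<phi> U. \<phi> \<in> F \<and> open U}"
  then obtain \<phi> U where V: "V = \<phi> -` U" "\<phi> \<in> F" "open U" by blast
  have "openin X {x \<in> topspace X. \<phi> (f x) \<in> U}"
    using assms(2)[OF V(2)] V(3) unfolding continuous_map_def by auto
  moreover have "f -` V \<inter> topspace X = {x \<in> topspace X. \<phi> (f x) \<in> U}" unfolding V(1) by auto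
  ultimately show "openin X (f -` V \<inter> topspace X)" by simp
next
  have "UNIV \<in> {\<phi> -` U |\<phi> U. \<phi> \<in> F \<and> open U}" using assms(1) open_UNIV by blast
  then show "f ` topspace X \<subseteq> \<Union> {\<phi> -` U |\<phi> U. \<phi> \<in> F \<and> open U}" by blast
qed

lemma topspace_sigma_weak:
  assumes "predual P"
  shows "topspace (sigma_weak P) = UNIV"
proof -
  have "0 \<in> P" using assms by (auto simp: predual_def csubspace_def)
  then show ?thesis unfolding weak_topology_def topology_generated_by_topspace using open_UNIV by auto
qed

text \<open>Used twice for the unit ball: to bound the elements representing functionals, and with r
  = 0 to see that the predual separates points.\<close>

lemma predual_norm_le:
  assumes P: "predual P" and "\<And>\<phi>. \<phi> \<in> P \<Longrightarrow> cmod (blinfun_apply \<phi> b) \<le> r * norm \<phi>" "r \<ge> 0"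
  shows "norm b \<le> r"
proof -
  have "0 \<in> P" using P by (auto simp: predual_def csubspace_def)
  have "norm b = (SUP \<phi>\<in>{\<phi>\<in>P. norm \<phi> \<le> 1}. cmod (blinfun_apply \<phi> b))"
    using P by (auto simp: predual_def)
  also have "\<dots> \<le> r"
  proof (rule cSUP_least)
    show "{\<phi>\<in>P. norm \<phi> \<le> 1} \<noteq> {}" using \<open>0 \<in> P\<close> by force
    show "cmod (blinfun_apply \<phi> b) \<le> r" if "\<phi> \<in> {\<phi>\<in>P. norm \<phi> \<le> 1}" for \<phi>
      using assms(2)[of \<phi>] that mult_left_mono[of "norm \<phi>" 1 r] assms(3) by simp
  qed
  finally show ?thesis .
qed

text \<open>Banach-Alaoglu. The linear functionals on P bounded by r form a closed subset of a
  product of discs, which is compact by Tychonoff; sending a functional to the element that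
  represents it is continuous and maps this set onto the ball.\<close>

lemma compactin_sigma_weak_ball:
  fixes P :: "('b::cstar_algebra \<Rightarrow>\<^sub>L complex) set"
  assumes P: "predual P" and r: "r \<ge> 0"
  shows "compactin (sigma_weak P) {b. norm b \<le> r}"
proof -
  let ?X = "product_topology (\<lambda>_. euclidean) P :: (('b \<Rightarrow>\<^sub>L complex) \<Rightarrow> complex) topology"
  have cP: "csubspace P" using P by (simp add: predual_def)
  define K0 where "K0 = PiE P (\<lambda>\<phi>. cball (0::complex) (r * norm \<phi>))"
  define K where "K = K0 \<inter>
    {f \<in> topspace ?X. \<forall>\<phi>\<in>P. \<forall>\<psi>\<in>P. f (\<phi> + \<psi>) - (f \<phi> + f \<psi>) \<in> {0}} \<inter>
    {f \<in> topspace ?X. \<forall>c. \<forall>\<phi>\<in>P. f (c *\<^sub>C \<phi>) - c * f \<phi> \<in> {0}}"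
  have coord: "continuous_map ?X euclidean (\<lambda>f. f \<phi>)" if "\<phi> \<in> P" for \<phi>
    by (rule continuous_map_product_projection[OF that])
  have closed1: "closedin ?X {f \<in> topspace ?X. \<forall>\<phi>\<in>P. \<forall>\<psi>\<in>P. f (\<phi> + \<psi>) - (f \<phi> + f \<psi>) \<in> {0}}"
  proof -
    have "closedin ?X {f \<in> topspace ?X. f (\<phi> + \<psi>) - (f \<phi> + f \<psi>) \<in> {0}}" if "\<phi> \<in> P" "\<psi> \<in> P" for \<phi> \<psi>
      by (rule closedin_continuous_map_preimage[where Y = euclidean])
        (use that csubspaceD(2)[OF cP] in \<open>auto intro!: continuous_map_diff continuous_map_add coord\<close>)
    moreover have "{f \<in> topspace ?X. \<forall>\<phi>\<in>P. \<forall>\<psi>\<in>P. f (\<phi> + \<psi>) - (f \<phi> + f \<psi>) \<in> {0}} =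
      (\<Inter>\<phi>\<in>P. \<Inter>\<psi>\<in>P. {f \<in> topspace ?X. f (\<phi> + \<psi>) - (f \<phi> + f \<psi>) \<in> {0}})"
      using csubspaceD(1)[OF cP] by auto
    ultimately show ?thesis
      using csubspaceD(1)[OF cP] by (auto intro!: closedin_INT)
  qed
  have closed2: "closedin ?X {f \<in> topspace ?X. \<forall>c. \<forall>\<phi>\<in>P. f (c *\<^sub>C \<phi>) - c * f \<phi> \<in> {0}}"
  proof -
    have "closedin ?X {f \<in> topspace ?X. f (c *\<^sub>C \<phi>) - c * f \<phi> \<in> {0}}" if "\<phi> \<in> P" for c \<phi>
    proof (rule closedin_continuous_map_preimage[where Y = euclidean])
      have 1: "continuous_map euclidean euclidean ((*) c)"
        by (simp add: continuous_intros)
      have "continuous_map ?X euclidean (\<lambda>f. c * f \<phi>)"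
        using continuous_map_compose[OF coord[OF that] 1] by (simp add: o_def)
      then show "continuous_map ?X euclidean (\<lambda>f. f (c *\<^sub>C \<phi>) - c * f \<phi>)"
        using that csubspaceD(3)[OF cP] by (intro continuous_map_diff coord) auto
    qed auto
    moreover have "{f \<in> topspace ?X. \<forall>c. \<forall>\<phi>\<in>P. f (c *\<^sub>C \<phi>) - c * f \<phi> \<in> {0}} =
      (\<Inter>c. \<Inter>\<phi>\<in>P. {f \<in> topspace ?X. f (c *\<^sub>C \<phi>) - c * f \<phi> \<in> {0}})"
      using csubspaceD(1)[OF cP] by auto
    ultimately show ?thesis
      using csubspaceD(1)[OF cP] by (auto intro!: closedin_INT)
  qed
  have "compactin ?X K0" unfolding K0_def by (simp add: compactin_PiE)
  then have "compactin ?X K"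
    unfolding K_def by (intro compact_Int_closedin closed1 closed2)
  \<comment> \<open>The representing element exists by the duality clause in
    \<open>predual\<close>.\<close>
  define \<Psi> where "\<Psi> f = (SOME b. \<forall>\<phi>\<in>P. f \<phi> = blinfun_apply \<phi> b)" for f :: "('b \<Rightarrow>\<^sub>L complex) \<Rightarrow> complex"
  have \<Psi>: "\<forall>\<phi>\<in>P. f \<phi> = blinfun_apply \<phi> (\<Psi> f)" if "f \<in> K" for f
  proof -
    have "bounded_clinear_on P f"
      using that by (auto simp: bounded_clinear_on_def clinear_on_def K_def K0_def scaleC_complex_def
          dist_norm PiE_def Pi_def intro!: exI[of _ r])
    then have "\<exists>b. \<forall>\<phi>\<in>P. f \<phi> = blinfun_apply \<phi> b" using P by (simp add: predual_def)
    then show ?thesis unfolding \<Psi>_def by (rule someI_ex)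
  qed
  have "continuous_map (subtopology ?X K) (sigma_weak P) \<Psi>"
  proof (rule continuous_map_into_weak_topology)
    show "blinfun_apply ` P \<noteq> {}" using csubspaceD(1)[OF cP] by auto
    fix \<phi>' assume "\<phi>' \<in> blinfun_apply ` P"
    then obtain \<phi> where \<phi>: "\<phi> \<in> P" "\<phi>' = blinfun_apply \<phi>" by blast
    have "continuous_map (subtopology ?X K) euclidean (\<lambda>f. f \<phi>)"
      by (rule continuous_map_from_subtopology[OF coord[OF \<phi>(1)]])
    then show "continuous_map (subtopology ?X K) euclidean (\<lambda>f. \<phi>' (\<Psi> f))"
      by (rule continuous_map_eq) (use \<Psi> \<phi> in auto)
  qed
  moreover have "compactin (subtopology ?X K) K"
    using \<open>compactin ?X K\<close> by (simp add: compactin_subtopology)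
  ultimately have "compactin (sigma_weak P) (\<Psi> ` K)" by (rule image_compactin[rotated])
  moreover have "\<Psi> ` K = {b. norm b \<le> r}"
  proof (intro equalityI subsetI)
    fix b assume "b \<in> \<Psi> ` K"
    then obtain f where f: "f \<in> K" "b = \<Psi> f" by blast
    have "norm b \<le> r"
    proof (rule predual_norm_le[OF P _ r])
      show "cmod (blinfun_apply \<phi> b) \<le> r * norm \<phi>" if "\<phi> \<in> P" for \<phi>
        using \<Psi>[OF f(1)] f that by (force simp: K_def K0_def PiE_def Pi_def dist_norm)
    qed
    then show "b \<in> {b. norm b \<le> r}" by simp
  next
    fix b :: 'b assume "b \<in> {b. norm b \<le> r}"
    then have b: "norm b \<le> r" by simp
    \<comment> \<open>Points of the product are extensional functions on P, hence the
      restriction.\<close>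
    define f where "f = restrict (\<lambda>\<phi>. blinfun_apply \<phi> b) P"
    have "cmod (blinfun_apply \<phi> b) \<le> r * norm \<phi>" for \<phi>
      using norm_blinfun[of \<phi> b] mult_left_mono[OF b, of "norm \<phi>"] by (simp add: mult.commute)
    then have fK: "f \<in> K"
      using csubspaceD(2,3)[OF cP]
      by (auto simp: K_def K0_def f_def dist_norm plus_blinfun.rep_eq scaleC_blinfun_apply scaleC_complex_def)
    have "\<Psi> f - b = 0"
    proof -
      have "norm (\<Psi> f - b) \<le> 0"
        by (rule predual_norm_le[OF P]) (use \<Psi>[OF fK] in \<open>auto simp: f_def blinfun.diff_right\<close>)
      then show ?thesis by simp
    qed
    then show "b \<in> \<Psi> ` K" using fK by force
  qed
  ultimately show ?thesis by simp
qed

section \<open>Normal representations tested on series functionals\<close>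

lemma normal_rep_series:
  fixes H :: "'a::complex_hilbert set"
  assumes "normal_rep P H \<pi>" "range g \<subseteq> H" "range h \<subseteq> H"
    "summable (\<lambda>n. (norm (g n))\<^sup>2)" "summable (\<lambda>n. (norm (h n))\<^sup>2)"
  shows "continuous_map (sigma_weak P) euclidean (\<lambda>b. \<Sum>n. cinner (g n) (\<pi> b (h n)))"
proof -
  let ?F = "{\<lambda>T. \<Sum>n. cinner (g n) (T (h n)) | g h :: nat \<Rightarrow> 'a.
    range g \<subseteq> H \<and> range h \<subseteq> H \<and> summable (\<lambda>n. (norm (g n))\<^sup>2) \<and> summable (\<lambda>n. (norm (h n))\<^sup>2)}"
  have 1: "continuous_map (sigma_weak P) (weak_topology ?F) \<pi>"
    using assms(1) unfolding normal_rep_def operator_sigma_weak_def continuous_map_in_subtopology by blast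
  have "(\<lambda>T. \<Sum>n. cinner (g n) (T (h n))) \<in> ?F" using assms by blast
  from continuous_map_compose[OF 1 continuous_map_weak_topology[OF this]]
  show ?thesis by (simp add: o_def)
qed

lemma normal_repI:
  fixes H :: "'a::complex_hilbert set"
  assumes "\<And>b. \<pi> b \<in> bounded_operators H" "hilbert_space H"
    and "\<And>g h. range g \<subseteq> H \<Longrightarrow> range h \<subseteq> H \<Longrightarrow> summable (\<lambda>n. (norm (g n))\<^sup>2) \<Longrightarrow>
      summable (\<lambda>n. (norm (h n))\<^sup>2) \<Longrightarrow>
      continuous_map (sigma_weak P) euclidean (\<lambda>b. \<Sum>n. cinner (g n) (\<pi> b (h n)))"
  shows "normal_rep P H \<pi>"
  unfolding normal_rep_def operator_sigma_weak_def continuous_map_in_subtopology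
proof
  let ?F = "{\<lambda>T. \<Sum>n. cinner (g n) (T (h n)) | g h :: nat \<Rightarrow> 'a.
    range g \<subseteq> H \<and> range h \<subseteq> H \<and> summable (\<lambda>n. (norm (g n))\<^sup>2) \<and> summable (\<lambda>n. (norm (h n))\<^sup>2)}"
  show "continuous_map (sigma_weak P) (weak_topology ?F) \<pi>"
  proof (rule continuous_map_into_weak_topology)
    have "(\<lambda>T. \<Sum>n. cinner ((\<lambda>_. 0) n) (T ((\<lambda>_. 0) n))) \<in> ?F"
      using hilbert_space_mem(1)[OF assms(2)] by (intro CollectI exI conjI refl) auto
    then show "?F \<noteq> {}" by blast
  qed (use assms(3) in auto)
qed (use assms(1) in auto)

lemma normal_rep_cinner:
  fixes H :: "'a::complex_hilbert set"
  assumes "normal_rep P H \<pi>" "hilbert_space H" "g \<in> H" "h \<in> H"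
  shows "continuous_map (sigma_weak P) euclidean (\<lambda>b. cinner g (\<pi> b h))"
proof -
  let ?s = "\<lambda>x n. if n = (0::nat) then x else (0::'a)"
  have s: "summable (\<lambda>n. (norm (?s x n))\<^sup>2)" for x
    by (rule summable_finite[of "{0}"]) auto
  have "continuous_map (sigma_weak P) euclidean (\<lambda>b. \<Sum>n. cinner (?s g n) (\<pi> b (?s h n)))"
    by (rule normal_rep_series[OF assms(1) _ _ s s])
      (use assms(3,4) hilbert_space_mem(1)[OF assms(2)] in auto)
  moreover have "(\<Sum>n. cinner (?s g n) (\<pi> b (?s h n))) = cinner g (\<pi> b h)" for b
    using suminf_finite[of "{0}" "\<lambda>n. cinner (?s g n) (\<pi> b (?s h n))"] by simp
  ultimately show ?thesis by simp
qed

section \<open>Existence of intertwiners\<close>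

context algebra_representation
begin

text \<open>Finitely many norm conditions become one approximation in an amplification over
  \<open>option\<close>: \<open>None\<close> carries d, \<open>Some a\<close> carries a, and entries
  outside F are 0 for square summability.\<close>

lemma disjoint_approximant:
  assumes A: "submodule H \<pi> A" and D: "submodule H \<pi> D"
    and disjoint: "\<And>T T' a. intertwining_adjoints \<pi> A D T T' \<Longrightarrow> a \<in> A \<Longrightarrow> T a = 0"
    and d: "d \<in> D" and F: "finite F" "F \<subseteq> A" and e: "e > 0"
  obtains b where "star b = b" "\<And>a. a \<in> F \<Longrightarrow> norm (\<pi> b a) < e" "norm (\<pi> b d - d) < e"
proof -
  define g where "g p = (case p of None \<Rightarrow> d | Some a \<Rightarrow> if a \<in> F then a else 0)" for p
  have "square_summable g"
    by (rule square_summable_finite_support[of "insert None (Some ` F)"])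
      (use F(1) in \<open>auto simp: g_def split: option.splits\<close>)
  then have g: "ell2_apply (Ell2 g) p = g p" for p by (simp add: ell2_apply_Ell2)
  have A0: "0 \<in> A" using hilbert_space_mem(1)[OF submoduleD(1)[OF A]] .
  have gH: "Ell2 g \<in> fibre (\<lambda>_. H)"
    using F(2) d submoduleD(2)[OF A] submoduleD(2)[OF D] A0
    by (auto simp: fibre_def g g_def split: option.splits)
  have "restr {None} (Ell2 g) \<in> closure ((\<lambda>b. amp (\<pi> b) (Ell2 g)) ` {b. star b = b})"
  proof (rule disjoint_density_selfadjoint[OF A D])
    show "T a = 0" if "intertwining_adjoints \<pi> A D T T'" "a \<in> A" for T T' a
      using disjoint that .
    show "ell2_apply (Ell2 g) p \<in> A" if "p \<notin> {None}" for p
      using that F(2) A0 by (auto simp: g g_def split: option.splits)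
    show "ell2_apply (Ell2 g) p \<in> D" if "p \<in> {None}" for p
      using that d by (simp add: g g_def)
  qed
  then obtain b where b: "star b = b" "norm (amp (\<pi> b) (Ell2 g) - restr {None} (Ell2 g)) < e"
    using e unfolding closure_approachable by (auto simp: dist_norm)
  have le: "norm (ell2_apply (amp (\<pi> b) (Ell2 g) - restr {None} (Ell2 g)) p) < e" for p
    using norm_ell2_apply_le b(2) by (rule le_less_trans)
  show thesis
  proof (rule that[OF b(1)])
    show "norm (\<pi> b a) < e" if "a \<in> F" for a
      using le[of "Some a"] that by (simp add: ell2_apply_diff amp_apply[OF gH] ell2_apply_restr g g_def)
    show "norm (\<pi> b d - d) < e"
      using le[of None] by (simp add: ell2_apply_diff amp_apply[OF gH] ell2_apply_restr g g_def)
  qed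
qed

text \<open>If all intertwiners vanished, elements of norm at most 3 could be nearly 0 on finitely
  many vectors of A and nearly i/8 on d. These requirements define weak* closed sets with the finite
  intersection property in the ball, so one element meets them all; it vanishes on A, hence is 0,
  yet does not vanish on d.\<close>

lemma exists_intertwining_adjoints:
  assumes P: "predual P" and normal: "normal_rep P H \<pi>"
    and A: "submodule H \<pi> A" and D: "submodule H \<pi> D"
    and faithful: "\<And>b. (\<And>a. a \<in> A \<Longrightarrow> \<pi> b a = 0) \<Longrightarrow> b = 0"
    and d: "d \<in> D" "d \<noteq> 0"
  obtains T T' a where "intertwining_adjoints \<pi> A D T T'" "a \<in> A" "T a \<noteq> 0"
proof -
  have False if disjoint: "\<And>T T' a. intertwining_adjoints \<pi> A D T T' \<Longrightarrow> a \<in> A \<Longrightarrow> T a = 0"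
  proof -
    have AH: "a \<in> A \<Longrightarrow> a \<in> H" for a using submoduleD(3)[OF A] .
    have dH: "d \<in> H" using submoduleD(3)[OF D d(1)] .
    \<comment> \<open>Relative to \<open>norm d\<close>, the approximant misses i/8 on d by at most
      (9/8)/32 + (1/8)/4 = 17/256, and 1/8 - 17/256 = 15/256 exceeds 1/20.\<close>
    define \<delta> where "\<delta> = (norm d)\<^sup>2 / 20"
    \<comment> \<open>Norm smallness is not a weak* closed condition given by continuity, so it is
      tested on pairs. Test vectors a' from A suffice, since \<open>\<pi> y a\<close> stays in
      A.\<close>
    define C where "C = (\<lambda>(a, a', n). {y. cmod (cinner a' (\<pi> y a)) \<le> inverse (real (Suc n))})"
    define Cd where "Cd = {y. Im (cinner d (\<pi> y d)) \<ge> \<delta>}"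
    define \<C> where "\<C> = insert Cd (C ` (A \<times> A \<times> UNIV))"
    note top = topspace_sigma_weak[OF P]
    note cont = normal_rep_cinner[OF normal hilbert_space]
    have closed: "closedin (sigma_weak P) S" if S: "S \<in> \<C>" for S
    proof -
      consider "S = Cd" | a a' n where "a \<in> A" "a' \<in> A" "S = C (a, a', n)"
        using S by (auto simp: \<C>_def)
      then show ?thesis
      proof cases
        case 1
        have "closed {x. \<delta> \<le> Im x}" by (intro closed_Collect_le continuous_intros)
        then show ?thesis
          using closedin_continuous_map_preimage[OF cont[OF dH dH], of "{x. \<delta> \<le> Im x}"]
          by (simp add: 1 Cd_def top)
      next
        case 2
        have "closed {x::complex. cmod x \<le> inverse (real (Suc n))}"
          by (intro closed_Collect_le continuous_intros)
        then show ?thesis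
          using closedin_continuous_map_preimage[OF cont[OF AH[OF 2(2)] AH[OF 2(1)]],
              of "{x. cmod x \<le> inverse (real (Suc n))}"]
          by (simp add: 2(3) C_def top)
      qed
    qed
    have fip: "{b. norm b \<le> 3} \<inter> \<Inter>\<F> \<noteq> {}" if \<F>: "finite \<F>" "\<F> \<subseteq> \<C>" for \<F>
    proof -
      have "finite (\<F> - {Cd})" "\<F> - {Cd} \<subseteq> C ` (A \<times> A \<times> UNIV)" using \<F> by (auto simp: \<C>_def)
      then obtain K where K: "K \<subseteq> A \<times> A \<times> UNIV" "finite K" "\<F> - {Cd} = C ` K"
        by (meson finite_subset_image)
      \<comment> \<open>norm d / 8 serves the condition on d; the other terms serve the conditions
        indexed by K, with 1 + \<open>norm a'\<close> to allow a' = 0.\<close>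
      define e where "e = Min (insert (norm d / 8) ((\<lambda>(a, a', n). inverse (real (Suc n)) / (1 + norm a')) ` K))"
      have pos: "inverse (real (Suc n)) / (1 + norm (a'::'h)) > 0" for n a'
        by (intro divide_pos_pos) (auto intro: add_pos_nonneg)
      have e: "e > 0" "e \<le> norm d / 8"
      proof -
        show "e > 0" unfolding e_def using K(2) d(2) pos by (auto simp: split_beta)
        show "e \<le> norm d / 8" unfolding e_def using K(2) by (intro Min_le) auto
      qed
      have e': "e \<le> inverse (real (Suc n)) / (1 + norm a')" if "(a, a', n) \<in> K" for a a' n
        unfolding e_def using K(2) that by (intro Min_le) (auto intro!: rev_image_eqI)
      obtain b where b: "star b = b" "\<And>a. a \<in> fst ` K \<Longrightarrow> norm (\<pi> b a) < e" "norm (\<pi> b d - d) < e"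
      proof (rule disjoint_approximant[OF A D _ d(1) _ _ e(1), of "fst ` K"])
        show "finite (fst ` K)" "fst ` K \<subseteq> A" using K by auto
        show "T a = 0" if "intertwining_adjoints \<pi> A D T T'" "a \<in> A" for T T' a
          using disjoint that .
      qed (blast intro: that)
      obtain y where y: "norm y \<le> 3" "\<And>h. h \<in> H \<Longrightarrow> norm (\<pi> y h) \<le> norm (\<pi> b h)"
        "\<And>h. h \<in> H \<Longrightarrow> norm (\<pi> y h - (\<i>/8) *\<^sub>C h) \<le> norm (\<pi> b h) / 32 + norm (\<pi> b h - h) / 4"
        using exists_bounded_approximant[OF b(1)] by blast
      have "y \<in> C (a, a', n)" if aK: "(a, a', n) \<in> K" for a a' n
      proof -
        have "a \<in> H" using aK K(1) AH by auto
        have "a \<in> fst ` K" using aK by force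
        have "cmod (cinner a' (\<pi> y a)) \<le> norm a' * norm (\<pi> y a)" by (rule cinner_cauchy_schwarz)
        also have "\<dots> \<le> (1 + norm a') * e"
          using y(2)[OF \<open>a \<in> H\<close>] b(2)[OF \<open>a \<in> fst ` K\<close>] by (intro mult_mono) auto
        also have "\<dots> \<le> (1 + norm a') * (inverse (real (Suc n)) / (1 + norm a'))"
          using e'[OF aK] by (intro mult_left_mono) auto
        also have "\<dots> = inverse (real (Suc n))"
          using norm_ge_zero[of a'] by (simp add: add_nonneg_eq_0_iff)
        finally show ?thesis by (simp add: C_def)
      qed
      then have "y \<in> \<Inter>(\<F> - {Cd})" using K(3) by auto
      moreover have "y \<in> Cd"
      proof -
        let ?r = "\<pi> y d - (\<i>/8) *\<^sub>C d"
        have "norm (\<pi> b d) \<le> norm d + norm (\<pi> b d - d)"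
          by (metis norm_triangle_sub)
        then have "norm (\<pi> b d) \<le> norm d * (9/8)" using b(3) e(2) by simp
        then have "norm ?r \<le> norm d * (17/256)" using y(3)[OF dH] b(3) e(2) by simp
        then have "norm d * norm ?r \<le> norm d * (norm d * (17/256))" by (rule mult_left_mono) simp
        then have "cmod (cinner d ?r) \<le> norm d * (norm d * (17/256))"
          using cinner_cauchy_schwarz[of d ?r] by linarith
        then have "\<bar>Im (cinner d ?r)\<bar> \<le> norm d * (norm d * (17/256))"
          using abs_Im_le_cmod[of "cinner d ?r"] by linarith
        moreover have "Im (cinner d (\<pi> y d)) = Im (cinner d ?r) + (norm d)\<^sup>2 / 8"
          by (simp add: cinner.diff_right cinner_scaleC_right cinner_self)
        ultimately show ?thesis
          using zero_le_power2[of "norm d"] unfolding Cd_def \<delta>_def power2_eq_square mem_Collect_eq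
          by linarith
      qed
      ultimately show ?thesis using y(1) by blast
    qed
    have "{b. norm b \<le> 3} \<inter> \<Inter>\<C> \<noteq> {}"
      using compactin_sigma_weak_ball[OF P, of 3] closed fip unfolding compactin_fip by simp
    then obtain y where y: "\<And>S. S \<in> \<C> \<Longrightarrow> y \<in> S" by blast
    have "\<pi> y a = 0" if a: "a \<in> A" for a
    proof -
      \<comment> \<open>Testing \<open>\<pi> y a\<close> against itself turns the weak conditions
        into the vanishing of its norm.\<close>
      have "C (a, \<pi> y a, n) \<in> \<C>" for n
        unfolding \<C>_def by (intro insertI2 imageI) (use a submoduleD(4)[OF A a] in auto)
      then have "cmod (cinner (\<pi> y a) (\<pi> y a)) \<le> inverse (real (Suc n))" for n
        using y[of "C (a, \<pi> y a, n)"] by (simp add: C_def)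
      then have "cmod (cinner (\<pi> y a) (\<pi> y a)) \<le> 0"
        by (intro LIMSEQ_le_const[OF LIMSEQ_inverse_real_of_nat]) auto
      then show ?thesis by simp
    qed
    then have "y = 0" by (rule faithful)
    moreover have "y \<in> Cd" using y by (simp add: \<C>_def)
    ultimately show False using d(2) dH by (simp add: Cd_def \<delta>_def pi_zero)
  qed
  then show thesis using that by blast
qed

end

section \<open>Square roots and vectors with equal orbits\<close>

text \<open>The iteration solves \<open>(1 - y)\<^sup>2 = 1 - b\<close>; it is dominated by the scalar iteration for
  \<open>b = 1\<close>, which increases to \<open>1\<close>.\<close>

lemma one_minus_sqrt_iteration:
  fixes b :: "'a::banach \<Rightarrow>\<^sub>L 'a"
  assumes b: "norm b \<le> 1" and y: "y 0 = 0" "\<And>n. y (Suc n) = (1/2) *\<^sub>R (b + (y n o\<^sub>L y n))"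
  obtains z where "y \<longlonglongrightarrow> z" "2 *\<^sub>R z = b + (z o\<^sub>L z)"
proof -
  define r where "r = rec_nat (0::real) (\<lambda>_ x. (1 + x\<^sup>2) / 2)"
  have r: "r 0 = 0" "r (Suc n) = (1 + (r n)\<^sup>2) / 2" for n by (simp_all add: r_def)
  have r01: "0 \<le> r n \<and> r n \<le> 1" for n
    by (induction n) (auto simp: r power_le_one)
  have mono: "r n \<le> r (Suc n)" for n
    using sum_squares_bound[of "r n" 1] by (simp add: r)
  have "incseq r" by (rule incseq_SucI) (rule mono)
  then have "convergent r"
    using r01 by (intro Bseq_mono_convergent BseqI'[of _ 1]) (auto simp: incseq_def)
  then have sum_r: "summable (\<lambda>n. r (Suc n) - r n)"
    unfolding convergent_def by (auto intro: telescope_summable)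
  have norm_y: "norm (y n) \<le> r n" for n
  proof (induction n)
    case (Suc n)
    have "norm (y n o\<^sub>L y n) \<le> norm (y n) * norm (y n)" by (rule norm_blinfun_compose)
    also have "\<dots> \<le> (r n)\<^sup>2" using Suc r01[of n] by (simp add: power2_eq_square mult_mono)
    finally have "norm (b + (y n o\<^sub>L y n)) \<le> 1 + (r n)\<^sup>2"
      using b norm_triangle_ineq[of b "y n o\<^sub>L y n"] by linarith
    then show ?case by (simp add: y r)
  qed (simp add: y r)
  have diff: "norm (y (Suc n) - y n) \<le> r (Suc n) - r n" for n
  proof (induction n)
    case 0
    then show ?case using norm_y[of 1] by (simp add: y(1) r(1))
  next
    case (Suc n)
    have "u - v = (1/2) *\<^sub>R (u' - v')" if "u = (1/2) *\<^sub>R (b + u')" "v = (1/2) *\<^sub>R (b + v')" for u v u' v'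
      unfolding that by (simp add: scaleR_diff_right[symmetric])
    from this[OF y(2) y(2)]
    have "y (Suc (Suc n)) - y (Suc n) = (1/2) *\<^sub>R ((y (Suc n) o\<^sub>L y (Suc n)) - (y n o\<^sub>L y n))" .
    \<comment> \<open>The order of the factors is kept, as these operators are not known to commute.
      For the scalar iteration the same splitting is exact, so the induction closes.\<close>
    also have "(y (Suc n) o\<^sub>L y (Suc n)) - (y n o\<^sub>L y n) =
        (y (Suc n) o\<^sub>L (y (Suc n) - y n)) + ((y (Suc n) - y n) o\<^sub>L y n)"
      by (simp add: bounded_bilinear.diff_left[OF bounded_bilinear_blinfun_compose] bounded_bilinear.diff_right[OF bounded_bilinear_blinfun_compose])
    finally have "norm (y (Suc (Suc n)) - y (Suc n)) \<le>
        (1/2) * (norm (y (Suc n) o\<^sub>L (y (Suc n) - y n)) + norm ((y (Suc n) - y n) o\<^sub>L y n))"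
      using norm_triangle_ineq[of "y (Suc n) o\<^sub>L (y (Suc n) - y n)" "(y (Suc n) - y n) o\<^sub>L y n"]
      by simp
    also have "\<dots> \<le> (1/2) * (r (Suc n) * (r (Suc n) - r n) + (r (Suc n) - r n) * r n)"
    proof (intro mult_left_mono add_mono)
      show "norm (y (Suc n) o\<^sub>L (y (Suc n) - y n)) \<le> r (Suc n) * (r (Suc n) - r n)"
        using r01[of "Suc n"] by (intro order_trans[OF norm_blinfun_compose] mult_mono norm_y Suc) auto
      show "norm ((y (Suc n) - y n) o\<^sub>L y n) \<le> (r (Suc n) - r n) * r n"
        using mono[of n] by (intro order_trans[OF norm_blinfun_compose] mult_mono norm_y Suc) auto
    qed simp
    also have "\<dots> = r (Suc (Suc n)) - r (Suc n)"
      by (simp only: r(2)[of "Suc n"] r(2)[of n]) (simp add: field_simps power2_eq_square)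
    finally show ?case .
  qed
  have "summable (\<lambda>n. y (Suc n) - y n)"
    by (rule summable_comparison_test'[OF sum_r]) (rule diff)
  then have "convergent (\<lambda>n. \<Sum>i<n. y (Suc i) - y i)" by (simp add: summable_iff_convergent)
  then have "convergent y" by (simp add: sum_lessThan_telescope y(1))
  then obtain z where z: "y \<longlonglongrightarrow> z" by (auto simp: convergent_def)
  have "(\<lambda>n. y (Suc n)) \<longlonglongrightarrow> (1/2) *\<^sub>R (b + (z o\<^sub>L z))"
    unfolding y(2) by (intro tendsto_intros bounded_bilinear.tendsto[OF bounded_bilinear_blinfun_compose] z)
  then have "z = (1/2) *\<^sub>R (b + (z o\<^sub>L z))" using LIMSEQ_Suc[OF z] LIMSEQ_unique by blast
  then have "2 *\<^sub>R z = 2 *\<^sub>R ((1/2) *\<^sub>R (b + (z o\<^sub>L z)))" by (rule arg_cong)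
  then show thesis using that[OF z] by simp
qed

context algebra_representation
begin

lemma pi_scaleR_right: "h \<in> H \<Longrightarrow> \<pi> b (r *\<^sub>R h) = r *\<^sub>R \<pi> b h"
  using clinear_onD(2)[OF pi_clinear, of h b "of_real r"] by (simp add: scaleC_of_real)

text \<open>Polar decomposition: \<open>d = T a\<close> and \<open>k = \<bar>T\<bar> a\<close>.\<close>

lemma exists_equal_orbit_norms:
  assumes A: "submodule H \<pi> A" and D: "submodule H \<pi> D"
    and T: "intertwining_adjoints \<pi> A D T T'" and a0: "a0 \<in> A" "T a0 \<noteq> 0"
  obtains d k where "d \<in> D" "d \<noteq> 0" "k \<in> A" "\<And>b. norm (\<pi> b d) = norm (\<pi> b k)"
proof -
  note hA = submoduleD(1)[OF A]
  note cA = hilbert_spaceD(1)[OF hA]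
  have TA: "bounded_clinear_on A T" "\<And>a. a \<in> A \<Longrightarrow> T a \<in> D"
    and TD: "bounded_clinear_on D T'" "\<And>d. d \<in> D \<Longrightarrow> T' d \<in> A"
    and adj: "\<And>a d. a \<in> A \<Longrightarrow> d \<in> D \<Longrightarrow> cinner (T a) d = cinner a (T' d)"
    and comm: "\<And>b a. a \<in> A \<Longrightarrow> T (\<pi> b a) = \<pi> b (T a)" "\<And>b d. d \<in> D \<Longrightarrow> T' (\<pi> b d) = \<pi> b (T' d)"
    using T by (auto simp: intertwining_adjoints_def)
  obtain M where M: "M > 0" "\<And>a. a \<in> A \<Longrightarrow> norm (T a) \<le> M * norm a"
    using bounded_clinear_on_bound[OF TA(1)] by blast
  obtain M' where M': "M' > 0" "\<And>d. d \<in> D \<Longrightarrow> norm (T' d) \<le> M' * norm d"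
    using bounded_clinear_on_bound[OF TD(1)] by blast
  have lin: "clinear_on A T" "clinear_on D T'"
    using TA(1) TD(1) by (auto simp: bounded_clinear_on_def)
  \<comment> \<open>Precomposition with the projection makes T'T an operator on the whole type,
    where the square root iteration of bounded operators can run.\<close>
  define s where "s x = T' (T (proj A x))" for x
  have pA: "proj A x \<in> A" for x by (rule proj_in[OF hA])
  have sA: "s x \<in> A" for x unfolding s_def using TA(2) TD(2) pA by blast
  have s_add: "s (x + x') = s x + s x'" for x x'
    unfolding s_def by (simp add: proj_add[OF hA] clinear_onD(1)[OF lin(1)] clinear_onD(1)[OF lin(2)] pA TA(2))
  have s_scaleC: "s (c *\<^sub>C x) = c *\<^sub>C s x" for c x
    unfolding s_def by (simp add: proj_scaleC[OF hA] clinear_onD(2)[OF lin(1)] clinear_onD(2)[OF lin(2)] pA TA(2))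
  have s_scaleR: "s (r *\<^sub>R x) = r *\<^sub>R s x" for r x
    using s_scaleC[of "of_real r" x] by (simp add: scaleC_of_real)
  have norm_s: "norm (s x) \<le> M' * norm (T (proj A x))" for x
    unfolding s_def using M'(2) TA(2) pA by blast
  have s_form: "cinner x (s z) = cinner (T (proj A x)) (T (proj A z))" for x z
    using adj[OF pA TA(2)[OF pA], of x z] cinner_proj[OF hA, of x "s z"] proj_id[OF hA sA, of z]
    by (simp add: s_def)
  have s_selfadj: "cinner (s x) z = cinner x (s z)" for x z
    using s_form[of z x] s_form[of x z] by (metis cinner_commute)
  have s_comm: "s (\<pi> b a) = \<pi> b (s a)" if "a \<in> A" for b a
    using that submoduleD(4)[OF A that] comm TA(2) by (simp add: s_def proj_id[OF hA])
  \<comment> \<open>The inner product of x and \<open>s x\<close> is the squared norm of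
    \<open>T (proj A x)\<close> and dominates r times the squared norm of \<open>s x\<close>; hence
    1 - r s is a contraction.\<close>
  define r where "r = 1 / M'\<^sup>2"
  have r: "r > 0" using M'(1) by (simp add: r_def)
  have norm_b: "norm (x - r *\<^sub>R s x) \<le> 1 * norm x" for x
  proof -
    let ?t = "(norm (T (proj A x)))\<^sup>2"
    have "(norm (s x))\<^sup>2 \<le> M'\<^sup>2 * ?t"
      using power_mono[OF norm_s, of x 2] by (simp add: power_mult_distrib)
    then have "r * (norm (s x))\<^sup>2 \<le> ?t" using M'(1) by (simp add: r_def divide_le_eq mult.commute)
    then have "r * (r * (norm (s x))\<^sup>2) \<le> r * ?t" using r by (intro mult_left_mono) auto
    moreover have "(norm (x - r *\<^sub>R s x))\<^sup>2 = (norm x)\<^sup>2 + r * (r * (norm (s x))\<^sup>2) - 2 * (r * ?t)"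
    proof -
      have "Re (cinner x (r *\<^sub>R s x)) = r * ?t" by (simp add: cinner_scaleR_right s_form Re_cinner_self)
      moreover have "(norm (r *\<^sub>R s x))\<^sup>2 = r * (r * (norm (s x))\<^sup>2)"
        by (simp add: power_mult_distrib power2_eq_square)
      ultimately show ?thesis unfolding norm_diff_sqr by simp
    qed
    moreover have "0 \<le> r * ?t" using r by simp
    ultimately have "(norm (x - r *\<^sub>R s x))\<^sup>2 \<le> (norm x)\<^sup>2" by linarith
    then show ?thesis using power2_le_imp_le[of _ "norm x"] by simp
  qed
  define b where "b = Blinfun (\<lambda>x. x - r *\<^sub>R s x)"
  have "bounded_linear (\<lambda>x. x - r *\<^sub>R s x)"
    by (rule bounded_linear_intro[OF _ _ norm_b[unfolded mult.commute[of 1]]])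
      (simp_all add: s_add s_scaleR algebra_simps)
  then have b_app: "blinfun_apply b x = x - r *\<^sub>R s x" for x
    by (simp add: b_def bounded_linear_Blinfun_apply)
  have "norm b \<le> 1" by (rule norm_blinfun_bound) (use norm_b b_app in auto)
  define y where "y = rec_nat 0 (\<lambda>_ y. (1/2) *\<^sub>R (b + (y o\<^sub>L y)))"
  have y: "y 0 = 0" "y (Suc n) = (1/2) *\<^sub>R (b + (y n o\<^sub>L y n))" for n by (simp_all add: y_def)
  obtain z where z: "y \<longlonglongrightarrow> z" "2 *\<^sub>R z = b + (z o\<^sub>L z)"
    using one_minus_sqrt_iteration[of b y] \<open>norm b \<le> 1\<close> y by blast
  have y_app: "blinfun_apply (y (Suc n)) x = (1/2) *\<^sub>R (x - r *\<^sub>R s x + y n (y n x))" for n x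
    by (simp add: y b_app plus_blinfun.rep_eq scaleR_blinfun.rep_eq)
  have yA: "y n a \<in> A" if "a \<in> A" for n a
    using that
  proof (induction n arbitrary: a)
    case (Suc n)
    then show ?case
      unfolding y_app using sA csubspaceD[OF cA] by metis
  qed (simp add: y csubspaceD(1)[OF cA])
  have y_selfadj: "cinner (y n x) x' = cinner x (y n x')" for n x x'
  proof (induction n arbitrary: x x')
    case (Suc n)
    then show ?case
      by (simp add: y_app cinner_scaleR_left cinner_scaleR_right cinner_add_left cinner_add_right
          cinner.diff_left cinner.diff_right s_selfadj)
  qed (simp add: y)
  have y_comm: "y n (\<pi> c a) = \<pi> c (y n a)" if "a \<in> A" for n c a
    using that
  proof (induction n arbitrary: a)
    case (Suc n)
    note AH = submoduleD(3)[OF A]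
    have H: "r *\<^sub>R s a \<in> H" "a - r *\<^sub>R s a \<in> H" "y n (y n a) \<in> H" "a - r *\<^sub>R s a + y n (y n a) \<in> H"
      using AH sA yA Suc.prems csubspaceD[OF cA] by metis+
    show ?case
      using Suc.IH[OF Suc.prems] Suc.IH[OF yA[OF Suc.prems]]
        clinear_onD(1)[OF pi_clinear H(2,3)] clinear_on_diff[OF pi_clinear csubspace_H AH[OF Suc.prems] H(1)]
      by (simp add: y_app s_comm[OF Suc.prems] pi_scaleR_right[OF H(4)] pi_scaleR_right[OF AH[OF sA]])
  next
    case 0
    have "\<pi> c 0 = 0" using clinear_on_zero[OF pi_clinear csubspace_H] .
    then show ?case by (simp add: y)
  qed
  have lim: "(\<lambda>n. y n x) \<longlonglongrightarrow> z x" for x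
    by (rule blinfun.tendsto[OF z(1) tendsto_const])
  have zA: "z a \<in> A" if "a \<in> A" for a
    using closed_sequentially[OF hilbert_spaceD(2)[OF hA] _ lim] yA[OF that] by blast
  have z_selfadj: "cinner (z x) x' = cinner x (z x')" for x x'
    using LIMSEQ_unique[OF cinner.tendsto[OF lim tendsto_const] cinner.tendsto[OF tendsto_const lim, of x x', folded y_selfadj]] .
  have z_comm: "z (\<pi> c a) = \<pi> c (z a)" if "a \<in> A" for c a
  proof -
    have "(\<lambda>n. \<pi> c (y n a)) \<longlonglongrightarrow> \<pi> c (z a)"
      by (rule bounded_clinear_on_tendsto[OF pi_bounded_clinear csubspace_H _ _ lim])
        (use yA zA that submoduleD(3)[OF A] in auto)
    then show ?thesis using LIMSEQ_unique[OF lim] y_comm[OF that] by simp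
  qed
  \<comment> \<open>z solves (1 - z)^2 = 1 - b = r s, so q is a self-adjoint square root of s
    divided by M'^2, and M' q takes the place of |T|.\<close>
  define q where "q x = x - z x" for x
  have qq: "q (q x) = r *\<^sub>R s x" for x
  proof -
    have "2 *\<^sub>R z x = x - r *\<^sub>R s x + z (z x)"
      using arg_cong[OF z(2), of "\<lambda>f. blinfun_apply f x"]
      by (simp add: plus_blinfun.rep_eq scaleR_blinfun.rep_eq b_app)
    then show ?thesis by (simp add: q_def blinfun.diff_right scaleR_2 algebra_simps)
  qed
  have norm_q: "norm (T a) = M' * norm (q a)" if a: "a \<in> A" for a
  proof -
    have "(norm (q a))\<^sup>2 = Re (cinner (q a) (q a))" by (simp add: Re_cinner_self)
    also have "cinner (q a) (q a) = cinner a (q (q a))"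
      unfolding q_def[of a] q_def[of "a - z a"]
      by (simp add: cinner.diff_left cinner.diff_right z_selfadj blinfun.diff_right)
    also have "Re \<dots> = r * (norm (T a))\<^sup>2"
      by (simp add: qq cinner_scaleR_right s_form Re_cinner_self proj_id[OF hA a])
    finally have "(M' * norm (q a))\<^sup>2 = (norm (T a))\<^sup>2"
      using M'(1) by (simp add: r_def power_mult_distrib)
    then show ?thesis using M'(1) by (simp add: power2_eq_iff_nonneg)
  qed
  have qA: "q a \<in> A" if "a \<in> A" for a unfolding q_def by (rule csubspaceD(5)[OF cA that zA[OF that]])
  have q_comm: "q (\<pi> c a) = \<pi> c (q a)" if a: "a \<in> A" for c a
    using clinear_on_diff[OF pi_clinear csubspace_H] submoduleD(3)[OF A] a zA[OF a]
    by (simp add: q_def z_comm[OF a])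
  show thesis
  proof (rule that[of "T a0" "M' *\<^sub>R q a0"])
    show "norm (\<pi> c (T a0)) = norm (\<pi> c (M' *\<^sub>R q a0))" for c
    proof -
      have "\<pi> c (M' *\<^sub>R q a0) = M' *\<^sub>R q (\<pi> c a0)"
        using pi_scaleR_right submoduleD(3)[OF A qA[OF a0(1)]] q_comm[OF a0(1)] by simp
      moreover have "norm (\<pi> c (T a0)) = M' * norm (q (\<pi> c a0))"
        using norm_q[OF submoduleD(4)[OF A a0(1)]] comm(1)[OF a0(1)] by simp
      ultimately show ?thesis using M'(1) by simp
    qed
  qed (use TA(2) a0 csubspaceD(6)[OF cA qA] in auto)
qed

end

section \<open>Embedding into a multiple of a faithful submodule\<close>

context algebra_representation
begin

text \<open>Zorn's lemma gives a maximal family of nonzero vectors s with pairwise orthogonal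
  orbits, each having a partner k in A with the same orbit norms. The family is a set of vectors of
  H, so \<open>'h\<close> itself can index the copies of A: the orbit of s goes to that of its
  partner in copy s. By maximality these orbits span a dense subspace.\<close>

lemma exists_embedding:
  assumes A: "submodule H \<pi> A"
    and ex: "\<And>D d. submodule H \<pi> D \<Longrightarrow> d \<in> D \<Longrightarrow> d \<noteq> 0 \<Longrightarrow>
      \<exists>d'\<in>D. d' \<noteq> 0 \<and> (\<exists>k\<in>A. \<forall>b. norm (\<pi> b d') = norm (\<pi> b k))"
  obtains U :: "'h \<Rightarrow> ('h, 'h) ell2" where
    "clinear_on H U" "\<And>h. h \<in> H \<Longrightarrow> norm (U h) = norm h" "\<And>h. h \<in> H \<Longrightarrow> U h \<in> fibre (\<lambda>_. A)"
    "\<And>b h. h \<in> H \<Longrightarrow> U (\<pi> b h) = amp (\<pi> b) (U h)"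
proof -
  let ?L = "fibre (\<lambda>_. H) :: ('h, 'h) ell2 set"
  interpret L: algebra_representation ?L "\<lambda>b. amp (\<pi> b)" by (rule algebra_representation_amp)
  define \<A> where "\<A> = {S. S \<subseteq> {s\<in>H. s \<noteq> 0 \<and> (\<exists>k\<in>A. \<forall>b. norm (\<pi> b s) = norm (\<pi> b k))} \<and>
    (\<forall>s\<in>S. \<forall>t\<in>S. s \<noteq> t \<longrightarrow> (\<forall>b c. cinner (\<pi> b s) (\<pi> c t) = 0))}"
  have "\<exists>M\<in>\<A>. \<forall>X\<in>\<A>. M \<subseteq> X \<longrightarrow> X = M"
  proof (rule subset_Zorn')
    fix C assume C: "subset.chain \<A> C"
    have C1: "X \<in> \<A>" if "X \<in> C" for X using C that by (auto simp: subset.chain_def)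
    have C2: "X \<subseteq> Y \<or> Y \<subseteq> X" if "X \<in> C" "Y \<in> C" for X Y
      using C that by (auto simp: subset.chain_def)
    show "\<Union>C \<in> \<A>"
      unfolding \<A>_def
    proof (intro CollectI conjI ballI impI allI)
      show "\<Union>C \<subseteq> {s\<in>H. s \<noteq> 0 \<and> (\<exists>k\<in>A. \<forall>b. norm (\<pi> b s) = norm (\<pi> b k))}"
        using C1 unfolding \<A>_def by blast
      fix s t b c assume "s \<in> \<Union>C" "t \<in> \<Union>C" "s \<noteq> t"
      then obtain X where "X \<in> C" "s \<in> X" "t \<in> X" using C2 by blast
      then show "cinner (\<pi> b s) (\<pi> c t) = 0" using C1 \<open>s \<noteq> t\<close> unfolding \<A>_def by blast
    qed
  qed
  then obtain S where S: "S \<in> \<A>" and max: "\<And>X. X \<in> \<A> \<Longrightarrow> S \<subseteq> X \<Longrightarrow> X = S" by blast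
  have SH: "s \<in> H" if "s \<in> S" for s using S that by (auto simp: \<A>_def)
  have orth: "cinner (\<pi> b s) (\<pi> c t) = 0" if "s \<in> S" "t \<in> S" "s \<noteq> t" for s t b c
    using S that by (auto simp: \<A>_def)
  have "\<forall>s\<in>S. \<exists>k. k \<in> A \<and> (\<forall>b. norm (\<pi> b s) = norm (\<pi> b k))" using S by (auto simp: \<A>_def)
  then obtain k where k: "\<And>s. s \<in> S \<Longrightarrow> k s \<in> A" "\<And>s b. s \<in> S \<Longrightarrow> norm (\<pi> b s) = norm (\<pi> b (k s))"
    by metis
  have kH: "k s \<in> H" if "s \<in> S" for s using submoduleD(3)[OF A k(1)[OF that]] .
  define x where "x F \<beta> = (\<Sum>s\<in>F. \<pi> (\<beta> s) s)" for F \<beta>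
  define y where "y F \<beta> = (\<Sum>s\<in>F. delta s (\<pi> (\<beta> s) (k s)))" for F and \<beta> :: "'h \<Rightarrow> 'b"
  \<comment> \<open>One vector may be \<open>x F \<beta>\<close> for many coefficients
    \<open>\<beta>\<close>; passing to a relation lets isometry make the image unique.\<close>
  define R where "R = {(x F \<beta>, y F \<beta>) | F \<beta>. finite F \<and> F \<subseteq> S}"
  have ext: "x F \<beta> = x (F \<union> F') (\<lambda>s. if s \<in> F then \<beta> s else 0)"
    "y F \<beta> = y (F \<union> F') (\<lambda>s. if s \<in> F then \<beta> s else 0)" if "finite F" "finite F'" "F \<subseteq> S" "F' \<subseteq> S" for F F' \<beta>
  proof -
    have delta0: "delta s 0 = (0 :: ('h, 'h) ell2)" for s
      by (rule ell2_eqI) (simp add: ell2_apply_delta zero_ell2.rep_eq)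
    show "x F \<beta> = x (F \<union> F') (\<lambda>s. if s \<in> F then \<beta> s else 0)"
      unfolding x_def by (rule sum.mono_neutral_cong_left) (use that pi_zero SH in auto)
    show "y F \<beta> = y (F \<union> F') (\<lambda>s. if s \<in> F then \<beta> s else 0)"
      unfolding y_def by (rule sum.mono_neutral_cong_left) (use that pi_zero kH delta0 in auto)
  qed
  have add: "x F \<beta> + x F \<gamma> = x F (\<lambda>s. \<beta> s + \<gamma> s)" "y F \<beta> + y F \<gamma> = y F (\<lambda>s. \<beta> s + \<gamma> s)"
    if "F \<subseteq> S" for F \<beta> \<gamma>
    unfolding x_def y_def sum.distrib[symmetric]
    by (rule sum.cong; use that SH kH in \<open>auto simp: pi_add delta_add\<close>)+
  have scale: "c *\<^sub>C x F \<beta> = x F (\<lambda>s. c *\<^sub>C \<beta> s)" "c *\<^sub>C y F \<beta> = y F (\<lambda>s. c *\<^sub>C \<beta> s)"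
    if "F \<subseteq> S" for F c \<beta>
  proof -
    have lin: "clinear_on UNIV ((*\<^sub>C) c :: 'v::complex_vector \<Rightarrow> 'v)"
      by (simp add: clinear_on_def scaleC_add_right scaleC_scaleC mult.commute)
    have cU: "csubspace (UNIV :: 'v::complex_vector set)" by (simp add: csubspace_def)
    show "c *\<^sub>C x F \<beta> = x F (\<lambda>s. c *\<^sub>C \<beta> s)"
      unfolding x_def using that SH
      by (subst clinear_on_sum[OF lin cU]) (auto simp: pi_scaleC intro!: sum.cong)
    show "c *\<^sub>C y F \<beta> = y F (\<lambda>s. c *\<^sub>C \<beta> s)"
      unfolding y_def using that kH
      by (subst clinear_on_sum[OF lin cU]) (auto simp: pi_scaleC delta_scaleC intro!: sum.cong)
  qed
  have xH: "x F \<beta> \<in> H" if "F \<subseteq> S" for F \<beta>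
    unfolding x_def by (rule csubspace_sum[OF csubspace_H]) (use that SH pi_in in auto)
  have cfA: "hilbert_space (fibre (\<lambda>_. A) :: ('h, 'h) ell2 set)"
    by (rule hilbert_space_fibre[OF submoduleD(1)[OF A]])
  have A0: "0 \<in> A" using hilbert_space_mem(1)[OF submoduleD(1)[OF A]] .
  have yA: "y F \<beta> \<in> fibre (\<lambda>_. A)" if "F \<subseteq> S" for F \<beta>
    unfolding y_def
    by (rule csubspace_sum[OF hilbert_spaceD(1)[OF cfA]])
      (use that submoduleD(4)[OF A k(1)] A0 in \<open>auto simp: fibre_def ell2_apply_delta\<close>)
  have fA_L: "fibre (\<lambda>_. A) \<subseteq> ?L" using submoduleD(2)[OF A] by (auto simp: fibre_def)
  have act: "\<pi> c (x F \<beta>) = x F (\<lambda>s. c * \<beta> s)" "amp (\<pi> c) (y F \<beta>) = y F (\<lambda>s. c * \<beta> s)"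
    if "F \<subseteq> S" for F c \<beta>
  proof -
    show "\<pi> c (x F \<beta>) = x F (\<lambda>s. c * \<beta> s)"
      unfolding x_def using that SH
      by (subst clinear_on_sum[OF pi_clinear csubspace_H]) (auto simp: pi_mult pi_in intro!: sum.cong)
    show "amp (\<pi> c) (y F \<beta>) = y F (\<lambda>s. c * \<beta> s)"
      unfolding y_def using that kH
      by (subst clinear_on_sum[OF L.pi_clinear L.csubspace_H])
        (auto simp: pi_mult pi_in delta_in_fibre amp_delta[OF pi_bounded_clinear csubspace_H] intro!: sum.cong)
  qed
  have R_add: "(u + u', v + v') \<in> R" if R: "(u, v) \<in> R" "(u', v') \<in> R" for u v u' v'
  proof -
    obtain F \<beta> F' \<gamma> where F: "finite F" "F \<subseteq> S" "u = x F \<beta>" "v = y F \<beta>"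
      "finite F'" "F' \<subseteq> S" "u' = x F' \<gamma>" "v' = y F' \<gamma>" using R unfolding R_def by blast
    let ?b = "\<lambda>s. (if s \<in> F then \<beta> s else 0) + (if s \<in> F' then \<gamma> s else 0)"
    have "u + u' = x (F \<union> F') ?b" "v + v' = y (F \<union> F') ?b"
      using F ext[of F F' \<beta>] ext[of F' F \<gamma>] add[of "F \<union> F'"] by (auto simp: Un_commute)
    then show ?thesis unfolding R_def using F by blast
  qed
  have R_scale: "(c *\<^sub>C u, c *\<^sub>C v) \<in> R" if uv: "(u, v) \<in> R" for c u v
  proof -
    obtain F \<beta> where F: "finite F" "F \<subseteq> S" "u = x F \<beta>" "v = y F \<beta>" using uv unfolding R_def by blast
    then show ?thesis unfolding R_def using scale[OF F(2)] by auto
  qed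
  have R_iso: "norm v = norm u" if uv: "(u, v) \<in> R" for u v
  proof -
    obtain F \<beta> where F: "finite F" "F \<subseteq> S" "u = x F \<beta>" "v = y F \<beta>" using uv unfolding R_def by blast
    have "(norm u)\<^sup>2 = (\<Sum>s\<in>F. (norm (\<pi> (\<beta> s) s))\<^sup>2)"
      unfolding F(3) x_def by (rule norm_sum_orthogonal[OF F(1)]) (rule orth; use F(2) in blast)
    also have "\<dots> = (\<Sum>s\<in>F. (norm (delta s (\<pi> (\<beta> s) (k s))))\<^sup>2)"
      by (rule sum.cong) (use F(2) k(2) in \<open>auto simp: norm_delta\<close>)
    also have "\<dots> = (norm v)\<^sup>2"
      unfolding F(4) y_def
      by (rule norm_sum_orthogonal[OF F(1), symmetric]) (auto simp: cinner_delta ell2_apply_delta)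
    finally show ?thesis by simp
  qed
  obtain U where U: "clinear_on (closure (fst ` R)) U"
    "\<And>h. h \<in> closure (fst ` R) \<Longrightarrow> norm (U h) = norm h"
    "\<And>h. h \<in> closure (fst ` R) \<Longrightarrow> (h, U h) \<in> closure R"
    "\<And>h v. (h, v) \<in> closure R \<Longrightarrow> v = U h"
    using isometric_relation_extension[of R] R_add R_scale R_iso by blast
  have N: "u \<in> fst ` R \<longleftrightarrow> (\<exists>F \<beta>. finite F \<and> F \<subseteq> S \<and> u = x F \<beta>)" for u
    unfolding R_def by force
  have dense: "closure (fst ` R) = H"
  proof (rule closure_eqI_orthogonal[OF hilbert_space])
    show "csubspace (fst ` R)"
      unfolding csubspace_def
    proof (intro conjI ballI allI)
      have "0 = x {} (\<lambda>_. 0)" by (simp add: x_def)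
      then show "0 \<in> fst ` R" unfolding N by (intro exI[of _ "{}"] exI conjI) auto
      show "u + v \<in> fst ` R" if "u \<in> fst ` R" "v \<in> fst ` R" for u v
        using that R_add by force
      show "c *\<^sub>C u \<in> fst ` R" if "u \<in> fst ` R" for c u
        using that R_scale by force
    qed
    show NH: "fst ` R \<subseteq> H" unfolding R_def using xH by auto
    fix h assume h: "h \<in> H" "\<And>n. n \<in> fst ` R \<Longrightarrow> cinner n h = 0"
    \<comment> \<open>If h were nonzero, this submodule would supply a further member of the maximal
      family.\<close>
    let ?D = "H \<inter> {h. \<forall>n\<in>fst ` R. cinner n h = 0}"
    show "h = 0"
    proof (rule ccontr)
      assume "h \<noteq> 0"
      have D: "submodule H \<pi> ?D"
      proof (rule submodule_orthogonal[OF NH])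
        fix b n assume "n \<in> fst ` R"
        then obtain F \<beta> where F: "finite F" "F \<subseteq> S" "n = x F \<beta>" unfolding N by blast
        then show "\<pi> b n \<in> fst ` R" unfolding N using act(1)[OF F(2)] by (intro exI[of _ F] exI conjI) auto
      qed
      obtain d where d: "d \<in> ?D" "d \<noteq> 0" "\<exists>k\<in>A. \<forall>b. norm (\<pi> b d) = norm (\<pi> b k)"
        using ex[OF D _ \<open>h \<noteq> 0\<close>] h by auto
      have mem: "\<pi> b s \<in> fst ` R" if "s \<in> S" for b s
      proof -
        have "\<pi> b s = x {s} (\<lambda>_. b)" by (simp add: x_def)
        then show ?thesis unfolding N using that by (intro exI[of _ "{s}"] exI conjI) auto
      qed
      have d_orth: "cinner (\<pi> b s) (\<pi> c d) = 0" if "s \<in> S" for b c s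
        using mem[OF that] submoduleD(4)[OF D d(1)] by blast
      have "insert d S \<in> \<A>"
        using S d d_orth d_orth[THEN iffD1[OF cinner_eq_zero_comm]] unfolding \<A>_def by auto
      then have "d \<in> S" using max[of "insert d S"] by blast
      then have "\<pi> b d = 0" for b using d_orth[of d b b] by simp
      then have "d = 0" using eq_zeroI d(1) by blast
      then show False using d(2) by simp
    qed
  qed
  have RA: "closure R \<subseteq> UNIV \<times> fibre (\<lambda>_. A)"
  proof (rule closure_minimal)
    show "R \<subseteq> UNIV \<times> fibre (\<lambda>_. A)" using yA unfolding R_def by blast
    show "closed ((UNIV :: 'h set) \<times> (fibre (\<lambda>_. A) :: ('h, 'h) ell2 set))"
      by (intro closed_Times closed_UNIV hilbert_spaceD(2)[OF cfA])
  qed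
  show thesis
  proof (rule that[of U])
    show "clinear_on H U" "\<And>h. h \<in> H \<Longrightarrow> norm (U h) = norm h" using U(1,2) dense by simp_all
    show UA: "U h \<in> fibre (\<lambda>_. A)" if "h \<in> H" for h
      using U(3) that RA dense by blast
    show "U (\<pi> b h) = amp (\<pi> b) (U h)" if h: "h \<in> H" for b h
    proof -
      have "(h, U h) \<in> closure R" using U(3) h dense by simp
      then obtain u where u: "\<forall>n. u n \<in> R" "u \<longlonglongrightarrow> (h, U h)" unfolding closure_sequential by blast
      have f: "fst (u n) \<in> H" "snd (u n) \<in> ?L" "(\<pi> b (fst (u n)), amp (\<pi> b) (snd (u n))) \<in> R" for n
      proof -
        obtain F \<beta> where F: "finite F" "F \<subseteq> S" "u n = (x F \<beta>, y F \<beta>)" using u(1) unfolding R_def by blast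
        show "fst (u n) \<in> H" "snd (u n) \<in> ?L" using F xH yA fA_L by auto
        show "(\<pi> b (fst (u n)), amp (\<pi> b) (snd (u n))) \<in> R"
          unfolding R_def using F act[OF F(2)] by auto
      qed
      have "(\<lambda>n. \<pi> b (fst (u n))) \<longlonglongrightarrow> \<pi> b h"
        using tendsto_fst[OF u(2)] by (intro bounded_clinear_on_tendsto[OF pi_bounded_clinear csubspace_H f(1) h]) simp
      moreover have "(\<lambda>n. amp (\<pi> b) (snd (u n))) \<longlonglongrightarrow> amp (\<pi> b) (U h)"
        using tendsto_snd[OF u(2)] fA_L UA[OF h]
        by (intro bounded_clinear_on_tendsto[OF L.pi_bounded_clinear L.csubspace_H f(2)]) auto
      ultimately have "(\<lambda>n. (\<pi> b (fst (u n)), amp (\<pi> b) (snd (u n)))) \<longlonglongrightarrow> (\<pi> b h, amp (\<pi> b) (U h))"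
        by (rule tendsto_Pair)
      then have "(\<pi> b h, amp (\<pi> b) (U h)) \<in> closure R"
        unfolding closure_sequential using f(3) by (intro exI conjI) auto
      then show ?thesis using U(4) by simp
    qed
  qed
qed

end

section \<open>Schroeder--Bernstein for isometric intertwiners\<close>

text \<open>Let D be the complement of Y and Z the smallest submodule that contains D and is mapped
  into itself by V. The map U that is V on Z and the identity on the complement of Z takes H
  isometrically onto Y, since V shifts D into Y along Z; W is its inverse. X is orthogonal to Z and
  therefore fixed.\<close>

lemma (in algebra_representation) schroeder_bernstein:
  assumes Y: "submodule H \<pi> Y"
    and V: "clinear_on H V" "\<And>h. h \<in> H \<Longrightarrow> norm (V h) = norm h" "\<And>h. h \<in> H \<Longrightarrow> V h \<in> Y"
      "\<And>b h. h \<in> H \<Longrightarrow> V (\<pi> b h) = \<pi> b (V h)"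
    and X: "X \<subseteq> Y" "\<And>b x. x \<in> X \<Longrightarrow> \<pi> b x \<in> X" "\<And>x. x \<in> X \<Longrightarrow> V x = x"
  obtains W where "clinear_on Y W" "\<And>y. y \<in> Y \<Longrightarrow> norm (W y) = norm y" "W ` Y = H"
    "\<And>b y. y \<in> Y \<Longrightarrow> W (\<pi> b y) = \<pi> b (W y)" "\<And>x. x \<in> X \<Longrightarrow> W x = x"
proof -
  note hY = submoduleD(1)[OF Y]
  note YH = submoduleD(3)[OF Y]
  have VH: "V h \<in> H" if "h \<in> H" for h using V(3)[OF that] YH by blast
  have Vc: "cinner (V h) (V k) = cinner h k" if "h \<in> H" "k \<in> H" for h k
    by (rule isometry_cinner[OF V(1) csubspace_H V(2) that])
  have bV: "bounded_clinear_on H V"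
    using V(1,2) by (auto simp: bounded_clinear_on_def intro!: exI[of _ 1])
  define D where "D = H \<inter> {h. \<forall>n\<in>Y. cinner n h = 0}"
  have D: "submodule H \<pi> D"
    unfolding D_def by (rule submodule_orthogonal) (use submoduleD[OF Y] in auto)
  define \<Z> where "\<Z> = {Z. submodule H \<pi> Z \<and> D \<subseteq> Z \<and> V ` Z \<subseteq> Z}"
  define Z where "Z = \<Inter>\<Z>"
  have "H \<in> \<Z>"
    using hilbert_space pi_in VH submoduleD(2)[OF D] by (auto simp: \<Z>_def submodule_def)
  then have Z: "submodule H \<pi> Z"
    unfolding Z_def submodule_def hilbert_space_def
    by (intro conjI closed_Inter csubspace_Inter) (auto simp: \<Z>_def submodule_def hilbert_space_def)
  have DZ: "D \<subseteq> Z" and VZ: "z \<in> Z \<Longrightarrow> V z \<in> Z" for z by (auto simp: Z_def \<Z>_def)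
  have Zmin: "Z \<subseteq> Z'" if "submodule H \<pi> Z'" "D \<subseteq> Z'" "\<And>z. z \<in> Z' \<Longrightarrow> V z \<in> Z'" for Z'
    using that by (auto simp: Z_def \<Z>_def)
  note hZ = submoduleD(1)[OF Z]
  note ZH = submoduleD(3)[OF Z]
  have pZ: "proj Z h \<in> Z" for h by (rule proj_in[OF hZ])
  have pZH: "proj Z h \<in> H" for h using pZ ZH by blast
  \<comment> \<open>Vectors orthogonal to Z are orthogonal to D, hence lie in Y.\<close>
  have orthZ: "h - proj Z h \<in> Y" if h: "h \<in> H" for h
  proof -
    let ?k = "h - proj Z h"
    have kH: "?k \<in> H" using csubspaceD(5)[OF csubspace_H h pZH] .
    have "?k - proj Y ?k \<in> D"
      using csubspaceD(5)[OF csubspace_H kH YH[OF proj_in[OF hY]]] proj_orth[OF hY] by (simp add: D_def)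
    then have "cinner (?k - proj Y ?k) ?k = 0" using proj_orth[OF hZ] DZ by blast
    moreover have "cinner (?k - proj Y ?k) (proj Y ?k) = 0"
      using proj_orth[OF hY proj_in[OF hY]] cinner_eq_zero_comm by blast
    ultimately have "cinner (?k - proj Y ?k) (?k - proj Y ?k) = 0"
      by (subst cinner.diff_right) simp
    then have "?k = proj Y ?k" by simp
    then show ?thesis using proj_in[OF hY] by metis
  qed
  have hVZ: "hilbert_space (V ` Z)"
    by (rule isometry_image_closed[OF _ hZ]) (use V(1,2) ZH in \<open>auto simp: clinear_on_def\<close>)
  have ZY: "y \<in> V ` Z" if y: "y \<in> Z" "y \<in> Y" for y
  proof -
    \<comment> \<open>Minimality of Z is applied to the intersection of this set with Z: vectors of
      D project to 0, and for z in Z the vector V z lies in Y, so it is its own projection.\<close>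
    let ?Z' = "{z \<in> H. proj Y z \<in> V ` Z}"
    have "submodule H \<pi> ?Z'"
      unfolding submodule_def hilbert_space_def
    proof (intro conjI allI ballI)
      show "csubspace ?Z'"
        unfolding csubspace_def
        using csubspaceD(1-3)[OF csubspace_H] hilbert_space_mem(1-3)[OF hVZ] proj_id[OF hY hilbert_space_mem(1)[OF hY]]
        by (auto simp: proj_add[OF hY] proj_scaleC[OF hY])
      have "?Z' = H \<inter> proj Y -` (V ` Z)" by auto
      moreover have "closed (H \<inter> proj Y -` (V ` Z))"
        by (intro closed_Int hilbert_spaceD(2)[OF hilbert_space] closed_vimage hilbert_spaceD(2)[OF hVZ]
            bounded_linear.continuous_on[OF bounded_linear_proj[OF hY]] continuous_on_id)
      ultimately show "closed ?Z'" by simp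
      fix b z assume z: "z \<in> ?Z'"
      then obtain z' where z': "z' \<in> Z" "proj Y z = V z'" by blast
      then have "proj Y (\<pi> b z) = V (\<pi> b z')"
        using submodule_proj[OF Y, of z b] z V(4)[OF ZH[OF z'(1)]] by simp
      then show "\<pi> b z \<in> ?Z'" using z pi_in submoduleD(4)[OF Z z'(1)] by auto
    qed auto
    moreover have "D \<subseteq> ?Z'"
    proof
      fix d assume d: "d \<in> D"
      then have "proj Y d = 0" by (intro proj_eq_zeroI[OF hY]) (auto simp: D_def)
      then show "d \<in> ?Z'" using d hilbert_space_mem(1)[OF hVZ] by (simp add: D_def)
    qed
    moreover have Vz': "V z \<in> ?Z'" if z: "z \<in> ?Z' \<inter> Z" for z
    proof -
      have "proj Y (V z) = V z" using proj_id[OF hY V(3)] z by blast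
      then show ?thesis using z VH by auto
    qed
    ultimately have "submodule H \<pi> (?Z' \<inter> Z)" "D \<subseteq> ?Z' \<inter> Z"
      using Z DZ hilbert_space_Int by (auto simp: submodule_def)
    then have "Z \<subseteq> ?Z' \<inter> Z" by (rule Zmin) (use Vz' VZ in blast)
    then have "proj Y y \<in> V ` Z" using y(1) by blast
    then show ?thesis unfolding proj_id[OF hY y(2)] .
  qed
  define U where "U h = V (proj Z h) + (h - proj Z h)" for h
  have U_lin: "clinear_on H U"
    unfolding clinear_on_def U_def
    by (simp add: proj_add[OF hZ] proj_scaleC[OF hZ] clinear_onD[OF V(1)] pZH scaleC_add_right scaleC_diff_right)
  have norm_U: "norm (U h) = norm h" if h: "h \<in> H" for h
  proof -
    have "cinner (V (proj Z h)) (h - proj Z h) = 0" by (rule proj_orth[OF hZ VZ[OF pZ]])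
    then have "(norm (U h))\<^sup>2 = (norm h)\<^sup>2"
      unfolding U_def norm_add_sqr norm_proj_pythagoras[OF hZ, of h] V(2)[OF pZH] by simp
    then show ?thesis by simp
  qed
  have UY: "U h \<in> Y" if h: "h \<in> H" for h
    unfolding U_def using hilbert_space_mem(2)[OF hY V(3)[OF pZH] orthZ[OF h]] .
  have U_onto: "\<exists>h\<in>H. U h = y" if y: "y \<in> Y" for y
  proof -
    have d: "y - proj Z y \<in> Y" by (rule orthZ[OF YH[OF y]])
    \<comment> \<open>So \<open>proj Z y\<close> lies in both Z and Y, hence is the image under V of
      a vector of Z.\<close>
    have "y - (y - proj Z y) \<in> Y" by (rule hilbert_space_mem(5)[OF hY y d])
    then have "proj Z y \<in> V ` Z" using ZY[OF pZ] by simp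
    then obtain z where z: "z \<in> Z" "proj Z y = V z" by blast
    let ?h = "z + (y - proj Z y)"
    have "proj Z ?h = z"
    proof (rule proj_unique[OF hZ z(1)])
      show "cinner s (?h - z) = 0" if "s \<in> Z" for s using proj_orth[OF hZ that, of y] by simp
    qed
    then have "U ?h = y" using z(2) by (simp add: U_def)
    moreover have "?h \<in> H" using csubspaceD(2)[OF csubspace_H ZH[OF z(1)] YH[OF d]] .
    ultimately show ?thesis by blast
  qed
  have U_comm: "U (\<pi> b h) = \<pi> b (U h)" if h: "h \<in> H" for b h
  proof -
    have d: "h - proj Z h \<in> H" using csubspaceD(5)[OF csubspace_H h pZH] .
    have "\<pi> b (U h) = \<pi> b (V (proj Z h)) + (\<pi> b h - \<pi> b (proj Z h))"
      using clinear_onD(1)[OF pi_clinear VH[OF pZH] d] clinear_on_diff[OF pi_clinear csubspace_H h pZH]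
      by (simp add: U_def)
    then show ?thesis by (simp add: U_def submodule_proj[OF Z h] V(4)[OF pZH])
  qed
  have U_X: "U x = x" if x: "x \<in> X" for x
  proof -
    have XH: "x \<in> H" if "x \<in> X" for x using that X(1) YH by blast
    \<comment> \<open>V fixes X and preserves inner products, so the complement of X is invariant
      under V; it contains D, hence Z.\<close>
    let ?Z' = "H \<inter> {h. \<forall>x\<in>X. cinner x h = 0}"
    have "Z \<subseteq> ?Z'"
    proof (rule Zmin)
      show "submodule H \<pi> ?Z'" by (rule submodule_orthogonal) (use XH X(2) in auto)
      show "D \<subseteq> ?Z'" using X(1) by (auto simp: D_def)
      show "V z \<in> ?Z'" if "z \<in> ?Z'" for z
      proof -
        have "cinner x (V z) = 0" if x: "x \<in> X" for x
          using Vc[OF XH[OF x], of z] X(3)[OF x] \<open>z \<in> ?Z'\<close> x by simp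
        then show ?thesis using that VH by blast
      qed
    qed
    have "proj Z x = 0"
    proof (rule proj_eq_zeroI[OF hZ])
      fix s assume "s \<in> Z"
      then have "cinner x s = 0" using \<open>Z \<subseteq> ?Z'\<close> x by blast
      then show "cinner s x = 0" by (simp add: cinner_eq_zero_comm[of s x])
    qed
    then show ?thesis using clinear_on_zero[OF V(1) csubspace_H] by (simp add: U_def)
  qed
  have "\<forall>y\<in>Y. \<exists>h. h \<in> H \<and> U h = y" using U_onto by blast
  then obtain W where W: "\<And>y. y \<in> Y \<Longrightarrow> W y \<in> H" "\<And>y. y \<in> Y \<Longrightarrow> U (W y) = y" by metis
  have U_inj: "h = k" if "h \<in> H" "k \<in> H" "U h = U k" for h k
    using norm_U[OF csubspaceD(5)[OF csubspace_H that(1,2)]] clinear_on_diff[OF U_lin csubspace_H that(1,2)] that(3)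
    by simp
  show thesis
  proof (rule that[of W])
    note cH = csubspaceD[OF csubspace_H] and cY = hilbert_space_mem[OF hY]
    show "clinear_on Y W"
      unfolding clinear_on_def
    proof (intro conjI ballI allI)
      show "W (y + y') = W y + W y'" if "y \<in> Y" "y' \<in> Y" for y y'
        by (rule U_inj) (use that W cY(2)[OF that] cH(2) clinear_onD(1)[OF U_lin W(1) W(1)] in auto)
      show "W (c *\<^sub>C y) = c *\<^sub>C W y" if "y \<in> Y" for c y
        by (rule U_inj) (use that W cY(3)[OF that] cH(3) clinear_onD(2)[OF U_lin W(1)] in auto)
    qed
    show "norm (W y) = norm y" if "y \<in> Y" for y using norm_U[OF W(1)[OF that]] W(2)[OF that] by simp
    show "W ` Y = H"
    proof
      show "W ` Y \<subseteq> H" using W(1) by blast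
      show "H \<subseteq> W ` Y"
      proof
        fix h assume h: "h \<in> H"
        have "W (U h) = h" by (rule U_inj) (use W UY[OF h] h in auto)
        then show "h \<in> W ` Y" using UY[OF h] by force
      qed
    qed
    show "W (\<pi> b y) = \<pi> b (W y)" if "y \<in> Y" for b y
      by (rule U_inj) (use that W submoduleD(4)[OF Y that] pi_in U_comm[OF W(1)[OF that]] in auto)
    show "W x = x" if "x \<in> X" for x
      by (rule U_inj) (use that W X(1) YH U_X[OF that] in auto)
  qed
qed

section \<open>Amplified embeddings\<close>

text \<open>A family of families is flattened along \<open>\<kappa>\<close>, and summing rows first
  gives the norm. A mere injection is allowed so that some positions remain empty.\<close>

lemma norm_ell2_spread:
  fixes f :: "('j, 'h::complex_hilbert) ell2" and F :: "'j \<Rightarrow> ('i, 'k::complex_hilbert) ell2"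
  assumes F: "\<And>j. norm (F j) = norm (ell2_apply f j)" and \<kappa>: "inj (\<kappa> :: 'j \<times> 'i \<Rightarrow> 'm)"
  obtains g :: "('m, 'k) ell2" where "norm g = norm f"
    "\<And>j i. ell2_apply g (\<kappa> (j, i)) = ell2_apply (F j) i" "\<And>m. m \<notin> range \<kappa> \<Longrightarrow> ell2_apply g m = 0"
proof -
  define u where "u m = (if m \<in> range \<kappa> then case inv \<kappa> m of (j, i) \<Rightarrow> ell2_apply (F j) i else 0)" for m
  have u: "u (\<kappa> (j, i)) = ell2_apply (F j) i" "m \<notin> range \<kappa> \<Longrightarrow> u m = 0" for j i m
    using \<kappa> by (simp_all add: u_def)
  let ?n = "\<lambda>(j, i). (norm (ell2_apply (F j) i))\<^sup>2"
  have inner: "((\<lambda>i. (norm (ell2_apply (F j) i))\<^sup>2) has_sum (norm (ell2_apply f j))\<^sup>2) UNIV" for j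
    using square_summable_ell2_apply[of "F j"] unfolding F[symmetric] norm_ell2_sqr square_summable_def
    by (rule has_sum_infsum)
  have outer: "((\<lambda>j. (norm (ell2_apply f j))\<^sup>2) has_sum (norm f)\<^sup>2) UNIV"
    using square_summable_ell2_apply[of f] unfolding norm_ell2_sqr square_summable_def
    by (rule has_sum_infsum)
  have "?n summable_on (Sigma UNIV (\<lambda>_. UNIV))"
    by (rule summable_on_SigmaI[where g = "\<lambda>j. (norm (ell2_apply f j))\<^sup>2"])
      (use inner has_sum_imp_summable[OF outer] in auto)
  then have "(?n has_sum (norm f)\<^sup>2) (Sigma UNIV (\<lambda>_. UNIV))"
    by (intro has_sum_SigmaI[OF _ outer]) (use inner in auto)
  moreover have "?n = (\<lambda>p. (norm (u (\<kappa> p)))\<^sup>2)" by (auto simp: u(1))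
  ultimately have "((\<lambda>p. (norm (u (\<kappa> p)))\<^sup>2) has_sum (norm f)\<^sup>2) UNIV" by simp
  then have "((\<lambda>m. (norm (u m))\<^sup>2) has_sum (norm f)\<^sup>2) (range \<kappa>)"
    using has_sum_reindex[OF \<kappa>, of "\<lambda>m. (norm (u m))\<^sup>2"] by (simp add: o_def)
  then have sum: "((\<lambda>m. (norm (u m))\<^sup>2) has_sum (norm f)\<^sup>2) UNIV"
    by (rule has_sum_cong_neutral[THEN iffD1, rotated -1]) (auto simp: u(2))
  then have "square_summable u" unfolding square_summable_def by (rule has_sum_imp_summable)
  then have app: "ell2_apply (Ell2 u) = u" by (rule ell2_apply_Ell2)
  have "(norm (Ell2 u))\<^sup>2 = (norm f)\<^sup>2"
    unfolding norm_ell2_sqr app using infsumI[OF sum] by (simp add: norm_ell2_sqr)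
  then show thesis using that[of "Ell2 u"] by (simp add: app u)
qed

text \<open>U is applied in every coordinate and the resulting copies of A are relabelled by
  \<open>\<kappa>\<close>. The positions that \<open>\<kappa>\<close> misses are reserved for the
  copy of A that must not move.\<close>

lemma (in algebra_representation) exists_amplified_embedding:
  fixes \<kappa> :: "'j \<times> 'i \<Rightarrow> 'm"
  assumes A: "submodule H \<pi> A" and \<kappa>: "inj \<kappa>"
    and U: "clinear_on H (U :: 'h \<Rightarrow> ('i, 'h) ell2)" "\<And>h. h \<in> H \<Longrightarrow> norm (U h) = norm h"
      "\<And>h. h \<in> H \<Longrightarrow> U h \<in> fibre (\<lambda>_. A)" "\<And>b h. h \<in> H \<Longrightarrow> U (\<pi> b h) = amp (\<pi> b) (U h)"
  obtains V :: "('j, 'h) ell2 \<Rightarrow> ('m, 'h) ell2" where "clinear_on (fibre (\<lambda>_. H)) V"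
    "\<And>f. f \<in> fibre (\<lambda>_. H) \<Longrightarrow> norm (V f) = norm f"
    "\<And>f. f \<in> fibre (\<lambda>_. H) \<Longrightarrow> V f \<in> fibre (\<lambda>_. A)"
    "\<And>b f. f \<in> fibre (\<lambda>_. H) \<Longrightarrow> V (amp (\<pi> b) f) = amp (\<pi> b) (V f)"
    "\<And>f m. f \<in> fibre (\<lambda>_. H) \<Longrightarrow> m \<notin> range \<kappa> \<Longrightarrow> ell2_apply (V f) m = 0"
proof -
  have "\<forall>f\<in>fibre (\<lambda>_. H). \<exists>g. norm g = norm f \<and>
    (\<forall>j i. ell2_apply g (\<kappa> (j, i)) = ell2_apply (U (ell2_apply f j)) i) \<and>
    (\<forall>m. m \<notin> range \<kappa> \<longrightarrow> ell2_apply g m = 0)"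
  proof
    fix f :: "('j, 'h) ell2" assume "f \<in> fibre (\<lambda>_. H)"
    then have "norm (U (ell2_apply f j)) = norm (ell2_apply f j)" for j
      using U(2) by (simp add: fibre_def)
    from norm_ell2_spread[OF this \<kappa>]
    show "\<exists>g. norm g = norm f \<and> (\<forall>j i. ell2_apply g (\<kappa> (j, i)) = ell2_apply (U (ell2_apply f j)) i) \<and>
      (\<forall>m. m \<notin> range \<kappa> \<longrightarrow> ell2_apply g m = 0)" by metis
  qed
  then obtain V where V: "\<And>f. f \<in> fibre (\<lambda>_. H) \<Longrightarrow> norm (V f) = norm f"
    "\<And>f j i. f \<in> fibre (\<lambda>_. H) \<Longrightarrow> ell2_apply (V f) (\<kappa> (j, i)) = ell2_apply (U (ell2_apply f j)) i"
    "\<And>f m. f \<in> fibre (\<lambda>_. H) \<Longrightarrow> m \<notin> range \<kappa> \<Longrightarrow> ell2_apply (V f) m = 0"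
    by metis
  have eqI: "g = h" if "\<And>j i. ell2_apply g (\<kappa> (j, i)) = ell2_apply h (\<kappa> (j, i))"
    "\<And>m. m \<notin> range \<kappa> \<Longrightarrow> ell2_apply g m = ell2_apply h m" for g h :: "('m, 'h) ell2"
    by (rule ell2_eqI) (metis that rangeE surj_pair)
  interpret J: algebra_representation "fibre (\<lambda>_. H) :: ('j, 'h) ell2 set" "\<lambda>b. amp (\<pi> b)"
    by (rule algebra_representation_amp)
  have A0: "0 \<in> A" using hilbert_space_mem(1)[OF submoduleD(1)[OF A]] .
  have VA: "V f \<in> fibre (\<lambda>_. A)" if f: "f \<in> fibre (\<lambda>_. H)" for f
  proof -
    have "ell2_apply (V f) m \<in> A" for m
    proof (cases "m \<in> range \<kappa>")
      case True
      then obtain j i where "m = \<kappa> (j, i)" by (metis rangeE surj_pair)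
      then show ?thesis using V(2)[OF f] U(3)[OF fibre_mem[OF f]] by (simp add: fibre_def)
    qed (simp add: V(3)[OF f] A0)
    then show ?thesis by (simp add: fibre_def)
  qed
  have VH: "V f \<in> fibre (\<lambda>_. H)" if "f \<in> fibre (\<lambda>_. H)" for f
    using VA[OF that] submoduleD(3)[OF A] by (auto simp: fibre_def)
  have UH: "U h \<in> fibre (\<lambda>_. H)" if "h \<in> H" for h
    using U(3)[OF that] submoduleD(3)[OF A] by (auto simp: fibre_def)
  have pi0: "\<pi> b 0 = 0" for b using clinear_on_zero[OF pi_clinear csubspace_H] .
  show thesis
  proof (rule that[of V])
    show "clinear_on (fibre (\<lambda>_. H)) V"
      unfolding clinear_on_def
    proof (intro conjI ballI allI)
      fix f g :: "('j, 'h) ell2" and c assume f: "f \<in> fibre (\<lambda>_. H)"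
      show "V (c *\<^sub>C f) = c *\<^sub>C V f"
        using V(2,3)[OF f] V(2,3)[OF csubspaceD(3)[OF J.csubspace_H f, of c]] clinear_onD(2)[OF U(1) fibre_mem[OF f]]
        by (intro eqI) (auto simp: scaleC_ell2.rep_eq)
      assume g: "g \<in> fibre (\<lambda>_. H)"
      show "V (f + g) = V f + V g"
        using V(2,3)[OF f] V(2,3)[OF g] V(2,3)[OF csubspaceD(2)[OF J.csubspace_H f g]]
          clinear_onD(1)[OF U(1) fibre_mem[OF f] fibre_mem[OF g]]
        by (intro eqI) (auto simp: plus_ell2.rep_eq)
    qed
    show "V (amp (\<pi> b) f) = amp (\<pi> b) (V f)" if f: "f \<in> fibre (\<lambda>_. H)" for b f
      using V(2,3)[OF f] V(2,3)[OF J.pi_in[OF f, of b]] U(4)[OF fibre_mem[OF f]] fibre_mem[OF f]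
      by (intro eqI) (simp_all add: amp_apply[OF VH[OF f]] amp_apply[OF f] amp_apply[OF UH] pi0)
  qed (use V VA in auto)
qed

section \<open>Normality of amplifications\<close>

text \<open>A series functional on the amplification is a double series over pairs (n, i). Only
  countably many pairs contribute, so enumerating them turns it into a series functional on
  H.\<close>

lemma (in algebra_representation) normal_rep_amp:
  assumes normal: "normal_rep P H \<pi>"
  shows "normal_rep P (fibre (\<lambda>_. H) :: ('i, 'h) ell2 set) (\<lambda>b. amp (\<pi> b))"
proof -
  let ?L = "fibre (\<lambda>_. H) :: ('i, 'h) ell2 set"
  interpret L: algebra_representation ?L "\<lambda>b. amp (\<pi> b)" by (rule algebra_representation_amp)
  show ?thesis
  proof (rule normal_repI[OF L.pi_bounded L.hilbert_space])
    fix g h :: "nat \<Rightarrow> ('i, 'h) ell2"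
    assume gL: "range g \<subseteq> ?L" and hL: "range h \<subseteq> ?L"
      and sg: "summable (\<lambda>n. (norm (g n))\<^sup>2)" and sh: "summable (\<lambda>n. (norm (h n))\<^sup>2)"
    have g: "g n \<in> ?L" and h: "h n \<in> ?L" for n using gL hL by auto
    have double: "(\<lambda>(n, i). (norm (ell2_apply (k n) i))\<^sup>2) summable_on UNIV"
      if sk: "summable (\<lambda>n. (norm (k n))\<^sup>2)" for k :: "nat \<Rightarrow> ('i, 'h) ell2"
    proof -
      have "((\<lambda>i. (norm (ell2_apply (k n) i))\<^sup>2) has_sum (norm (k n))\<^sup>2) UNIV" for n
        using square_summable_ell2_apply[of "k n"] unfolding norm_ell2_sqr square_summable_def
        by (rule has_sum_infsum)
      moreover have "(\<lambda>n. (norm (k n))\<^sup>2) summable_on UNIV"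
        using sk by (intro norm_summable_imp_summable_on) simp
      ultimately have "(\<lambda>(n, i). (norm (ell2_apply (k n) i))\<^sup>2) summable_on (Sigma UNIV (\<lambda>_. UNIV))"
        by (intro summable_on_SigmaI) auto
      then show ?thesis by simp
    qed
    \<comment> \<open>The two supports are countable because the squared norms are summable.\<close>
    define C where "C = {p. ell2_apply (g (fst p)) (snd p) \<noteq> 0} \<union> {p. ell2_apply (h (fst p)) (snd p) \<noteq> 0}"
    have "countable {p. ell2_apply (k (fst p)) (snd p) \<noteq> 0}"
      if "summable (\<lambda>n. (norm (k n))\<^sup>2)" for k :: "nat \<Rightarrow> ('i, 'h) ell2"
      using summable_countable_real[OF double[OF that]] by (simp add: case_prod_unfold)
    then have C: "countable C" using sg sh by (simp add: C_def)
    let ?e = "to_nat_on C"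
    have e: "inj_on ?e C" by (rule inj_on_to_nat_on[OF C])
    \<comment> \<open>C may be finite, so positions outside its enumeration are filled with
      0.\<close>
    define seq where "seq k m = (if m \<in> ?e ` C then case inv_into C ?e m of (n, i) \<Rightarrow> ell2_apply (k n) i else 0)"
      for k :: "nat \<Rightarrow> ('i, 'h) ell2" and m
    have seq: "seq k (?e p) = ell2_apply (k (fst p)) (snd p)" if "p \<in> C" for k p
      using that e by (simp add: seq_def case_prod_unfold)
    have seq0: "seq k m = 0" if "m \<notin> ?e ` C" for k m using that by (simp add: seq_def)
    have seqH: "range (seq k) \<subseteq> H" if "\<And>n. k n \<in> ?L" for k
      using fibre_mem[OF that] csubspaceD(1)[OF csubspace_H] by (auto simp: seq_def split: prod.split)
    have seq_sum: "summable (\<lambda>m. (norm (seq k m))\<^sup>2)" if sk: "summable (\<lambda>n. (norm (k n))\<^sup>2)" for k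
    proof -
      have "(\<lambda>p. (norm (ell2_apply (k (fst p)) (snd p)))\<^sup>2) summable_on C"
        using summable_on_subset_banach[OF double[OF sk], of C] by (simp add: case_prod_unfold)
      then have "(\<lambda>p. (norm (seq k (?e p)))\<^sup>2) summable_on C"
        by (rule summable_on_cong[THEN iffD1, rotated]) (simp add: seq)
      then have "(\<lambda>m. (norm (seq k m))\<^sup>2) summable_on ?e ` C"
        using summable_on_reindex[OF e, of "\<lambda>m. (norm (seq k m))\<^sup>2"] by (simp add: o_def)
      then have "(\<lambda>m. (norm (seq k m))\<^sup>2) summable_on UNIV"
        by (rule summable_on_cong_neutral[THEN iffD1, rotated -1]) (auto simp: seq0)
      then show ?thesis by (rule summable_on_imp_summable)
    qed
    have eq: "(\<Sum>m. cinner (seq g m) (\<pi> b (seq h m))) = (\<Sum>n. cinner (g n) (amp (\<pi> b) (h n)))" for b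
    proof -
      obtain M where M: "M > 0" "\<And>x. x \<in> H \<Longrightarrow> norm (\<pi> b x) \<le> M * norm x"
        using bounded_clinear_on_bound[OF pi_bounded_clinear] by blast
      let ?c = "\<lambda>p. cinner (ell2_apply (g (fst p)) (snd p)) (\<pi> b (ell2_apply (h (fst p)) (snd p)))"
      \<comment> \<open>This gives absolute summability, so that the same double family may be
        summed along the enumeration of C and row by row.\<close>
      have c_le: "norm (?c p) \<le> (norm (ell2_apply (g (fst p)) (snd p)))\<^sup>2
          + M\<^sup>2 * (norm (ell2_apply (h (fst p)) (snd p)))\<^sup>2" for p
      proof -
        let ?x = "ell2_apply (g (fst p)) (snd p)" and ?y = "ell2_apply (h (fst p)) (snd p)"
        have "norm (?c p) \<le> norm ?x * norm (\<pi> b ?y)" by (rule cinner_cauchy_schwarz)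
        also have "\<dots> \<le> norm ?x * (M * norm ?y)"
          by (intro mult_left_mono M fibre_mem h) simp
        also have "\<dots> \<le> (norm ?x)\<^sup>2 + (M * norm ?y)\<^sup>2"
        proof -
          have "0 \<le> norm ?x * (M * norm ?y)" using M(1) by simp
          then show ?thesis using sum_squares_bound[of "norm ?x" "M * norm ?y"] by linarith
        qed
        finally show ?thesis by (simp add: power_mult_distrib)
      qed
      have "(\<lambda>p. (norm (ell2_apply (g (fst p)) (snd p)))\<^sup>2 + M\<^sup>2 * (norm (ell2_apply (h (fst p)) (snd p)))\<^sup>2)
          summable_on UNIV"
        using double[OF sg] double[OF sh]
        by (intro summable_on_add summable_on_cmult_right) (simp_all add: case_prod_unfold)
      then have abs: "(\<lambda>p. norm (?c p)) summable_on UNIV"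
        by (rule Infinite_Sum.abs_summable_on_comparison_test') (rule c_le)
      then have sum: "?c summable_on UNIV" by (rule abs_summable_summable)
      have pi0: "\<pi> b 0 = 0" using clinear_on_zero[OF pi_clinear csubspace_H] .
      have "(?c has_sum infsum ?c UNIV) UNIV" using sum by (rule has_sum_infsum)
      then have "(?c has_sum infsum ?c UNIV) C"
        by (rule has_sum_cong_neutral[THEN iffD1, rotated -1]) (auto simp: C_def pi0)
      then have "((\<lambda>p. cinner (seq g (?e p)) (\<pi> b (seq h (?e p)))) has_sum infsum ?c UNIV) C"
        by (rule has_sum_cong[THEN iffD1, rotated]) (simp add: seq)
      then have "((\<lambda>m. cinner (seq g m) (\<pi> b (seq h m))) has_sum infsum ?c UNIV) (?e ` C)"
        using has_sum_reindex[OF e, of "\<lambda>m. cinner (seq g m) (\<pi> b (seq h m))"] by (simp add: o_def)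
      then have "((\<lambda>m. cinner (seq g m) (\<pi> b (seq h m))) has_sum infsum ?c UNIV) UNIV"
        by (rule has_sum_cong_neutral[THEN iffD1, rotated -1]) (auto simp: seq0 pi0)
      from sums_unique[OF has_sum_imp_sums[OF this]]
      have 1: "(\<Sum>m. cinner (seq g m) (\<pi> b (seq h m))) = infsum ?c UNIV" by (rule sym)
      have inner: "((\<lambda>i. ?c (n, i)) has_sum cinner (g n) (amp (\<pi> b) (h n))) UNIV" for n
      proof -
        have "(\<lambda>i. cinner (ell2_apply (g n) i) (ell2_apply (amp (\<pi> b) (h n)) i)) summable_on UNIV"
          by (rule summable_cinner) (rule square_summable_ell2_apply)+
        then show ?thesis
          unfolding cinner_ell2.rep_eq by (simp add: amp_apply[OF h] has_sum_infsum)
      qed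
      have "((\<lambda>n. cinner (g n) (amp (\<pi> b) (h n))) has_sum infsum ?c UNIV) UNIV"
      proof (rule has_sum_SigmaD[OF _ inner])
        show "(?c has_sum infsum ?c UNIV) (Sigma UNIV (\<lambda>_. UNIV))" using sum by (simp add: has_sum_infsum)
      qed
      from sums_unique[OF has_sum_imp_sums[OF this]]
      have "(\<Sum>n. cinner (g n) (amp (\<pi> b) (h n))) = infsum ?c UNIV" by (rule sym)
      then show ?thesis using 1 by simp
    qed
    have "continuous_map (sigma_weak P) euclidean (\<lambda>b. \<Sum>m. cinner (seq g m) (\<pi> b (seq h m)))"
      by (rule normal_rep_series[OF normal seqH seqH seq_sum seq_sum]) (use g h sg sh in auto)
    then show "continuous_map (sigma_weak P) euclidean (\<lambda>b. \<Sum>n. cinner (g n) (amp (\<pi> b) (h n)))"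
      unfolding eq .
  qed
qed

section \<open>Extension to a nondegenerate representation\<close>

text \<open>\<open>nat \<times> 'g\<close> is infinite even for finite \<open>'g\<close>, hence
  equinumerous with its square. The shift by \<open>Suc\<close> keeps layer 0 free.\<close>

lemma exists_index_injection:
  obtains \<kappa> :: "(nat \<times> 'g) \<times> 'g \<Rightarrow> nat \<times> 'g" where "inj \<kappa>" "\<And>s. (0, s) \<notin> range \<kappa>"
proof -
  have "infinite (UNIV :: (nat \<times> 'g) set)" by (simp add: finite_prod)
  from card_of_Times_same_infinite[OF this]
  have "\<exists>f. bij_betw f ((UNIV :: (nat \<times> 'g) set) \<times> (UNIV :: (nat \<times> 'g) set)) (UNIV :: (nat \<times> 'g) set)"
    unfolding card_of_ordIso .
  then obtain f :: "(nat \<times> 'g) \<times> (nat \<times> 'g) \<Rightarrow> nat \<times> 'g" where "bij_betw f (UNIV \<times> UNIV) UNIV"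
    by blast
  then have f: "inj f" by (simp add: bij_betw_def)
  define \<kappa> where "\<kappa> p = (Suc (fst (f (fst p, (0, snd p)))), snd (f (fst p, (0, snd p))))"
    for p :: "(nat \<times> 'g) \<times> 'g"
  have "inj \<kappa>"
  proof (rule injI)
    fix p q assume "\<kappa> p = \<kappa> q"
    then have "f (fst p, (0, snd p)) = f (fst q, (0, snd q))" by (simp add: \<kappa>_def prod_eq_iff)
    from injD[OF f this] show "p = q" by (simp add: prod_eq_iff)
  qed
  then show thesis by (rule that) (auto simp: \<kappa>_def)
qed

section \<open>Faithfulness on the closed range of the representation\<close>

context wstar_correspondence
begin

lemma ip_rmult_lmult: "ip y (lmult b (rmult x b')) = ip y (lmult b x) * b'"
  using ip_lmult[of "star b" y "rmult x b'"] ip_lmult[of "star b" y x]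
  by (simp add: star_star ip_rmult_right)

text \<open>The right action is not assumed unital. With y = \<open>lmult b x\<close> the hypothesis
  gives \<open>ip y y * b' = 0\<close> for all b'; the choice b' = \<open>ip y y\<close> and the
  C*-identity finish.\<close>

lemma lmult_eq_zeroI:
  assumes "\<And>b'. lmult b (rmult x b') = 0"
  shows "lmult b x = 0"
proof (rule ip_definite)
  let ?y = "lmult b x"
  have ip0: "ip ?y 0 = 0" using ip_scaleC_right[of ?y 0 0] by simp
  have "ip ?y ?y * b' = 0" for b'
    using ip_rmult_lmult[of ?y b x b'] assms ip0 by simp
  then have "star (ip ?y ?y) * ip ?y ?y = 0" by (simp add: star_ip)
  then show "ip ?y ?y = 0" using norm_star_mult[of "ip ?y ?y"] by simp
qed

lemma lmult_zero: "lmult 0 x = 0"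
  using lmult_scaleC_left[of 0 0 x] by simp

end

lemma faithful_rep_eq_zero:
  assumes "algebra_representation H \<pi>" "faithful_rep H \<pi>" "\<And>h. h \<in> H \<Longrightarrow> \<pi> b h = 0"
  shows "b = 0"
proof -
  interpret algebra_representation H \<pi> by fact
  have "restrict (\<pi> b) H = restrict (\<pi> 0) H" by (rule restrict_ext) (simp add: assms(3) pi_zero)
  then show ?thesis using assms(2) by (auto simp: faithful_rep_def dest: injD)
qed

context correspondence_representation
begin

lemma eta_bounded_clinear: "bounded_clinear_on H (\<eta> x)"
  and eta_in: "h \<in> H \<Longrightarrow> \<eta> x h \<in> H"
  using eta_bounded by (force simp: bounded_operators_def)+

text \<open>The space called A in the overview.\<close>

definition eta_range :: "'h set" where
  "eta_range = closure (cspan {\<eta> x h | x h. h \<in> H})"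

lemma eta_in_range: "h \<in> H \<Longrightarrow> \<eta> x h \<in> eta_range"
  unfolding eta_range_def
  by (rule subsetD[OF order_trans[OF cspan_superset closure_subset]]) blast

text \<open>The bimodule relation moves \<open>\<pi> b\<close> inside \<open>\<eta>\<close> only
  when some \<open>\<pi> b'\<close> stands on the right. This is arranged by approximating h from
  its own orbit, using \<open>mem_closure_orbit\<close>.\<close>

lemma submodule_eta_range: "submodule H \<pi> eta_range"
proof -
  let ?N = "{\<eta> x h | x h. h \<in> H}"
  have NH: "cspan ?N \<subseteq> H" by (rule cspan_minimal[OF _ csubspace_H]) (use eta_in in auto)
  have AH: "eta_range \<subseteq> H"
    unfolding eta_range_def using NH hilbert_spaceD(2)[OF hilbert_space] by (rule closure_minimal)
  have hA: "hilbert_space eta_range"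
    unfolding eta_range_def by (rule hilbert_space_closure[OF csubspace_cspan])
  have gen: "\<pi> b (\<eta> x h) \<in> eta_range" if h: "h \<in> H" for b x h
  proof -
    let ?O = "range (\<lambda>b'. \<pi> b' h)"
    have OH: "closure ?O \<subseteq> H" using submoduleD(2)[OF submodule_orbit[OF h]] .
    have "\<eta> x h \<in> closure (\<eta> x ` ?O)"
      by (rule bounded_clinear_on_closure[OF eta_bounded_clinear csubspace_H OH _ mem_closure_orbit[OF h]]) simp
    moreover have "closure (\<eta> x ` ?O) \<subseteq> H"
      by (rule closure_minimal[OF _ hilbert_spaceD(2)[OF hilbert_space]]) (use h pi_in eta_in in auto)
    moreover have "\<pi> b y \<in> eta_range" if "y \<in> \<eta> x ` ?O" for y
      using that h eta_in_range by (auto simp: eta_bimodule[symmetric])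
    ultimately have "\<pi> b (\<eta> x h) \<in> closure eta_range"
      by (intro bounded_clinear_on_closure[OF pi_bounded_clinear csubspace_H])
    then show ?thesis by (simp add: eta_range_def)
  qed
  have "\<pi> b y \<in> eta_range" if y: "y \<in> cspan ?N" for b y
  proof -
    have "cspan ?N \<subseteq> {y \<in> H. \<pi> b y \<in> eta_range}"
    proof (rule cspan_minimal)
      show "?N \<subseteq> {y \<in> H. \<pi> b y \<in> eta_range}" using gen eta_in by blast
      show "csubspace {y \<in> H. \<pi> b y \<in> eta_range}"
        unfolding csubspace_def
        using csubspaceD(1-3)[OF csubspace_H] hilbert_space_mem(1-3)[OF hA] clinear_onD[OF pi_clinear]
          clinear_on_zero[OF pi_clinear csubspace_H] by auto
    qed
    then show ?thesis using y by blast
  qed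
  then have "\<pi> b y \<in> closure eta_range" if "y \<in> closure (cspan ?N)" for b y
    by (rule bounded_clinear_on_closure[OF pi_bounded_clinear csubspace_H AH[unfolded eta_range_def] _ that])
  then show ?thesis using hA AH by (simp add: submodule_def eta_range_def)
qed

lemma eta_range_eq_zeroI:
  assumes k: "k \<in> eta_range" and "\<And>x h. h \<in> H \<Longrightarrow> cinner (\<eta> x h) k = 0"
  shows "k = 0"
proof -
  have "eta_range \<subseteq> {h. \<forall>n\<in>{k}. cinner n h = 0}"
    unfolding eta_range_def
    by (intro closure_minimal cspan_minimal hilbert_spaceD[OF hilbert_space_orthogonal])
      (use assms(2) cinner_eq_zero_comm in auto)
  then have "cinner k k = 0" using k by blast
  then show ?thesis by simp
qed

text \<open>If \<open>\<pi> b\<close> kills the values of \<open>\<eta>\<close>, then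
  \<open>\<eta>\<close> vanishes at each bxb', hence so does \<open>\<pi>\<close> at the inner
  square of bxb'. Faithfulness of \<open>\<pi>\<close> gives bxb' = 0, and faithfulness of E gives b
  = 0.\<close>

lemma eta_range_faithful:
  assumes E: "faithful_wstar_correspondence P lmult rmult ip" and faithful: "faithful_rep H \<pi>"
    and 0: "\<And>a. a \<in> eta_range \<Longrightarrow> \<pi> b a = 0"
  shows "b = 0"
proof -
  interpret E: faithful_wstar_correspondence P lmult rmult ip by fact
  have "lmult b (rmult x b') = 0" for x b'
  proof (rule E.ip_definite, rule faithful_rep_eq_zero[OF algebra_representation_axioms faithful])
    let ?z = "lmult b (rmult x b')"
    fix k assume k: "k \<in> H"
    have z0: "\<eta> ?z h = 0" if "h \<in> H" for h
      using that 0[OF eta_in_range[OF pi_in]] by (simp add: eta_bimodule)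
    have "\<pi> (ip ?z ?z) k \<in> H" by (rule pi_in[OF k])
    then have "cinner (\<pi> (ip ?z ?z) k) (\<pi> (ip ?z ?z) k) = 0"
      using eta_ip[OF _ k, of "\<pi> (ip ?z ?z) k" ?z ?z] z0 k by simp
    then show "\<pi> (ip ?z ?z) k = 0" by simp
  qed
  then have "lmult b = lmult 0" using E.lmult_eq_zeroI E.lmult_zero by (intro ext) metis
  then show ?thesis using E.lmult_faithful by (auto dest: injD)
qed

end

theorem theorem8p8:
  fixes P :: "('b::cstar_algebra \<Rightarrow>\<^sub>L complex) set"
    and lmult :: "'b \<Rightarrow> 'e::complex_banach \<Rightarrow> 'e"
    and rmult :: "'e \<Rightarrow> 'b \<Rightarrow> 'e"
    and ip :: "'e \<Rightarrow> 'e \<Rightarrow> 'b"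
    and G :: "'g::complex_hilbert set"
    and \<sigma>\<^sub>0 :: "'b \<Rightarrow> 'g \<Rightarrow> 'g"
    and \<sigma> :: "'e \<Rightarrow> 'g \<Rightarrow> 'g"
  assumes "faithful_wstar_correspondence P lmult rmult ip"
    and "correspondence_representation lmult rmult ip G \<sigma>\<^sub>0 \<sigma>"
    and "normal_rep P G \<sigma>\<^sub>0"
    and "faithful_rep G \<sigma>\<^sub>0"
  shows "\<exists>(H :: (nat \<times> 'g, 'g) ell2 set) V \<tau>\<^sub>0 \<tau>.
    isometric_embedding G H V \<and>
    correspondence_representation lmult rmult ip H \<tau>\<^sub>0 \<tau> \<and>
    normal_rep P H \<tau>\<^sub>0 \<and> nondegenerate_rep H \<tau> \<and> faithful_rep H \<tau>\<^sub>0 \<and>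
    (\<forall>x. \<forall>g\<in>G. \<tau> x (V g) = V (\<sigma> x g)) \<and>
    (\<forall>b. \<forall>g\<in>G. \<tau>\<^sub>0 b (V g) = V (\<sigma>\<^sub>0 b g))"
proof -
  interpret E: faithful_wstar_correspondence P lmult rmult ip by fact
  interpret R: correspondence_representation lmult rmult ip G \<sigma>\<^sub>0 \<sigma> by fact
  let ?L = "fibre (\<lambda>_. G) :: (nat \<times> 'g, 'g) ell2 set"
  interpret L: algebra_representation ?L "\<lambda>b. amp (\<sigma>\<^sub>0 b)" by (rule R.algebra_representation_amp)
  let ?A = R.eta_range
  note A = R.submodule_eta_range
  note hA = submoduleD(1)[OF A] and AG = submoduleD(3)[OF A]
  have "\<exists>d'\<in>D. d' \<noteq> 0 \<and> (\<exists>k\<in>?A. \<forall>b. norm (\<sigma>\<^sub>0 b d') = norm (\<sigma>\<^sub>0 b k))"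
    if D: "submodule G \<sigma>\<^sub>0 D" and d: "d \<in> D" "d \<noteq> 0" for D d
  proof -
    obtain T T' a where T: "intertwining_adjoints \<sigma>\<^sub>0 ?A D T T'" "a \<in> ?A" "T a \<noteq> 0"
      using R.exists_intertwining_adjoints[OF E.predual assms(3) A D
          R.eta_range_faithful[OF assms(1,4)] d] by blast
    show ?thesis using R.exists_equal_orbit_norms[OF A D T] by metis
  qed
  then obtain U :: "'g \<Rightarrow> ('g, 'g) ell2" where U: "clinear_on G U"
    "\<And>h. h \<in> G \<Longrightarrow> norm (U h) = norm h" "\<And>h. h \<in> G \<Longrightarrow> U h \<in> fibre (\<lambda>_. ?A)"
    "\<And>b h. h \<in> G \<Longrightarrow> U (\<sigma>\<^sub>0 b h) = amp (\<sigma>\<^sub>0 b) (U h)"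
    using R.exists_embedding[OF A] by blast
  obtain \<kappa> :: "(nat \<times> 'g) \<times> 'g \<Rightarrow> nat \<times> 'g" where \<kappa>: "inj \<kappa>" "\<And>s. (0, s) \<notin> range \<kappa>"
    using exists_index_injection by blast
  let ?o = "(0, 0) :: nat \<times> 'g"
  obtain V0 :: "(nat \<times> 'g, 'g) ell2 \<Rightarrow> (nat \<times> 'g, 'g) ell2" where V0: "clinear_on ?L V0"
    "\<And>f. f \<in> ?L \<Longrightarrow> norm (V0 f) = norm f" "\<And>f. f \<in> ?L \<Longrightarrow> V0 f \<in> fibre (\<lambda>_. ?A)"
    "\<And>b f. f \<in> ?L \<Longrightarrow> V0 (amp (\<sigma>\<^sub>0 b) f) = amp (\<sigma>\<^sub>0 b) (V0 f)"
    "\<And>f. f \<in> ?L \<Longrightarrow> ell2_apply (V0 f) ?o = 0"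
    using R.exists_amplified_embedding[OF A \<kappa>(1) U] \<kappa>(2) by metis
  let ?Y = "fibre (\<lambda>_. ?A) :: (nat \<times> 'g, 'g) ell2 set"
  have YL: "f \<in> ?L" if "f \<in> ?Y" for f using that AG by (auto simp: fibre_def)
  have hY: "hilbert_space ?Y" by (rule hilbert_space_fibre[OF hA])
  have Y: "submodule ?L (\<lambda>b. amp (\<sigma>\<^sub>0 b)) ?Y"
    unfolding submodule_def
    using hY YL submoduleD(4)[OF A] by (auto simp: fibre_def R.amp_apply[OF YL])
  define p where "p f = delta ?o (proj ?A (ell2_apply f ?o))" for f
  have pA: "proj ?A g \<in> ?A" for g by (rule proj_in[OF hA])
  have deltaY: "delta i a \<in> ?Y" if "a \<in> ?A" for i a
    using that hilbert_space_mem(1)[OF hA] by (simp add: fibre_def ell2_apply_delta)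
  have pY: "p f \<in> ?Y" for f unfolding p_def by (rule deltaY[OF pA])
  have dL: "f - p f \<in> ?L" if "f \<in> ?L" for f by (rule csubspaceD(5)[OF L.csubspace_H that YL[OF pY]])
  have p_lin: "p (f + f') = p f + p f'" "p (c *\<^sub>C f) = c *\<^sub>C p f" for f f' c
    by (simp_all add: p_def plus_ell2.rep_eq scaleC_ell2.rep_eq proj_add[OF hA] proj_scaleC[OF hA]
        delta_add delta_scaleC)
  \<comment> \<open>V0 alone would move the copy of A at ?o. It leaves that position empty, so
    putting the identity there keeps the two summands orthogonal and V isometric.\<close>
  define V where "V f = p f + V0 (f - p f)" for f
  have V: "clinear_on ?L V"
    unfolding clinear_on_def V_def
  proof (intro conjI ballI allI)
    fix f f' c assume f: "f \<in> ?L"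
    show "p (c *\<^sub>C f) + V0 (c *\<^sub>C f - p (c *\<^sub>C f)) = c *\<^sub>C (p f + V0 (f - p f))"
      using clinear_onD(2)[OF V0(1) dL[OF f], of c]
      by (simp add: p_lin scaleC_add_right scaleC_diff_right)
    assume f': "f' \<in> ?L"
    have d: "f + f' - (p f + p f') = (f - p f) + (f' - p f')" by simp
    show "p (f + f') + V0 (f + f' - p (f + f')) = p f + V0 (f - p f) + (p f' + V0 (f' - p f'))"
      unfolding p_lin d clinear_onD(1)[OF V0(1) dL[OF f] dL[OF f']] by simp
  qed
  have norm_V: "norm (V f) = norm f" if f: "f \<in> ?L" for f
  proof -
    have "cinner (p f) (V0 (f - p f)) = 0"
      unfolding p_def[of f] cinner_delta using V0(5)[OF dL[OF f]] by (simp add: p_def)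
    moreover have "cinner (p f) (f - p f) = 0"
      using proj_orth[OF hA pA, of "ell2_apply f ?o" "ell2_apply f ?o"]
      by (simp add: p_def cinner_delta ell2_apply_diff ell2_apply_delta)
    ultimately have "(norm (V f))\<^sup>2 = (norm (p f + (f - p f)))\<^sup>2"
      unfolding V_def norm_add_sqr V0(2)[OF dL[OF f]] by simp
    then show ?thesis by simp
  qed
  have VY: "V f \<in> ?Y" if "f \<in> ?L" for f
    unfolding V_def by (rule hilbert_space_mem(2)[OF hY pY V0(3)[OF dL[OF that]]])
  have V_comm: "V (amp (\<sigma>\<^sub>0 b) f) = amp (\<sigma>\<^sub>0 b) (V f)" if f: "f \<in> ?L" for b f
  proof -
    have "p (amp (\<sigma>\<^sub>0 b) f) = amp (\<sigma>\<^sub>0 b) (p f)"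
      using R.submodule_proj[OF A R.fibre_mem[OF f]] AG[OF pA]
      by (simp add: p_def R.amp_apply[OF f] amp_delta[OF R.pi_bounded_clinear R.csubspace_H])
    then have "V (amp (\<sigma>\<^sub>0 b) f) = amp (\<sigma>\<^sub>0 b) (p f) + V0 (amp (\<sigma>\<^sub>0 b) (f - p f))"
      using clinear_on_diff[OF L.pi_clinear L.csubspace_H f YL[OF pY]] by (simp add: V_def)
    then show ?thesis
      using V0(4)[OF dL[OF f]] clinear_onD(1)[OF L.pi_clinear YL[OF pY] YL[OF V0(3)[OF dL[OF f]]]]
      by (simp add: V_def)
  qed
  let ?X = "delta ?o ` ?A"
  have XY: "?X \<subseteq> ?Y" using deltaY by blast
  have X_inv: "amp (\<sigma>\<^sub>0 b) x \<in> ?X" if "x \<in> ?X" for b x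
    using that submoduleD(4)[OF A] AG
    by (auto simp: amp_delta[OF R.pi_bounded_clinear R.csubspace_H])
  have V_X: "V x = x" if "x \<in> ?X" for x
  proof -
    have "p x = x" using that by (auto simp: p_def ell2_apply_delta proj_id[OF hA])
    then show ?thesis using clinear_on_zero[OF V0(1) L.csubspace_H] by (simp add: V_def)
  qed
  obtain W where W: "clinear_on ?Y W" "\<And>y. y \<in> ?Y \<Longrightarrow> norm (W y) = norm y" "W ` ?Y = ?L"
    "\<And>b y. y \<in> ?Y \<Longrightarrow> W (amp (\<sigma>\<^sub>0 b) y) = amp (\<sigma>\<^sub>0 b) (W y)" "\<And>x. x \<in> ?X \<Longrightarrow> W x = x"
    using L.schroeder_bernstein[OF Y V norm_V VY V_comm XY X_inv V_X] by blast
  have WL: "W y \<in> ?L" if "y \<in> ?Y" for y using W(3) that by blast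
  have Wc: "cinner (W y) (W y') = cinner y y'" if "y \<in> ?Y" "y' \<in> ?Y" for y y'
    by (rule isometry_cinner[OF W(1) hilbert_spaceD(1)[OF hY] W(2) that])
  note ap = ell2_apply_amp[OF R.eta_bounded_clinear R.csubspace_H]
  note ad = amp_delta[OF R.eta_bounded_clinear R.csubspace_H]
  have sY: "amp (\<sigma> x) f \<in> ?Y" if "f \<in> ?L" for x f
    using R.eta_in_range[OF R.fibre_mem[OF that]] by (simp add: fibre_def ap[OF that])
  define \<tau> where "\<tau> x f = W (amp (\<sigma> x) f)" for x f
  have \<tau>L: "\<tau> x f \<in> ?L" if "f \<in> ?L" for x f unfolding \<tau>_def by (rule WL[OF sY[OF that]])
  have \<tau>c: "cinner (\<tau> x f) (W y) = cinner (amp (\<sigma> x) f) y" if "f \<in> ?L" "y \<in> ?Y" for x f y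
    unfolding \<tau>_def by (rule Wc[OF sY[OF that(1)] that(2)])
  \<comment> \<open>The bimodule relation uses that W commutes with the algebra, the inner product
    relation that W is isometric.\<close>
  have "correspondence_representation lmult rmult ip ?L (\<lambda>b. amp (\<sigma>\<^sub>0 b)) \<tau>"
  proof (unfold_locales)
    show "\<tau> x \<in> bounded_operators ?L" for x
    proof -
      have b: "bounded_clinear_on ?L (amp (\<sigma> x))"
        by (rule amp_bounded_clinear[OF R.eta_bounded_clinear R.csubspace_H])
      then obtain M where "\<And>f. f \<in> ?L \<Longrightarrow> norm (amp (\<sigma> x) f) \<le> M * norm f"
        using bounded_clinear_on_bound[OF b] by blast
      then have "norm (\<tau> x f) \<le> M * norm f" if "f \<in> ?L" for f
        using W(2)[OF sY[OF that]] that by (simp add: \<tau>_def)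
      moreover have "clinear_on ?L (amp (\<sigma> x))" using b by (simp add: bounded_clinear_on_def)
      then have "clinear_on ?L (\<tau> x)"
        using clinear_onD[OF W(1)] sY by (auto simp: clinear_on_def \<tau>_def)
      ultimately show ?thesis using \<tau>L by (auto simp: bounded_operators_def bounded_clinear_on_def)
    qed
    fix f k assume f: "f \<in> ?L"
    show "\<tau> (x + y) f = \<tau> x f + \<tau> y f" for x y
    proof -
      have "amp (\<sigma> (x + y)) f = amp (\<sigma> x) f + amp (\<sigma> y) f"
        by (rule ell2_eqI) (simp add: ap[OF f] plus_ell2.rep_eq R.eta_add R.fibre_mem[OF f])
      then show ?thesis using clinear_onD(1)[OF W(1) sY[OF f] sY[OF f]] by (simp add: \<tau>_def)
    qed
    show "\<tau> (c *\<^sub>C x) f = c *\<^sub>C \<tau> x f" for c x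
    proof -
      have "amp (\<sigma> (c *\<^sub>C x)) f = c *\<^sub>C amp (\<sigma> x) f"
        by (rule ell2_eqI) (simp add: ap[OF f] scaleC_ell2.rep_eq R.eta_scaleC R.fibre_mem[OF f])
      then show ?thesis using clinear_onD(2)[OF W(1) sY[OF f]] by (simp add: \<tau>_def)
    qed
    show "\<tau> (lmult b (rmult x b')) f = amp (\<sigma>\<^sub>0 b) (\<tau> x (amp (\<sigma>\<^sub>0 b') f))" for b x b'
    proof -
      have f': "amp (\<sigma>\<^sub>0 b') f \<in> ?L" by (rule L.pi_in[OF f])
      have "amp (\<sigma> (lmult b (rmult x b'))) f = amp (\<sigma>\<^sub>0 b) (amp (\<sigma> x) (amp (\<sigma>\<^sub>0 b') f))"
        by (rule ell2_eqI)
          (simp add: ap[OF f] ap[OF f'] R.amp_apply[OF f] R.amp_apply[OF YL[OF sY[OF f']]]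
            R.eta_bimodule R.fibre_mem[OF f])
      then show ?thesis using W(4)[OF sY[OF f']] by (simp add: \<tau>_def)
    qed
    assume k: "k \<in> ?L"
    show "cinner (\<tau> x f) (\<tau> y k) = cinner f (amp (\<sigma>\<^sub>0 (ip x y)) k)" for x y
    proof -
      have "cinner (\<tau> x f) (\<tau> y k) = cinner (amp (\<sigma> x) f) (amp (\<sigma> y) k)"
        unfolding \<tau>_def[of y] by (rule \<tau>c[OF f sY[OF k]])
      also have "\<dots> = cinner f (amp (\<sigma>\<^sub>0 (ip x y)) k)"
        unfolding cinner_ell2.rep_eq
        by (rule infsum_cong) (simp add: ap[OF f] ap[OF k] R.amp_apply[OF k] R.eta_ip R.fibre_mem f k)
      finally show ?thesis .
    qed
  qed
  moreover have "isometric_embedding G ?L (delta ?o)"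
    using R.delta_in_fibre
    by (auto simp: isometric_embedding_def clinear_on_def delta_add delta_scaleC norm_delta)
  moreover have "normal_rep P ?L (\<lambda>b. amp (\<sigma>\<^sub>0 b))" by (rule R.normal_rep_amp[OF assms(3)])
  moreover have "nondegenerate_rep ?L \<tau>"
    unfolding nondegenerate_rep_def
  proof (rule closure_eqI_orthogonal[OF L.hilbert_space csubspace_cspan])
    show "cspan {\<tau> x f |x f. f \<in> ?L} \<subseteq> ?L"
      by (rule cspan_minimal[OF _ L.csubspace_H]) (use \<tau>L in auto)
    fix k assume k: "k \<in> ?L" "\<And>n. n \<in> cspan {\<tau> x f |x f. f \<in> ?L} \<Longrightarrow> cinner n k = 0"
    \<comment> \<open>As W is onto, orthogonality of k to the values of \<open>\<tau>\<close> pulls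
      back to orthogonality of each coordinate of y to the values of \<open>\<sigma>\<close>; these
      coordinates lie in A.\<close>
    obtain y where y: "y \<in> ?Y" "k = W y" using k(1) W(3) by blast
    have "ell2_apply y i = 0" for i
    proof (rule R.eta_range_eq_zeroI)
      show "ell2_apply y i \<in> ?A" using y(1) unfolding fibre_def by blast
      fix x h assume h: "h \<in> G"
      have "\<tau> x (delta i h) \<in> cspan {\<tau> x f |x f. f \<in> ?L}"
      proof (rule subsetD[OF cspan_superset], intro CollectI exI conjI)
        show "delta i h \<in> ?L" by (rule R.delta_in_fibre[OF h])
      qed (rule refl)
      from k(2)[OF this] have "cinner (\<tau> x (delta i h)) (W y) = 0" unfolding y(2) .
      then show "cinner (\<sigma> x h) (ell2_apply y i) = 0"
        using \<tau>c[OF R.delta_in_fibre[OF h] y(1)] by (simp add: ad[OF h] cinner_delta)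
    qed
    then have "y = 0" by (auto intro!: ell2_eqI simp: zero_ell2.rep_eq)
    then show "k = 0" using y W(2)[OF y(1)] by simp
  qed
  moreover have "faithful_rep ?L (\<lambda>b. amp (\<sigma>\<^sub>0 b))"
    unfolding faithful_rep_def
  proof (rule injI)
    fix b b' assume eq: "restrict (amp (\<sigma>\<^sub>0 b)) ?L = restrict (amp (\<sigma>\<^sub>0 b')) ?L"
    have "\<sigma>\<^sub>0 (b - b') g = 0" if g: "g \<in> G" for g
    proof -
      have "amp (\<sigma>\<^sub>0 b) (delta ?o g) = amp (\<sigma>\<^sub>0 b') (delta ?o g)"
        using fun_cong[OF eq, of "delta ?o g"] unfolding restrict_apply'[OF R.delta_in_fibre[OF g]] .
      then have "ell2_apply (delta ?o (\<sigma>\<^sub>0 b g)) ?o = ell2_apply (delta ?o (\<sigma>\<^sub>0 b' g)) ?o"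
        by (simp add: amp_delta[OF R.pi_bounded_clinear R.csubspace_H g])
      then show ?thesis by (simp add: ell2_apply_delta R.pi_diff[OF g])
    qed
    then have "b - b' = 0" by (rule faithful_rep_eq_zero[OF R.algebra_representation_axioms assms(4)])
    then show "b = b'" by simp
  qed
  \<comment> \<open>\<open>\<sigma> x g\<close> lies in A, so its copy at ?o belongs to the set
    fixed by W.\<close>
  moreover have "\<tau> x (delta ?o g) = delta ?o (\<sigma> x g)" if "g \<in> G" for x g
    unfolding \<tau>_def ad[OF that] by (rule W(5)) (use R.eta_in_range[OF that] in blast)
  moreover have "amp (\<sigma>\<^sub>0 b) (delta ?o g) = delta ?o (\<sigma>\<^sub>0 b g)" if "g \<in> G" for b g
    by (rule amp_delta[OF R.pi_bounded_clinear R.csubspace_H that])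
  ultimately show ?thesis by blast
qed

end
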